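(* Let $n\ge 2$ and let $\int:A_u(n)\to\mathbb{C}$ be the Haar functional of $A_u(n)$. (i) If $a=a_1a_2\cdots a_{2k}$ is a word in the letters $\alpha,\beta$ containing as many $\alpha$'s as $\beta$'s, then for all indices $i_1,\dots,i_{2k},j_1,\dots,j_{2k}\in\{1,\dots,n\}$, $$\int v_{i_1j_1}^{a_1}\cdots v_{i_{2k}j_{2k}}^{a_{2k}}=\sum_{p,q\in D(a)}\delta_{pi}\,\delta_{qj}\,W_{an}(p,q).$$ (ii) If $a=a_1\cdots a_l$ is a word in the letters $\alpha,\beta$ in which the number of $\alpha$'s differs from the number of $\beta$'s, then for all indices $i_1,\dots,i_l,j_1,\dots,j_l\in\{1,\dots,n\}$, $$\int v_{i_1j_1}^{a_1}\cdots v_{i_lj_l}^{a_l}=0.$$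
   Context: $A_u(n)$ is the universal (unital) $C^*$-algebra generated by $n^2$ elements $v_{ij}$, $1\le i,j\le n$, subject to the relations making both $v=(v_{ij})$ and its transpose $v^t=(v_{ji})$ unitary matrices. It is a Hopf $C^*$-algebra with comultiplication $\Delta(v_{ij})=\sum_k v_{ik}\otimes v_{kj}$. The Haar functional $\int:A_u(n)\to\mathbb{C}$ is the unique positive unital linear form satisfying $(\mathrm{id}\otimes\int)\Delta(x)=(\int\otimes \mathrm{id})\Delta(x)=(\int x)\,1$ for all $x$. Notation: $v_{ij}^{\alpha}=v_{ij}$ and $v_{ij}^{\beta}=v_{ij}^*$. For a word $a=a_1\cdots a_{2k}$ in $\alpha,\beta$, $D(a)$ is the set of non-crossing pair partitions of $\{1,\dots,2k\}$ such that each pair $\{r,t\}$ joins an $\alpha$ to a $\beta$, i.e. $a_r\ne a_t$. For $p\in D(a)$ and a multi-index $i=(i_1,\dots,i_{2k})$, $\delta_{pi}=1$ if $i_r=i_t$ for every pair $\{r,t\}$ of $p$, and $\delta_{pi}=0$ otherwise. For $p,q\in D(a)$, $l(p,q)$ is the number of connected components (loops) of the graph on $\{1,\dots,2k\}$ whose edges are the pairs of $p$ and the pairs of $q$. The Gram matrix is $G_{an}(p,q)=n^{l(p,q)}$ for $p,q\in D(a)$ (invertible for $n\geq 2$) and the Weingarten matrix is $W_{an}=G_{an}^{-1}$. *)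

theory Defs
  imports "HOL-Analysis.Analysis" "HOL-Library.Poly_Mapping" "HOL-Library.Disjoint_Sets"
begin

section \<open>Unital *-algebras and unital C*-algebras over the complex numbers\<close>

class complex_star_algebra = ring_1 +
  fixes scaleC :: "complex \<Rightarrow> 'a \<Rightarrow> 'a" (infixr "*\<^sub>C" 75)
    and star :: "'a \<Rightarrow> 'a"
  assumes scaleC_add_right: "c *\<^sub>C (x + y) = c *\<^sub>C x + c *\<^sub>C y"
    and scaleC_add_left: "(c + d) *\<^sub>C x = c *\<^sub>C x + d *\<^sub>C x"
    and scaleC_scaleC: "c *\<^sub>C (d *\<^sub>C x) = (c * d) *\<^sub>C x"
    and scaleC_one: "1 *\<^sub>C x = x"
    and mult_scaleC_left: "(c *\<^sub>C x) * y = c *\<^sub>C (x * y)"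
    and mult_scaleC_right: "x * (c *\<^sub>C y) = c *\<^sub>C (x * y)"
    and star_add: "star (x + y) = star x + star y"
    and star_scaleC: "star (c *\<^sub>C x) = cnj c *\<^sub>C star x"
    and star_mult: "star (x * y) = star y * star x"
    and star_star: "star (star x) = x"

class cstar_algebra = complex_star_algebra + real_normed_algebra_1 + banach +
  assumes scaleR_scaleC: "r *\<^sub>R x = complex_of_real r *\<^sub>C x"
    and norm_scaleC: "norm (c *\<^sub>C x) = cmod c * norm x"
    and cstar_identity: "norm (star x * x) = (norm x)\<^sup>2"

instantiation complex :: cstar_algebra
begin

definition scaleC_complex :: "complex \<Rightarrow> complex \<Rightarrow> complex" where "scaleC_complex = (*)"
definition star_complex :: "complex \<Rightarrow> complex" where "star_complex = cnj"

instance
  by standard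
     (simp_all add: scaleC_complex_def star_complex_def algebra_simps scaleR_conv_of_real norm_mult
       power2_eq_square)

end

definition star_hom :: "('a::complex_star_algebra \<Rightarrow> 'b::complex_star_algebra) \<Rightarrow> bool" where
  "star_hom f \<longleftrightarrow>
     (\<forall>x y. f (x + y) = f x + f y) \<and> (\<forall>c x. f (c *\<^sub>C x) = c *\<^sub>C f x) \<and>
     (\<forall>x y. f (x * y) = f x * f y) \<and> f 1 = 1 \<and> (\<forall>x. f (star x) = star (f x))"

definition cstar_seminorm :: "('a::complex_star_algebra \<Rightarrow> real) \<Rightarrow> bool" where
  "cstar_seminorm p \<longleftrightarrow>
     (\<forall>x. 0 \<le> p x) \<and> (\<forall>x y. p (x + y) \<le> p x + p y) \<and> (\<forall>c x. p (c *\<^sub>C x) = cmod c * p x) \<and>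
     (\<forall>x y. p (x * y) \<le> p x * p y) \<and> (\<forall>x. p (star x * x) = (p x)\<^sup>2)"


section \<open>Letters, words and the free unital *-algebra\<close>

datatype letter = Alpha | Beta

primrec flip :: "letter \<Rightarrow> letter" where
  "flip Alpha = Beta"
| "flip Beta = Alpha"

lemma flip_flip [simp]: "flip (flip a) = a"
  by (cases a) auto

text \<open>The element \<open>x\<^sup>a\<close>: \<open>x\<close> itself for the letter \<open>\<alpha>\<close>, its adjoint for the letter \<open>\<beta>\<close>.\<close>

primrec letter_pow :: "'a::complex_star_algebra \<Rightarrow> letter \<Rightarrow> 'a" where
  "letter_pow x Alpha = x"
| "letter_pow x Beta = star x"

text \<open>The free monoid on the symbols \<open>g\<^sup>\<alpha>, g\<^sup>\<beta>\<close>.  It is written additively because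
  multiplication of finitely supported functions in the library is convolution over an additive
  monoid.  The free *-algebra is its monoid algebra.\<close>

datatype 'g monomial = Monomial (symbols: "('g \<times> letter) list")

instantiation monomial :: (type) monoid_add
begin

definition zero_monomial :: "'a monomial" where
  "zero_monomial = Monomial []"

definition plus_monomial :: "'a monomial \<Rightarrow> 'a monomial \<Rightarrow> 'a monomial" where
  "plus_monomial s t = Monomial (symbols s @ symbols t)"

instance
  by standard (simp_all add: zero_monomial_def plus_monomial_def)

end

definition monomial_star :: "'g monomial \<Rightarrow> 'g monomial" where
  "monomial_star w = Monomial (rev (map (map_prod id flip) (symbols w)))"

lemma monomial_star_star [simp]: "monomial_star (monomial_star w) = w"
  by (simp add: monomial_star_def rev_map o_def prod.map_comp)

lemma monomial_star_plus: "monomial_star (s + t) = monomial_star t + monomial_star s"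
  by (simp add: monomial_star_def plus_monomial_def)

lemma inj_monomial_star [simp]: "inj monomial_star"
  by (metis injI monomial_star_star)

typedef 'g free_algebra = "UNIV :: ('g monomial \<Rightarrow>\<^sub>0 complex) set"
  morphisms coeffs free_of ..

setup_lifting type_definition_free_algebra

lemma poly_mapping_sum_single:
  "(x :: 'k \<Rightarrow>\<^sub>0 'c::comm_monoid_add)
     = (\<Sum>k\<in>Poly_Mapping.keys x. Poly_Mapping.single k (Poly_Mapping.lookup x k))"
  by (rule poly_mapping_eqI)
     (auto simp: lookup_sum lookup_single when_def not_in_keys_iff_lookup_eq_zero)

definition pm_star :: "('g monomial \<Rightarrow>\<^sub>0 complex) \<Rightarrow> ('g monomial \<Rightarrow>\<^sub>0 complex)" where
  "pm_star x = Poly_Mapping.map_key monomial_star (Poly_Mapping.map cnj x)"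

lemma lookup_pm_star:
  "Poly_Mapping.lookup (pm_star x) w = cnj (Poly_Mapping.lookup x (monomial_star w))"
  by (simp add: pm_star_def map_key.rep_eq Poly_Mapping.map.rep_eq when_def)

lemma pm_star_add: "pm_star (x + y) = pm_star x + pm_star y"
  by (rule poly_mapping_eqI) (simp add: lookup_pm_star lookup_add)

lemma pm_star_zero: "pm_star 0 = 0"
  by (rule poly_mapping_eqI) (simp add: lookup_pm_star)

lemma pm_star_sum: "pm_star (sum f A) = (\<Sum>k\<in>A. pm_star (f k))"
  by (induction A rule: infinite_finite_induct) (simp_all add: pm_star_add pm_star_zero)

lemma pm_star_single:
  "pm_star (Poly_Mapping.single w c) = Poly_Mapping.single (monomial_star w) (cnj c)"
  by (rule poly_mapping_eqI) (auto simp: lookup_pm_star lookup_single when_def)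

lemma pm_star_mult: "pm_star (x * y) = pm_star y * pm_star x"
proof -
  let ?k = Poly_Mapping.keys and ?l = Poly_Mapping.lookup and ?s = Poly_Mapping.single
  have "pm_star (x * y)
      = pm_star ((\<Sum>s\<in>?k x. ?s s (?l x s)) * (\<Sum>t\<in>?k y. ?s t (?l y t)))"
    using poly_mapping_sum_single[of x] poly_mapping_sum_single[of y] by simp
  also have "\<dots> = (\<Sum>s\<in>?k x. \<Sum>t\<in>?k y. pm_star (?s t (?l y t)) * pm_star (?s s (?l x s)))"
    by (simp add: sum_product pm_star_sum pm_star_single mult_single monomial_star_plus mult.commute)
  also have "\<dots> = pm_star (\<Sum>t\<in>?k y. ?s t (?l y t)) * pm_star (\<Sum>s\<in>?k x. ?s s (?l x s))"
    by (simp only: pm_star_sum sum_product) (rule sum.swap)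
  also have "\<dots> = pm_star y * pm_star x"
    using poly_mapping_sum_single[of x] poly_mapping_sum_single[of y] by simp
  finally show ?thesis .
qed

lemma single_zero_commute:
  fixes x :: "'g monomial \<Rightarrow>\<^sub>0 complex"
  shows "x * Poly_Mapping.single 0 c = Poly_Mapping.single 0 c * x"
proof -
  have "(\<Sum>k\<in>A. Poly_Mapping.single k (f k)) * Poly_Mapping.single 0 c
      = Poly_Mapping.single 0 c * (\<Sum>k\<in>A. Poly_Mapping.single k (f k))"
    for A and f :: "'g monomial \<Rightarrow> complex"
    by (simp add: sum_distrib_left sum_distrib_right mult_single mult.commute)
  then show ?thesis
    using poly_mapping_sum_single[of x] by metis
qed

instantiation free_algebra :: (type) complex_star_algebra
begin

lift_definition zero_free_algebra :: "'a free_algebra" is 0 .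
lift_definition one_free_algebra :: "'a free_algebra" is 1 .
lift_definition plus_free_algebra :: "'a free_algebra \<Rightarrow> 'a free_algebra \<Rightarrow> 'a free_algebra" is "(+)" .
lift_definition minus_free_algebra :: "'a free_algebra \<Rightarrow> 'a free_algebra \<Rightarrow> 'a free_algebra" is "(-)" .
lift_definition uminus_free_algebra :: "'a free_algebra \<Rightarrow> 'a free_algebra" is uminus .
lift_definition times_free_algebra :: "'a free_algebra \<Rightarrow> 'a free_algebra \<Rightarrow> 'a free_algebra" is "(*)" .
lift_definition scaleC_free_algebra :: "complex \<Rightarrow> 'a free_algebra \<Rightarrow> 'a free_algebra"
  is "\<lambda>c x. Poly_Mapping.single 0 c * x" .
lift_definition star_free_algebra :: "'a free_algebra \<Rightarrow> 'a free_algebra" is pm_star .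

instance
proof
  fix c d :: complex and x y z :: "'a free_algebra"
  show "x * y * z = x * (y * z)" by transfer (simp add: mult.assoc)
  show "1 * x = x" "x * 1 = x" by (transfer, simp)+
  show "x + y + z = x + (y + z)" by transfer (simp add: add.assoc)
  show "x + y = y + x" by transfer (simp add: add.commute)
  show "0 + x = x" by transfer simp
  show "- x + x = 0" by transfer simp
  show "x - y = x + - y" by transfer simp
  show "(x + y) * z = x * z + y * z" by transfer (simp add: algebra_simps)
  show "x * (y + z) = x * y + x * z" by transfer (simp add: algebra_simps)
  show "(0 :: 'a free_algebra) \<noteq> 1" by transfer simp
  show "c *\<^sub>C (x + y) = c *\<^sub>C x + c *\<^sub>C y" by transfer (simp add: algebra_simps)
  show "(c + d) *\<^sub>C x = c *\<^sub>C x + d *\<^sub>C x" by transfer (simp add: algebra_simps single_add)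
  show "c *\<^sub>C (d *\<^sub>C x) = (c * d) *\<^sub>C x"
    by transfer (simp add: mult.assoc[symmetric] mult_single)
  show "1 *\<^sub>C x = x" by transfer simp
  show "c *\<^sub>C x * y = c *\<^sub>C (x * y)" by transfer (simp add: mult.assoc)
  show "x * c *\<^sub>C y = c *\<^sub>C (x * y)"
    by transfer (simp add: mult.assoc[symmetric] single_zero_commute)
  show "star (x + y) = star x + star y" by transfer (rule pm_star_add)
  show "star (c *\<^sub>C x) = cnj c *\<^sub>C star x"
    by transfer (simp add: pm_star_mult pm_star_single monomial_star_def zero_monomial_def
        single_zero_commute[unfolded zero_monomial_def])
  show "star (x * y) = star y * star x" by transfer (rule pm_star_mult)
  show "star (star x) = x" by transfer (rule poly_mapping_eqI, simp add: lookup_pm_star)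
qed

end

lift_definition gen :: "'g \<Rightarrow> 'g free_algebra"
  is "\<lambda>g. Poly_Mapping.single (Monomial [(g, Alpha)]) 1" .

definition monomial_eval :: "('g \<Rightarrow> 'a::complex_star_algebra) \<Rightarrow> 'g monomial \<Rightarrow> 'a" where
  "monomial_eval u w = prod_list (map (\<lambda>(g, a). letter_pow (u g) a) (symbols w))"

text \<open>The *-homomorphism out of the free *-algebra that sends each generator \<open>g\<close> to \<open>u g\<close>.\<close>

definition free_eval :: "('g \<Rightarrow> 'a::complex_star_algebra) \<Rightarrow> 'g free_algebra \<Rightarrow> 'a" where
  "free_eval u x = (\<Sum>w\<in>Poly_Mapping.keys (coeffs x).
      Poly_Mapping.lookup (coeffs x) w *\<^sub>C monomial_eval u w)"

lemma star_hom_zero: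
  assumes "star_hom f" shows "f 0 = 0"
  using assms unfolding star_hom_def by (metis add_cancel_left_left)

lemma star_hom_sum:
  assumes "star_hom f" shows "f (sum g A) = (\<Sum>k\<in>A. f (g k))"
  using assms star_hom_zero[OF assms]
  by (induction A rule: infinite_finite_induct) (simp_all add: star_hom_def)

lemma scaleC_zero_left [simp]: "0 *\<^sub>C (x::'a::complex_star_algebra) = 0"
  using scaleC_add_left[of 0 0 x] by simp

lemma scaleC_zero_right [simp]: "c *\<^sub>C (0::'a::complex_star_algebra) = 0"
  using scaleC_add_right[of c 0 "0::'a"] by simp

lemma scaleC_sum_right:
  "c *\<^sub>C (\<Sum>k\<in>A. f k) = (\<Sum>k\<in>A. c *\<^sub>C (f k :: 'a::complex_star_algebra))"
  by (induction A rule: infinite_finite_induct) (simp_all add: scaleC_add_right)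

lemma star_zero [simp]: "star (0::'a::complex_star_algebra) = 0"
  using star_scaleC[of 0 "0::'a"] by simp

lemma star_one [simp]: "star (1::'a::complex_star_algebra) = 1"
  by (metis mult.right_neutral mult.left_neutral star_mult star_star)

lemma star_sum:
  "star (\<Sum>k\<in>A. f k) = (\<Sum>k\<in>A. star (f k :: 'a::complex_star_algebra))"
  by (induction A rule: infinite_finite_induct) (simp_all add: star_add)

lemma monomial_eval_plus: "monomial_eval u (s + t) = monomial_eval u s * monomial_eval u t"
  by (simp add: monomial_eval_def plus_monomial_def)

lemma monomial_eval_zero: "monomial_eval u 0 = 1"
  by (simp add: monomial_eval_def zero_monomial_def)

lemma monomial_eval_star: "monomial_eval u (monomial_star w) = star (monomial_eval u w)"
proof -
  have *: "letter_pow x (flip a) = star (letter_pow x a)" for x :: "'c::complex_star_algebra" and a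
    by (cases a) (simp_all add: star_star)
  have "prod_list (map (\<lambda>(g, a). letter_pow (u g) a) (rev (map (map_prod id flip) l)))
      = star (prod_list (map (\<lambda>(g, a). letter_pow (u g) a) l))" for l
    by (induction l) (auto simp: star_mult *)
  then show ?thesis by (simp add: monomial_eval_def monomial_star_def)
qed

definition pm_eval :: "('g \<Rightarrow> 'a::complex_star_algebra) \<Rightarrow> ('g monomial \<Rightarrow>\<^sub>0 complex) \<Rightarrow> 'a" where
  "pm_eval u x = (\<Sum>w\<in>Poly_Mapping.keys x. Poly_Mapping.lookup x w *\<^sub>C monomial_eval u w)"

lemma pm_eval_superset:
  assumes "finite K" "Poly_Mapping.keys x \<subseteq> K"
  shows "pm_eval u x = (\<Sum>w\<in>K. Poly_Mapping.lookup x w *\<^sub>C monomial_eval u w)"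
  unfolding pm_eval_def using assms
  by (intro sum.mono_neutral_left) (auto simp: in_keys_iff)

lemma pm_eval_add: "pm_eval u (x + y) = pm_eval u x + pm_eval u y"
proof -
  let ?K = "Poly_Mapping.keys x \<union> Poly_Mapping.keys y"
  have "Poly_Mapping.keys (x + y) \<subseteq> ?K" by (rule Poly_Mapping.keys_add)
  then show ?thesis
    by (simp add: pm_eval_superset[of ?K] lookup_add scaleC_add_left sum.distrib)
qed

lemma pm_eval_zero: "pm_eval u 0 = 0"
  by (simp add: pm_eval_def)

lemma pm_eval_sum: "pm_eval u (sum f A) = (\<Sum>k\<in>A. pm_eval u (f k))"
  by (induction A rule: infinite_finite_induct) (simp_all add: pm_eval_add pm_eval_zero)

lemma pm_eval_single: "pm_eval u (Poly_Mapping.single w c) = c *\<^sub>C monomial_eval u w"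
  by (simp add: pm_eval_def)

lemma pm_eval_mult: "pm_eval u (x * y) = pm_eval u x * pm_eval u y"
proof -
  let ?k = Poly_Mapping.keys and ?l = Poly_Mapping.lookup and ?s = Poly_Mapping.single
  have "pm_eval u (x * y)
      = pm_eval u ((\<Sum>s\<in>?k x. ?s s (?l x s)) * (\<Sum>t\<in>?k y. ?s t (?l y t)))"
    using poly_mapping_sum_single[of x] poly_mapping_sum_single[of y] by simp
  also have "\<dots> = pm_eval u x * pm_eval u y"
    by (simp add: sum_product pm_eval_sum pm_eval_single mult_single monomial_eval_plus
        pm_eval_def[of u x] pm_eval_def[of u y] mult_scaleC_left mult_scaleC_right
        scaleC_scaleC mult.commute)
  finally show ?thesis .
qed

lemma pm_eval_star: "pm_eval u (pm_star x) = star (pm_eval u x)"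
proof -
  let ?k = Poly_Mapping.keys and ?l = Poly_Mapping.lookup and ?s = Poly_Mapping.single
  have "pm_eval u (pm_star x) = pm_eval u (pm_star (\<Sum>s\<in>?k x. ?s s (?l x s)))"
    using poly_mapping_sum_single[of x] by simp
  also have "\<dots> = star (pm_eval u x)"
    by (simp add: pm_star_sum pm_star_single pm_eval_sum pm_eval_single monomial_eval_star
        pm_eval_def[of u x] star_sum star_scaleC)
  finally show ?thesis .
qed

lemma free_eval_pm_eval: "free_eval u x = pm_eval u (coeffs x)"
  by (simp add: free_eval_def pm_eval_def)

lemma star_hom_free_eval: "star_hom (free_eval u)"
  unfolding star_hom_def free_eval_pm_eval
  by (auto simp: plus_free_algebra.rep_eq times_free_algebra.rep_eq one_free_algebra.rep_eq
      scaleC_free_algebra.rep_eq star_free_algebra.rep_eq pm_eval_add pm_eval_mult pm_eval_star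
      pm_eval_single monomial_eval_zero scaleC_one mult_scaleC_left simp flip: single_one)

lemma free_eval_gen: "free_eval u (gen g) = u g"
  by (simp add: free_eval_pm_eval gen.rep_eq pm_eval_single monomial_eval_def scaleC_one)

lemma cstar_seminorm_norm_hom:
  fixes f :: "'a::complex_star_algebra \<Rightarrow> 'b::cstar_algebra"
  assumes "star_hom f"
  shows "cstar_seminorm (\<lambda>x. norm (f x))"
  using assms unfolding star_hom_def cstar_seminorm_def
  by (simp add: norm_triangle_ineq norm_scaleC norm_mult_ineq cstar_identity)

lemma star_hom_agree_free_eval:
  fixes f :: "'a::complex_star_algebra \<Rightarrow> 'b::complex_star_algebra"
  assumes f: "star_hom f" and fu: "\<And>g. f (u g) = w g"
  shows "f (free_eval u x) = free_eval w x"
proof -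
  have lp: "f (letter_pow (u g) a) = letter_pow (w g) a" for g a
    using f fu by (cases a) (simp_all add: star_hom_def)
  have pl: "f (prod_list (map (\<lambda>(g, a). letter_pow (u g) a) l))
      = prod_list (map (\<lambda>(g, a). letter_pow (w g) a) l)" for l
    using f by (induction l) (auto simp: star_hom_def lp)
  have "f (monomial_eval u m) = monomial_eval w m" for m
    by (simp add: monomial_eval_def pl)
  then show ?thesis
    using f by (simp add: free_eval_def star_hom_sum[OF f]) (simp add: star_hom_def)
qed


section \<open>Universal C*-algebras\<close>

text \<open>The C*-algebra generated by the family \<open>u\<close> is universal for the relations \<open>r = 0\<close>, \<open>r \<in> R\<close>,
  if it is the separated completion of the free *-algebra in the greatest C*-seminorm vanishing
  on \<open>R\<close>.\<close>

definition universal_cstar_algebra ::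
  "'g free_algebra set \<Rightarrow> ('g \<Rightarrow> 'a::cstar_algebra) \<Rightarrow> bool" where
  "universal_cstar_algebra R u \<longleftrightarrow>
     closure (range (free_eval u)) = UNIV \<and>
     (\<forall>r\<in>R. free_eval u r = 0) \<and>
     (\<forall>p x. cstar_seminorm p \<and> (\<forall>r\<in>R. p r = 0) \<longrightarrow> p x \<le> norm (free_eval u x))"

lemma norm_star: "norm (star (x::'a::cstar_algebra)) = norm x"
proof -
  have *: "norm y \<le> norm (star y)" for y :: 'a
  proof (cases "norm y = 0")
    case False
    have "norm y * norm y \<le> norm (star y) * norm y"
      using norm_mult_ineq[of "star y" y] cstar_identity[of y] by (simp add: power2_eq_square)
    with False show ?thesis by (simp add: mult_le_cancel_right)
  qed simp
  from *[of x] *[of "star x"] show ?thesis by (simp add: star_star)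
qed

lemma continuous_on_star [continuous_intros]:
  fixes f :: "'x::topological_space \<Rightarrow> 'a::cstar_algebra"
  assumes "continuous_on S f"
  shows "continuous_on S (\<lambda>x. star (f x))"
proof -
  have "bounded_linear (star :: 'a \<Rightarrow> 'a)"
    by (rule bounded_linear_intro[where K = 1])
       (simp_all add: star_add star_scaleC scaleR_scaleC norm_star)
  from bounded_linear.continuous_on[OF this assms] show ?thesis .
qed

lemma continuous_on_scaleC [continuous_intros]:
  fixes f :: "'x::topological_space \<Rightarrow> 'a::cstar_algebra"
  assumes "continuous_on S f"
  shows "continuous_on S (\<lambda>x. c *\<^sub>C f x)"
proof -
  have "bounded_linear (\<lambda>x::'a. c *\<^sub>C x)"
    by (rule bounded_linear_intro[where K = "cmod c"])
       (simp_all add: scaleC_add_right scaleR_scaleC scaleC_scaleC norm_scaleC mult.commute)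
  from bounded_linear.continuous_on[OF this assms] show ?thesis .
qed

lemma eq_on_dense:
  fixes f g :: "'a::topological_space \<Rightarrow> 'b::t2_space"
  assumes "closure D = UNIV" "continuous_on UNIV f" "continuous_on UNIV g" "\<And>x. x \<in> D \<Longrightarrow> f x = g x"
  shows "f x = g x"
proof -
  have "closed {x. f x = g x}" using assms(2,3) by (rule closed_Collect_eq)
  then have "closure D \<subseteq> {x. f x = g x}" using assms(4) by (intro closure_minimal) auto
  with assms(1) show ?thesis by auto
qed

text \<open>The usual universal property, with respect to C*-algebras on any type.\<close>

theorem universal_cstar_algebra_property:
  fixes u :: "'g \<Rightarrow> 'a::cstar_algebra" and w :: "'g \<Rightarrow> 'b::cstar_algebra"
  assumes univ: "universal_cstar_algebra R u" and w: "\<forall>r\<in>R. free_eval w r = 0"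
  shows "\<exists>!f. star_hom f \<and> continuous_on UNIV f \<and> (\<forall>g. f (u g) = w g)"
proof (rule ex_ex1I)
  let ?D = "range (free_eval u)"
  let ?eu = "free_eval u" and ?ew = "free_eval w"
  have dense: "closure ?D = UNIV"
    using univ by (simp add: universal_cstar_algebra_def)
  have le: "norm (?ew x) \<le> norm (?eu x)" for x
    using univ w cstar_seminorm_norm_hom[OF star_hom_free_eval[of w]]
    unfolding universal_cstar_algebra_def by auto
  have hom: "star_hom ?eu" "star_hom ?ew" by (rule star_hom_free_eval)+
  have diff: "k (x - y) = k x - k y" if "star_hom k" for k :: "'g free_algebra \<Rightarrow> 'c::cstar_algebra" and x y
    using that unfolding star_hom_def by (metis add_diff_cancel diff_add_cancel)
  have lip: "norm (?ew x - ?ew y) \<le> norm (?eu x - ?eu y)" for x y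
    using le[of "x - y"] diff[OF hom(1)] diff[OF hom(2)] by simp
  define g where "g a = ?ew (SOME x. ?eu x = a)" for a
  have g: "g (?eu x) = ?ew x" for x
  proof -
    have "?eu (SOME y. ?eu y = ?eu x) = ?eu x" by (rule someI) (rule refl)
    then show ?thesis
      using lip[of "SOME y. ?eu y = ?eu x" x] by (simp add: g_def)
  qed
  have "dist (g a) (g b) \<le> dist a b" if "a \<in> ?D" "b \<in> ?D" for a b
  proof -
    from that obtain x y where "a = ?eu x" "b = ?eu y" by blast
    then show ?thesis using lip[of x y] by (simp only: g dist_norm)
  qed
  then have uc: "uniformly_continuous_on ?D g"
    unfolding uniformly_continuous_on_def by (meson le_less_trans)
  obtain f where fu: "uniformly_continuous_on (closure ?D) f" and fg: "\<And>x. x \<in> ?D \<Longrightarrow> g x = f x"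
    by (rule uniformly_continuous_on_extension_on_closure[OF uc]) (rule that)
  have f: "f (?eu x) = ?ew x" for x using fg[of "?eu x"] g by simp
  have cont: "continuous_on UNIV f" using uniformly_continuous_imp_continuous[OF fu] by (simp only: dense)
  have cont': "continuous_on UNIV (\<lambda>x. f (k x))" if "continuous_on UNIV k" for k :: "'a \<Rightarrow> 'a"
    using continuous_on_compose2[OF cont that] by simp
  have eu: "?eu x + ?eu y = ?eu (x + y)" "?eu x * ?eu y = ?eu (x * y)" "star (?eu x) = ?eu (star x)"
    "c *\<^sub>C ?eu x = ?eu (c *\<^sub>C x)" "?eu 1 = 1" for x y c
    using hom(1) by (simp_all add: star_hom_def)
  have ew: "?ew (x + y) = ?ew x + ?ew y" "?ew (x * y) = ?ew x * ?ew y" "?ew (star x) = star (?ew x)"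
    "?ew (c *\<^sub>C x) = c *\<^sub>C ?ew x" "?ew 1 = 1" for x y c
    using hom(2) by (simp_all add: star_hom_def)
  have dense_ext: "k = l"
    if "continuous_on UNIV k" "continuous_on UNIV l" "\<And>x. k (?eu x) = l (?eu x)"
    for k l :: "'a \<Rightarrow> 'b"
    using eq_on_dense[OF dense that(1,2)] that(3) by blast
  have add1: "(\<lambda>b. f (?eu x + b)) = (\<lambda>b. ?ew x + f b)" for x
  proof (rule dense_ext)
    show "continuous_on UNIV (\<lambda>b. f (?eu x + b))" by (rule cont') (intro continuous_intros)
    show "continuous_on UNIV (\<lambda>b. ?ew x + f b)" by (intro continuous_intros cont)
  qed (simp add: eu f ew)
  have "(\<lambda>a. f (a + b)) = (\<lambda>a. f a + f b)" for b
  proof (rule dense_ext)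
    show "continuous_on UNIV (\<lambda>a. f (a + b))" by (rule cont') (intro continuous_intros)
    show "continuous_on UNIV (\<lambda>a. f a + f b)" by (intro continuous_intros cont)
  qed (simp add: fun_cong[OF add1] f)
  moreover
  have mult1: "(\<lambda>b. f (?eu x * b)) = (\<lambda>b. ?ew x * f b)" for x
  proof (rule dense_ext)
    show "continuous_on UNIV (\<lambda>b. f (?eu x * b))" by (rule cont') (intro continuous_intros)
    show "continuous_on UNIV (\<lambda>b. ?ew x * f b)" by (intro continuous_intros cont)
  qed (simp add: eu f ew)
  have "(\<lambda>a. f (a * b)) = (\<lambda>a. f a * f b)" for b
  proof (rule dense_ext)
    show "continuous_on UNIV (\<lambda>a. f (a * b))" by (rule cont') (intro continuous_intros)
    show "continuous_on UNIV (\<lambda>a. f a * f b)" by (intro continuous_intros cont)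
  qed (simp add: fun_cong[OF mult1] f)
  moreover have "(\<lambda>a. f (c *\<^sub>C a)) = (\<lambda>a. c *\<^sub>C f a)" for c
  proof (rule dense_ext)
    show "continuous_on UNIV (\<lambda>a. f (c *\<^sub>C a))" by (rule cont') (intro continuous_intros)
    show "continuous_on UNIV (\<lambda>a. c *\<^sub>C f a)" by (intro continuous_intros cont)
  qed (simp add: eu f ew)
  moreover have "(\<lambda>a. f (star a)) = (\<lambda>a. star (f a))"
  proof (rule dense_ext)
    show "continuous_on UNIV (\<lambda>a. f (star a))" by (rule cont') (intro continuous_intros)
    show "continuous_on UNIV (\<lambda>a. star (f a))" by (intro continuous_intros cont)
  qed (simp add: eu f ew)
  moreover have "f 1 = 1" using f[of 1] eu(5) ew(5) by simp
  moreover have "f (u k) = w k" for k using f[of "gen k"] by (simp add: free_eval_gen)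
  ultimately show "\<exists>f. star_hom f \<and> continuous_on UNIV f \<and> (\<forall>g. f (u g) = w g)"
    using cont unfolding star_hom_def fun_eq_iff by blast
next
  fix f f' :: "'a \<Rightarrow> 'b"
  assume *: "star_hom f \<and> continuous_on UNIV f \<and> (\<forall>g. f (u g) = w g)"
    "star_hom f' \<and> continuous_on UNIV f' \<and> (\<forall>g. f' (u g) = w g)"
  have dense: "closure (range (free_eval u)) = UNIV"
    using univ by (simp add: universal_cstar_algebra_def)
  have "f x = f' x" for x
    by (rule eq_on_dense[OF dense]) (use * in \<open>auto simp: star_hom_agree_free_eval[of _ u w]\<close>)
  then show "f = f'" by blast
qed

definition unitary_matrix_relators ::
  "('n::finite \<Rightarrow> 'n \<Rightarrow> 'a::complex_star_algebra) \<Rightarrow> 'a set" where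
  "unitary_matrix_relators u =
     {(\<Sum>k\<in>UNIV. u i k * star (u j k)) - (if i = j then 1 else 0) | i j. True} \<union>
     {(\<Sum>k\<in>UNIV. star (u k i) * u k j) - (if i = j then 1 else 0) | i j. True}"

definition biunitary_relators ::
  "('n::finite \<Rightarrow> 'n \<Rightarrow> 'a::complex_star_algebra) \<Rightarrow> 'a set" where
  "biunitary_relators u = unitary_matrix_relators u \<union> unitary_matrix_relators (\<lambda>i j. u j i)"

text \<open>\<open>is_Au v\<close>: the ambient C*-algebra, with the entries of \<open>v\<close> as generators, is \<open>A\<^sub>u(n)\<close>, where
  the matrix indices range over a type with \<open>n\<close> elements.\<close>

definition is_Au :: "('n::finite \<Rightarrow> 'n \<Rightarrow> 'a::cstar_algebra) \<Rightarrow> bool" where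
  "is_Au v \<longleftrightarrow>
     universal_cstar_algebra (biunitary_relators (\<lambda>i j. gen (i, j))) (\<lambda>(i, j). v i j)"


lemma star_hom_unitary_matrix_relators:
  fixes f :: "'a::complex_star_algebra \<Rightarrow> 'b::complex_star_algebra" and u :: "'c::finite \<Rightarrow> 'c \<Rightarrow> 'a"
  assumes f: "star_hom f"
  shows "f ` unitary_matrix_relators u = unitary_matrix_relators (\<lambda>i j. f (u i j))"
proof -
  have *: "f (x * y) = f x * f y" "f (star x) = star (f x)" "f (x - y) = f x - f y" "f 1 = 1" for x y
    using f unfolding star_hom_def by (simp, simp, metis add_diff_cancel diff_add_cancel, simp)
  have if_f: "f (if P then 1 else 0) = (if P then 1 else 0)" for P
    using * star_hom_zero[OF f] by simp
  have img: "f ` {g i j | i j. True} = {f (g i j) | i j. True}" for g :: "'c \<Rightarrow> 'c \<Rightarrow> 'a"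
    by blast
  show ?thesis
    by (simp only: unitary_matrix_relators_def image_Un img * star_hom_sum[OF f] if_f)
qed

lemma is_Au_biunitary:
  fixes v :: "'n::finite \<Rightarrow> 'n \<Rightarrow> 'a::cstar_algebra"
  assumes "is_Au v"
  shows "biunitary_relators v \<subseteq> {0}"
proof -
  let ?f = "free_eval (\<lambda>(i, j). v i j)" and ?R = "biunitary_relators (\<lambda>i j. gen (i, j))"
  have "?f ` ?R = biunitary_relators v"
    by (simp add: biunitary_relators_def image_Un free_eval_gen
        star_hom_unitary_matrix_relators[OF star_hom_free_eval])
  moreover have "\<forall>r\<in>?R. ?f r = 0"
    using assms unfolding is_Au_def universal_cstar_algebra_def by (elim conjE)
  then have "?f ` ?R \<subseteq> {0}" by auto
  ultimately show ?thesis by (simp only:)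
qed

theorem is_Au_universal:
  fixes v :: "'n::finite \<Rightarrow> 'n \<Rightarrow> 'a::cstar_algebra" and w :: "'n \<Rightarrow> 'n \<Rightarrow> 'b::cstar_algebra"
  assumes "is_Au v" and w: "biunitary_relators w \<subseteq> {0}"
  shows "\<exists>!f. star_hom f \<and> continuous_on UNIV f \<and> (\<forall>i j. f (v i j) = w i j)"
proof -
  let ?f = "free_eval (\<lambda>(i, j). w i j)"
  have "?f ` biunitary_relators (\<lambda>i j. gen (i, j)) = biunitary_relators w"
    by (simp add: biunitary_relators_def image_Un free_eval_gen
        star_hom_unitary_matrix_relators[OF star_hom_free_eval])
  with w have "\<forall>r\<in>biunitary_relators (\<lambda>i j. gen (i, j)). ?f r = 0" by blast
  from universal_cstar_algebra_property[OF assms(1)[unfolded is_Au_def] this]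
  show ?thesis by simp
qed


section \<open>Tensor product, comultiplication and Haar functional\<close>

text \<open>The C*-algebra \<open>'t\<close> is the completion of the algebraic tensor product of \<open>'a\<close> and \<open>'b\<close> in
  some C*-norm, with \<open>\<iota>\<^sub>1 x = x \<otimes> 1\<close> and \<open>\<iota>\<^sub>2 y = 1 \<otimes> y\<close>.  The third condition
  says that the canonical map from the algebraic tensor product to \<open>'t\<close> is injective.  Both the
  minimal and the maximal tensor product are instances.\<close>

definition cstar_tensor ::
  "('a::cstar_algebra \<Rightarrow> 't::cstar_algebra) \<Rightarrow> ('b::cstar_algebra \<Rightarrow> 't) \<Rightarrow> bool" where
  "cstar_tensor \<iota>\<^sub>1 \<iota>\<^sub>2 \<longleftrightarrow>
     star_hom \<iota>\<^sub>1 \<and> star_hom \<iota>\<^sub>2 \<and>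
     (\<forall>x y. \<iota>\<^sub>1 x * \<iota>\<^sub>2 y = \<iota>\<^sub>2 y * \<iota>\<^sub>1 x) \<and>
     (\<forall>(m::nat) x y.
        (\<forall>c. (\<Sum>k<m. c k *\<^sub>C x k) = 0 \<longrightarrow> (\<forall>k<m. c k = 0)) \<and> (\<Sum>k<m. \<iota>\<^sub>1 (x k) * \<iota>\<^sub>2 (y k)) = 0
          \<longrightarrow> (\<forall>k<m. y k = 0)) \<and>
     closure {\<Sum>k<m. \<iota>\<^sub>1 (x k) * \<iota>\<^sub>2 (y k) | (m::nat) x y. True} = UNIV"

definition comultiplication ::
  "('n::finite \<Rightarrow> 'n \<Rightarrow> 'a::cstar_algebra) \<Rightarrow> ('a \<Rightarrow> 't::cstar_algebra) \<Rightarrow> ('a \<Rightarrow> 't)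
     \<Rightarrow> ('a \<Rightarrow> 't) \<Rightarrow> bool" where
  "comultiplication v \<iota>\<^sub>1 \<iota>\<^sub>2 \<Delta> \<longleftrightarrow>
     star_hom \<Delta> \<and> (\<forall>i j. \<Delta> (v i j) = (\<Sum>k\<in>UNIV. \<iota>\<^sub>1 (v i k) * \<iota>\<^sub>2 (v k j)))"

text \<open>\<open>S\<close> is \<open>id \<otimes> h\<close>, respectively \<open>h \<otimes> id\<close>: the bounded map determined by its values
  on elementary tensors.\<close>

definition right_slice ::
  "('a::cstar_algebra \<Rightarrow> 't::cstar_algebra) \<Rightarrow> ('b::cstar_algebra \<Rightarrow> 't) \<Rightarrow> ('b \<Rightarrow> complex)
     \<Rightarrow> ('t \<Rightarrow> 'a) \<Rightarrow> bool" where
  "right_slice \<iota>\<^sub>1 \<iota>\<^sub>2 h S \<longleftrightarrow> bounded_linear S \<and> (\<forall>x y. S (\<iota>\<^sub>1 x * \<iota>\<^sub>2 y) = h y *\<^sub>C x)"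

definition left_slice ::
  "('a::cstar_algebra \<Rightarrow> 't::cstar_algebra) \<Rightarrow> ('b::cstar_algebra \<Rightarrow> 't) \<Rightarrow> ('a \<Rightarrow> complex)
     \<Rightarrow> ('t \<Rightarrow> 'b) \<Rightarrow> bool" where
  "left_slice \<iota>\<^sub>1 \<iota>\<^sub>2 h S \<longleftrightarrow> bounded_linear S \<and> (\<forall>x y. S (\<iota>\<^sub>1 x * \<iota>\<^sub>2 y) = h x *\<^sub>C y)"

definition haar_functional ::
  "('a::cstar_algebra \<Rightarrow> 't::cstar_algebra) \<Rightarrow> ('a \<Rightarrow> 't) \<Rightarrow> ('a \<Rightarrow> 't) \<Rightarrow> ('a \<Rightarrow> complex) \<Rightarrow> bool" where
  "haar_functional \<iota>\<^sub>1 \<iota>\<^sub>2 \<Delta> h \<longleftrightarrow>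
     (\<forall>x y. h (x + y) = h x + h y) \<and> (\<forall>c x. h (c *\<^sub>C x) = c * h x) \<and>
     (\<forall>x. h (star x * x) \<in> \<real>\<^sub>\<ge>\<^sub>0) \<and> h 1 = 1 \<and>
     (\<exists>S. right_slice \<iota>\<^sub>1 \<iota>\<^sub>2 h S \<and> (\<forall>x. S (\<Delta> x) = h x *\<^sub>C 1)) \<and>
     (\<exists>S. left_slice \<iota>\<^sub>1 \<iota>\<^sub>2 h S \<and> (\<forall>x. S (\<Delta> x) = h x *\<^sub>C 1))"


section \<open>Non-crossing pairings and the Weingarten matrix\<close>

text \<open>Positions in a word are counted from \<open>0\<close>.\<close>

definition noncrossing :: "nat set set \<Rightarrow> bool" where
  "noncrossing p \<longleftrightarrow>
     (\<forall>b\<in>p. \<forall>b'\<in>p. \<forall>r s t u. r < s \<and> s < t \<and> t < u \<and> r \<in> b \<and> t \<in> b \<and> s \<in> b' \<and> u \<in> b' \<longrightarrow> b = b')"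

definition nc_pairings :: "letter list \<Rightarrow> nat set set set" where
  "nc_pairings a = {p. partition_on {..<length a} p \<and> (\<forall>b\<in>p. card b = 2) \<and> noncrossing p \<and>
     (\<forall>r t. r \<noteq> t \<and> {r, t} \<in> p \<longrightarrow> a ! r \<noteq> a ! t)}"

definition pairing_delta :: "nat set set \<Rightarrow> (nat \<Rightarrow> 'n) \<Rightarrow> complex" where
  "pairing_delta p i = (if \<forall>r t. {r, t} \<in> p \<longrightarrow> i r = i t then 1 else 0)"

definition loops :: "nat \<Rightarrow> nat set set \<Rightarrow> nat set set \<Rightarrow> nat" where
  "loops m p q = card ({..<m} // {(r, t). {r, t} \<in> p \<union> q}\<^sup>*)"

definition gram :: "letter list \<Rightarrow> nat \<Rightarrow> nat set set \<Rightarrow> nat set set \<Rightarrow> complex" where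
  "gram a n p q = of_nat n ^ loops (length a) p q"

text \<open>\<open>W\<close> is the inverse of the matrix \<open>G\<close> with rows and columns indexed by \<open>D\<close>; vanishing
  outside \<open>D \<times> D\<close> makes it unique as a function.\<close>

definition inverse_matrix_on ::
  "'d set \<Rightarrow> ('d \<Rightarrow> 'd \<Rightarrow> complex) \<Rightarrow> ('d \<Rightarrow> 'd \<Rightarrow> complex) \<Rightarrow> bool" where
  "inverse_matrix_on D G W \<longleftrightarrow>
     (\<forall>p\<in>D. \<forall>q\<in>D. (\<Sum>r\<in>D. G p r * W r q) = (if p = q then 1 else 0)) \<and>
     (\<forall>p\<in>D. \<forall>q\<in>D. (\<Sum>r\<in>D. W p r * G r q) = (if p = q then 1 else 0)) \<and>
     (\<forall>p q. p \<notin> D \<or> q \<notin> D \<longrightarrow> W p q = 0)"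

definition weingarten :: "letter list \<Rightarrow> nat \<Rightarrow> nat set set \<Rightarrow> nat set set \<Rightarrow> complex" where
  "weingarten a n = (THE W. inverse_matrix_on (nc_pairings a) (gram a n) W)"

definition word_product ::
  "('n \<Rightarrow> 'n \<Rightarrow> 'a::complex_star_algebra) \<Rightarrow> letter list \<Rightarrow> (nat \<Rightarrow> 'n) \<Rightarrow> (nat \<Rightarrow> 'n) \<Rightarrow> 'a" where
  "word_product v a i j = prod_list (map (\<lambda>r. letter_pow (v (i r) (j r)) (a ! r)) [0..<length a])"

end

theory Submission
  imports Defs
begin

text \<open>For a word \<open>a\<close> let \<open>P\<^sub>a\<close> be the orthogonal projection of the corresponding tensor power of \<open>\<complex>\<^sup>n\<close>
  onto the span of the vectors \<open>\<xi>\<^sub>p\<close>, \<open>p \<in> D(a)\<close>.  Taking the matrix coefficients of \<open>P\<^sub>a\<close> as values on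
  monomials defines a linear form on the free *-algebra.  It vanishes on the ideal of the relations
  because the spans are stable under inserting and contracting adjacent pairs.  It is positive: the
  spans are the morphism spaces of a *-category, and positivity amounts to complete positivity of the
  conditional expectation of a matrix algebra onto a *-subalgebra.  The GNS construction turns it
  into a C*-seminorm, so it vanishes on everything that is zero in \<open>A\<^sub>u(n)\<close>.

  Let \<open>H\<close> be the matrix of values of the Haar functional on the coefficients of the word \<open>a\<close>.  Applying
  the form to the invariance relation gives \<open>P\<^sub>a H = H\<close>, and \<open>P\<^sub>a H = P\<^sub>a\<close> since the \<open>\<xi>\<^sub>p\<close> are fixed
  vectors.  Hence \<open>H = P\<^sub>a\<close>, and the coefficients of \<open>P\<^sub>a\<close> in the linearly independent \<open>\<xi>\<^sub>p\<close> form the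
  inverse of their Gram matrix.\<close>


section \<open>Functions on a finite set\<close>


text \<open>Unitarity shows at once that the vectors \<xi> of the pairings are fixed; the hard
  direction is that nothing else is, which is what the equation P H = H expresses. Duality theory
  would extract this from the category of non-crossing pairings. Here the category is turned
  directly into a state: if the fixed vectors are only the combinations of the \<xi>, then the
  values of the Haar functional are forced to be the entries of the projections, so these entries
  are prescribed and shown to be admissible.

  An equation in the universal C*-algebra only says that every C*-seminorm killing the relations is
  zero on the corresponding free element. Vanishing on the ideal is therefore too weak; the form has
  to be dominated by such a seminorm, hence the need for positivity and for bounded left
  multiplication.

  Positivity couples different words: the product of an adjoint monomial over \<open>u\<close> with
  a monomial over \<open>a\<close> sees the fixed vectors of \<open>dual_word u @ a\<close>, which
  by Frobenius reciprocity are the intertwiners between the two words. So all words occurring in an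
  element have to be treated together, as blocks of one matrix algebra.\<close>

definition function_subspace :: "'x set \<Rightarrow> ('x \<Rightarrow> complex) set \<Rightarrow> bool" where
  "function_subspace X S \<longleftrightarrow>
     (\<lambda>_. 0) \<in> S \<and> (\<forall>f\<in>S. \<forall>g\<in>S. (\<lambda>x. f x + g x) \<in> S) \<and>
     (\<forall>c. \<forall>f\<in>S. (\<lambda>x. c * f x) \<in> S) \<and> (\<forall>f\<in>S. \<forall>x. x \<notin> X \<longrightarrow> f x = 0)"

definition finner :: "'x set \<Rightarrow> ('x \<Rightarrow> complex) \<Rightarrow> ('x \<Rightarrow> complex) \<Rightarrow> complex" where
  "finner X f g = (\<Sum>x\<in>X. cnj (f x) * g x)"

text \<open>Only the reconstruction formula of an orthonormal basis is kept. It already makes \<Sum>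
  b(x) cnj (b(y)) the reproducing kernel of the subspace.\<close>

definition parseval_frame ::
  "'x set \<Rightarrow> ('x \<Rightarrow> complex) set \<Rightarrow> ('x \<Rightarrow> complex) set \<Rightarrow> bool" where
  "parseval_frame X S B \<longleftrightarrow>
     finite B \<and> B \<subseteq> S \<and> (\<forall>f\<in>S. \<forall>x. f x = (\<Sum>b\<in>B. finner X b f * b x))"

lemma finner_commute: "finner X f g = cnj (finner X g f)"
  by (simp add: finner_def mult.commute)

lemma finner_diff_right: "finner X f (\<lambda>x. g x - h x) = finner X f g - finner X f h"
  by (simp add: finner_def algebra_simps sum_subtractf)

lemma finner_scale_right: "finner X f (\<lambda>x. c * g x) = c * finner X f g"
  by (simp add: finner_def sum_distrib_left mult.left_commute)

lemma finner_sum_right: "finner X f (\<lambda>x. \<Sum>b\<in>B. g b x) = (\<Sum>b\<in>B. finner X f (g b))"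
  by (simp add: finner_def sum_distrib_left sum.swap[of _ B])

lemma finner_self: "finner X f f = of_real (\<Sum>x\<in>X. (cmod (f x))\<^sup>2)"
  by (simp add: finner_def complex_norm_square[symmetric] mult.commute[of "cnj _"])

lemma finner_self_eq_0:
  assumes "finite X" "finner X f f = 0" "x \<in> X"
  shows "f x = 0"
  using assms by (simp add: finner_self sum_nonneg_eq_0_iff flip: of_real_sum of_real_power)

lemma function_subspaceD:
  assumes "function_subspace X S"
  shows "(\<lambda>_. 0) \<in> S" "f \<in> S \<Longrightarrow> g \<in> S \<Longrightarrow> (\<lambda>x. f x + g x) \<in> S" "f \<in> S \<Longrightarrow> (\<lambda>x. c * f x) \<in> S"
    "f \<in> S \<Longrightarrow> x \<notin> X \<Longrightarrow> f x = 0"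
  using assms by (auto simp: function_subspace_def)

lemma function_subspace_sum:
  assumes "function_subspace X S" "\<And>b. b \<in> B \<Longrightarrow> g b \<in> S"
  shows "(\<lambda>x. \<Sum>b\<in>B. c b * g b x) \<in> S"
  using assms(2)
  by (induction B rule: infinite_finite_induct)
     (simp_all add: function_subspaceD[OF assms(1)])

lemma function_subspace_diff:
  assumes "function_subspace X S" "f \<in> S" "g \<in> S"
  shows "(\<lambda>x. f x - g x) \<in> S"
  using function_subspaceD(2)[OF assms(1,2) function_subspaceD(3)[OF assms(1,3), of "-1"]] by simp

text \<open>Bessel's inequality for the point mass at \<open>x\<close> bounds the sum of the
  |b(x)|^2 by 1; summing over \<open>x\<close> counts the vectors, each of which has norm 1.\<close>

lemma orthonormal_card_le:
  assumes X: "finite X" and B: "finite B"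
    and on: "\<And>b b'. b \<in> B \<Longrightarrow> b' \<in> B \<Longrightarrow> finner X b b' = (if b = b' then 1 else 0)"
  shows "card B \<le> card X"
proof -
  have le: "(\<Sum>b\<in>B. (cmod (b x))\<^sup>2) \<le> 1" if x: "x \<in> X" for x
  proof -
    \<comment> \<open>\<open>?d\<close> is the point mass at \<open>x\<close> and \<open>?p\<close>
      its projection onto the span of \<open>B\<close>; the squared norm of \<open>?d - ?p\<close>
      turns out to be 1 minus the Bessel sum.\<close>
    let ?d = "\<lambda>y. if y = x then 1 else (0::complex)"
    let ?p = "\<lambda>y. \<Sum>b\<in>B. cnj (b x) * b y"
    have bd: "finner X b ?d = cnj (b x)" for b
      using X x by (simp add: finner_def mult_delta_right)
    have bp: "finner X b ?p = cnj (b x)" if "b \<in> B" for b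
      using that B by (simp add: finner_sum_right finner_scale_right on mult_delta_right)
    have "finner X b (\<lambda>y. ?d y - ?p y) = 0" if "b \<in> B" for b
      using bd bp[OF that] by (simp add: finner_diff_right)
    then have "finner X (\<lambda>y. ?d y - ?p y) ?p = 0"
      by (simp add: finner_sum_right finner_scale_right finner_commute[of X "\<lambda>y. ?d y - ?p y"])
    then have "finner X (\<lambda>y. ?d y - ?p y) (\<lambda>y. ?d y - ?p y) = finner X (\<lambda>y. ?d y - ?p y) ?d"
      by (simp add: finner_diff_right)
    also have "\<dots> = 1 - cnj (?p x)"
      using X x by (subst finner_commute) (simp add: finner_def mult_delta_right mult_delta_left)
    also have "cnj (?p x) = of_real (\<Sum>b\<in>B. (cmod (b x))\<^sup>2)"
      by (simp add: complex_norm_square[symmetric])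
    finally have "of_real (1 - (\<Sum>b\<in>B. (cmod (b x))\<^sup>2))
        = (of_real (\<Sum>y\<in>X. (cmod (?d y - ?p y))\<^sup>2) :: complex)"
      by (simp only: finner_self of_real_diff of_real_1)
    then have "1 - (\<Sum>b\<in>B. (cmod (b x))\<^sup>2) = (\<Sum>y\<in>X. (cmod (?d y - ?p y))\<^sup>2)"
      by (simp only: of_real_eq_iff)
    moreover have "0 \<le> (\<Sum>y\<in>X. (cmod (?d y - ?p y))\<^sup>2)" by (simp add: sum_nonneg)
    ultimately show ?thesis by linarith
  qed
  have "(\<Sum>x\<in>X. (cmod (b x))\<^sup>2) = 1" if "b \<in> B" for b
    using on[OF that that] unfolding finner_self by (simp only: of_real_eq_1_iff if_True simp_thms)
  then have "real (card B) = (\<Sum>b\<in>B. \<Sum>x\<in>X. (cmod (b x))\<^sup>2)" by simp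
  also have "\<dots> = (\<Sum>x\<in>X. \<Sum>b\<in>B. (cmod (b x))\<^sup>2)" by (rule sum.swap)
  also have "\<dots> \<le> (\<Sum>x\<in>X. 1)" by (intro sum_mono le)
  finally show ?thesis by simp
qed

text \<open>An orthonormal subset of maximal size is a basis, as otherwise a normalised remainder could
  be added to it.\<close>

lemma ex_parseval_frame:
  assumes X: "finite X" and S: "function_subspace X S"
  shows "\<exists>B. parseval_frame X S B"
proof -
  define P where "P B \<longleftrightarrow> finite B \<and> B \<subseteq> S \<and>
    (\<forall>b\<in>B. \<forall>b'\<in>B. finner X b b' = (if b = b' then 1 else 0))" for B
  have "P {}" by (simp add: P_def)
  moreover have "card B \<le> card X" if "P B" for B
    using that by (intro orthonormal_card_le[OF X]) (simp_all add: P_def)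
  ultimately have "\<exists>B. P B \<and> (\<forall>C. P C \<longrightarrow> card C \<le> card B)"
    by (intro ex_has_greatest_nat[where k = "{}" and b = "Suc (card X)"]) (simp_all add: less_Suc_eq_le)
  then obtain B where B: "P B" and max: "\<And>C. P C \<Longrightarrow> card C \<le> card B" by blast
  have fB: "finite B" and BS: "B \<subseteq> S"
    and on: "\<And>b b'. b \<in> B \<Longrightarrow> b' \<in> B \<Longrightarrow> finner X b b' = (if b = b' then 1 else 0)"
    using B by (auto simp: P_def)
  have "f x = (\<Sum>b\<in>B. finner X b f * b x)" if f: "f \<in> S" for f x
  proof (rule ccontr)
    assume neq: "f x \<noteq> (\<Sum>b\<in>B. finner X b f * b x)"
    define g where "g x = f x - (\<Sum>b\<in>B. finner X b f * b x)" for x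
    have gS: "g \<in> S"
      unfolding g_def using BS f by (intro function_subspace_diff[OF S] function_subspace_sum[OF S]) auto
    have bg: "finner X b g = 0" if "b \<in> B" for b
      unfolding g_def using that fB
      by (simp add: finner_diff_right finner_sum_right finner_scale_right on mult_delta_right)
    define r where "r = (\<Sum>x\<in>X. (cmod (g x))\<^sup>2)"
    have gg: "finner X g g = of_real r" by (simp only: finner_self r_def)
    have "g x \<noteq> 0" using neq by (simp add: g_def)
    moreover have "x \<in> X" using function_subspaceD(4)[OF S gS] calculation by blast
    ultimately have "finner X g g \<noteq> 0" using finner_self_eq_0[OF X] by blast
    then have "r \<noteq> 0" unfolding gg by simp
    moreover have "r \<ge> 0" by (simp add: r_def sum_nonneg)
    ultimately have r: "r > 0" by linarith
    \<comment> \<open>\<open>r\<close> is the squared norm of the remainder \<open>g\<close>, so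
      this factor normalises it.\<close>
    define q :: complex where "q = of_real (1 / sqrt r)"
    define e where "e = (\<lambda>x. q * g x)"
    have "finner X e e = q * finner X e g"
      by (simp only: e_def finner_scale_right)
    also have "finner X e g = cnj (finner X g e)" by (rule finner_commute)
    also have "finner X g e = q * of_real r"
      by (simp only: e_def finner_scale_right gg)
    also have "q * cnj (q * of_real r) = of_real (1 / sqrt r * (1 / sqrt r) * r)"
      by (simp only: q_def complex_cnj_mult complex_cnj_complex_of_real of_real_mult mult.assoc)
    also have "1 / sqrt r * (1 / sqrt r) * r = 1" using r by simp
    finally have ee: "finner X e e = 1" by simp
    have be: "finner X b e = 0" if "b \<in> B" for b
      by (simp only: e_def finner_scale_right bg[OF that] mult_zero_right)
    have eb: "finner X e b = 0" if "b \<in> B" for b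
      using be[OF that] finner_commute[of X e b] by simp
    have eS: "e \<in> S" unfolding e_def by (rule function_subspaceD(3)[OF S gS])
    have eB: "e \<notin> B" using ee be by force
    moreover have "P (insert e B)"
      unfolding P_def
    proof (intro conjI ballI)
      show "finner X b b' = (if b = b' then 1 else 0)" if "b \<in> insert e B" "b' \<in> insert e B" for b b'
        using that on[of b b'] ee be[of b] eb[of b'] eB by (cases "b = e"; cases "b' = e") auto
    qed (use fB BS eS in auto)
    ultimately show False using max[of "insert e B"] fB by simp
  qed
  then show ?thesis using fB BS unfolding parseval_frame_def by blast
qed

text \<open>The vector obtained is the orthogonal projection of \<open>f\<close>. It is described
  only by its inner products with \<open>S\<close>, the form in which it replaces \<open>f\<close>
  later.\<close>

lemma orthogonal_decomposition:
  assumes X: "finite X" and S: "function_subspace X S"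
  obtains f\<^sub>1 where "f\<^sub>1 \<in> S" "\<And>g. g \<in> S \<Longrightarrow> finner X g f = finner X g f\<^sub>1"
proof -
  obtain B where B: "parseval_frame X S B" using ex_parseval_frame[OF X S] by blast
  define f1 where "f1 x = (\<Sum>b\<in>B. finner X b f * b x)" for x
  have "f1 \<in> S"
    unfolding f1_def using B by (intro function_subspace_sum[OF S]) (auto simp: parseval_frame_def)
  moreover have "finner X g f = finner X g f1" if "g \<in> S" for g
  proof -
    have g: "g = (\<lambda>x. \<Sum>b\<in>B. finner X b g * b x)"
      using B that unfolding parseval_frame_def by blast
    have "finner X g f = cnj (finner X f g)" by (rule finner_commute)
    also have "finner X f g = (\<Sum>b\<in>B. finner X b g * finner X f b)"
      by (subst g) (simp only: finner_sum_right finner_scale_right)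
    also have "cnj \<dots> = (\<Sum>b\<in>B. finner X b f * finner X g b)"
      by (simp only: cnj_sum complex_cnj_mult finner_commute[symmetric] mult.commute)
    also have "\<dots> = finner X g f1"
      unfolding f1_def by (simp only: finner_sum_right finner_scale_right)
    finally show ?thesis .
  qed
  ultimately show ?thesis by (rule that)
qed

section \<open>Positivity of the Casimir form\<close>


text \<open>\<open>R\<close> is the kernel of \<open>T(c) = \<Sum>\<^sub>s b\<^sub>s c b\<^sub>s\<^sup>*\<close>.  The hypothesis \<open>casimir\<close> says that \<open>T\<close> maps into the
  commutant of the \<open>b\<^sub>s\<close>, and \<open>herm\<close> that \<open>T\<close> is self-adjoint; hence only the component of \<open>c\<close> in
  the commutant contributes, where the form is \<open>\<Sum>\<^sub>s \<parallel>c b\<^sub>s\<parallel>\<^sup>2\<close>.\<close>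

lemma casimir_form_nonneg:
  fixes b :: "'s \<Rightarrow> 'x \<Rightarrow> 'x \<Rightarrow> complex" and c :: "'x \<Rightarrow> 'x \<Rightarrow> complex"
  assumes X: "finite X"
    and R: "\<And>i i' j j'. R i i' j j' = (\<Sum>s\<in>T. b s i i' * cnj (b s j j'))"
    and casimir: "\<And>t i i' j j'. \<lbrakk>t \<in> T; i \<in> X; i' \<in> X; j \<in> X; j' \<in> X\<rbrakk> \<Longrightarrow>
      (\<Sum>k\<in>X. b t i k * R k i' j j') = (\<Sum>k\<in>X. R i i' k j' * b t k j)"
    and herm: "\<And>i i' j j'. \<lbrakk>i \<in> X; i' \<in> X; j \<in> X; j' \<in> X\<rbrakk> \<Longrightarrow> R i i' j j' = cnj (R i' i j' j)"
  shows "(\<Sum>i\<in>X. \<Sum>j\<in>X. \<Sum>i'\<in>X. \<Sum>j'\<in>X. cnj (c i j) * c i' j' * R i i' j j') \<in> \<real>\<^sub>\<ge>\<^sub>0"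
proof -
  \<comment> \<open>Matrices over \<open>X\<close> are flattened to functions on \<open>Z\<close>,
    so that they form a Hilbert space. \<open>A\<close> is the matrix of the map T, cut off so that
    its values are supported in \<open>Z\<close>, and \<open>S\<close> is the commutant of the
    \<open>b t\<close>.\<close>
  define Z where "Z = X \<times> X"
  have Z: "finite Z" using X by (simp add: Z_def)
  define A where "A p q = (if p \<in> Z then R (fst p) (fst q) (snd p) (snd q) else 0)" for p q
  define Tm where "Tm f p = (\<Sum>q\<in>Z. A p q * f q)" for f p
  define S where "S = {f. (\<forall>p. p \<notin> Z \<longrightarrow> f p = 0) \<and>
    (\<forall>t\<in>T. \<forall>i\<in>X. \<forall>j\<in>X. (\<Sum>k\<in>X. b t i k * f (k, j)) = (\<Sum>k\<in>X. f (i, k) * b t k j))}"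
  have S: "function_subspace Z S"
    unfolding function_subspace_def S_def
    by (auto simp: algebra_simps sum.distrib simp flip: sum_distrib_left)
  have TS: "Tm f \<in> S" for f
  proof -
    have "(\<Sum>k\<in>X. b t i k * Tm f (k, j)) = (\<Sum>k\<in>X. Tm f (i, k) * b t k j)"
      if "t \<in> T" "i \<in> X" "j \<in> X" for t i j
    proof -
      have "(\<Sum>k\<in>X. b t i k * Tm f (k, j)) = (\<Sum>q\<in>Z. (\<Sum>k\<in>X. b t i k * A (k, j) q) * f q)"
        by (simp only: Tm_def sum_distrib_left sum_distrib_right mult.assoc) (rule sum.swap)
      also have "\<dots> = (\<Sum>q\<in>Z. (\<Sum>k\<in>X. A (i, k) q * b t k j) * f q)"
      proof (rule sum.cong[OF refl])
        fix q assume "q \<in> Z"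
        then have "(\<Sum>k\<in>X. b t i k * A (k, j) q) = (\<Sum>k\<in>X. A (i, k) q * b t k j)"
          using casimir[of t i "fst q" j "snd q"] that by (auto simp: A_def Z_def cong: sum.cong_simp)
        then show "(\<Sum>k\<in>X. b t i k * A (k, j) q) * f q = (\<Sum>k\<in>X. A (i, k) q * b t k j) * f q" by simp
      qed
      also have "\<dots> = (\<Sum>k\<in>X. Tm f (i, k) * b t k j)"
        by (simp only: Tm_def sum_distrib_left sum_distrib_right mult.assoc)
           (subst sum.swap, simp only: mult.commute mult.left_commute)
      finally show ?thesis .
    qed
    moreover have "Tm f p = 0" if "p \<notin> Z" for p using that by (simp add: Tm_def A_def)
    ultimately show ?thesis by (simp add: S_def)
  qed
  have adj: "finner Z f (Tm g) = finner Z (Tm f) g" for f g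
  proof -
    have "finner Z f (Tm g) = (\<Sum>p\<in>Z. \<Sum>q\<in>Z. cnj (f p) * A p q * g q)"
      by (simp add: finner_def Tm_def sum_distrib_left mult.assoc)
    also have "\<dots> = (\<Sum>p\<in>Z. \<Sum>q\<in>Z. cnj (f p) * cnj (A q p) * g q)"
      by (intro sum.cong refl) (auto simp: A_def Z_def intro!: herm)
    also have "\<dots> = (\<Sum>q\<in>Z. \<Sum>p\<in>Z. cnj (f p) * cnj (A q p) * g q)" by (rule sum.swap)
    also have "\<dots> = finner Z (Tm f) g"
      by (simp add: finner_def Tm_def sum_distrib_left sum_distrib_right algebra_simps)
    finally show ?thesis .
  qed
  define cz where "cz p = c (fst p) (snd p)" for p
  obtain c1 where c1: "c1 \<in> S" and c1c: "\<And>g. g \<in> S \<Longrightarrow> finner Z g cz = finner Z g c1"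
    using orthogonal_decomposition[OF Z S] by metis
  \<comment> \<open>T takes its values in the commutant, so \<open>c1\<close> may replace
    \<open>cz\<close> in one argument; self-adjointness then moves T across and allows the same in
    the other.\<close>
  have "finner Z cz (Tm cz) = cnj (finner Z (Tm cz) cz)" by (rule finner_commute)
  also have "\<dots> = cnj (finner Z (Tm cz) c1)" by (simp only: c1c[OF TS])
  also have "\<dots> = finner Z c1 (Tm cz)" by (rule finner_commute[symmetric])
  also have "\<dots> = finner Z (Tm c1) cz" by (rule adj)
  also have "\<dots> = finner Z (Tm c1) c1" by (rule c1c[OF TS])
  also have "\<dots> = finner Z c1 (Tm c1)" by (rule adj[symmetric])
  also have "\<dots> = (\<Sum>s\<in>T. \<Sum>i\<in>X. \<Sum>j'\<in>X. of_real ((cmod (\<Sum>k\<in>X. c1 (i, k) * b s k j'))\<^sup>2))"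
  proof -
    have Tc1: "Tm c1 (i, j) = (\<Sum>s\<in>T. \<Sum>j'\<in>X. (\<Sum>k\<in>X. c1 (i, k) * b s k j') * cnj (b s j j'))"
      if "i \<in> X" "j \<in> X" for i j
    proof -
      have "Tm c1 (i, j) = (\<Sum>i'\<in>X. \<Sum>j'\<in>X. \<Sum>s\<in>T. b s i i' * c1 (i', j') * cnj (b s j j'))"
        using that by (simp add: Tm_def A_def Z_def R sum_distrib_left sum_distrib_right
            mult_ac sum.cartesian_product')
      also have "\<dots> = (\<Sum>s\<in>T. \<Sum>j'\<in>X. (\<Sum>i'\<in>X. b s i i' * c1 (i', j')) * cnj (b s j j'))"
        by (simp only: sum_distrib_left sum_distrib_right sum.swap[of _ T] mult.assoc)
           (intro sum.cong refl sum.swap)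
      \<comment> \<open>Since \<open>c1\<close> commutes with \<open>b s\<close>, the product b c b*
        becomes c b b*, which makes the form a sum of squares.\<close>
      also have "\<dots> = (\<Sum>s\<in>T. \<Sum>j'\<in>X. (\<Sum>k\<in>X. c1 (i, k) * b s k j') * cnj (b s j j'))"
        using c1 that by (intro sum.cong refl) (simp add: S_def)
      finally show ?thesis .
    qed
    have "finner Z c1 (Tm c1) = (\<Sum>i\<in>X. \<Sum>j\<in>X. cnj (c1 (i, j)) *
        (\<Sum>s\<in>T. \<Sum>j'\<in>X. (\<Sum>k\<in>X. c1 (i, k) * b s k j') * cnj (b s j j')))"
      by (simp add: finner_def Z_def Tc1 sum.cartesian_product')
    also have "\<dots> = (\<Sum>i\<in>X. \<Sum>s\<in>T. \<Sum>j'\<in>X. \<Sum>j\<in>X.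
        (\<Sum>k\<in>X. c1 (i, k) * b s k j') * cnj (c1 (i, j) * b s j j'))"
      by (simp only: sum_distrib_left sum.swap[of _ T X] complex_cnj_mult mult_ac)
         (intro sum.cong refl sum.swap)
    also have "\<dots> = (\<Sum>i\<in>X. \<Sum>s\<in>T. \<Sum>j'\<in>X. of_real ((cmod (\<Sum>k\<in>X. c1 (i, k) * b s k j'))\<^sup>2))"
      by (simp only: sum_distrib_left[symmetric] cnj_sum[symmetric] complex_norm_square)
    also have "\<dots> = (\<Sum>s\<in>T. \<Sum>i\<in>X. \<Sum>j'\<in>X. of_real ((cmod (\<Sum>k\<in>X. c1 (i, k) * b s k j'))\<^sup>2))"
      by (rule sum.swap)
    finally show ?thesis .
  qed
  also have "\<dots> \<in> \<real>\<^sub>\<ge>\<^sub>0"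
    by (simp only: of_real_sum[symmetric] nonneg_Reals_of_real_iff) (intro sum_nonneg zero_le_power2)
  finally have "finner Z cz (Tm cz) \<in> \<real>\<^sub>\<ge>\<^sub>0" .
  moreover have "finner Z cz (Tm cz) = (\<Sum>i\<in>X. \<Sum>j\<in>X. \<Sum>i'\<in>X. \<Sum>j'\<in>X. cnj (c i j) * c i' j' * R i i' j j')"
    by (simp add: finner_def Z_def Tm_def A_def cz_def sum_distrib_left mult_ac sum.cartesian_product')
  ultimately show ?thesis by simp
qed

section \<open>Bounded positive functionals and C*-seminorms\<close>


locale positive_functional =
  fixes \<phi> :: "'a::complex_star_algebra \<Rightarrow> complex"
  assumes add: "\<phi> (x + y) = \<phi> x + \<phi> y"
    and scale: "\<phi> (c *\<^sub>C x) = c * \<phi> x"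
    and nonneg: "\<phi> (star x * x) \<in> \<real>\<^sub>\<ge>\<^sub>0"
begin

text \<open>The seminorm of the GNS space, left on the algebra itself: null vectors are not divided
  out and nothing is completed.\<close>

definition gns_norm :: "'a \<Rightarrow> real" where
  "gns_norm y = sqrt (Re (\<phi> (star y * y)))"

text \<open>The norm of left multiplication by \<open>x\<close>, that is, of \<open>x\<close> in the
  GNS representation. The supremum is meaningful only once left multiplication is bounded.\<close>

definition gns_op_norm :: "'a \<Rightarrow> real" where
  "gns_op_norm x = Sup {gns_norm (x * y) | y. gns_norm y \<le> 1}"

lemma square: "\<phi> (star y * y) = of_real ((gns_norm y)\<^sup>2)"
proof -
  obtain r where "\<phi> (star y * y) = of_real r" "0 \<le> r"
    using nonneg[of y] by (auto simp: nonneg_Reals_def)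
  then show ?thesis by (simp add: gns_norm_def)
qed

lemma gns_norm_nonneg: "0 \<le> gns_norm y"
  using nonneg[of y] by (auto simp: gns_norm_def nonneg_Reals_def)

lemma expand: "\<phi> (star (x + c *\<^sub>C y) * (x + c *\<^sub>C y)) =
    \<phi> (star x * x) + c * \<phi> (star x * y) + cnj c * \<phi> (star y * x) + cnj c * c * \<phi> (star y * y)"
  by (simp add: star_add star_scaleC distrib_left distrib_right mult_scaleC_left mult_scaleC_right
      add scale scaleC_scaleC scaleC_add_right)

text \<open>Polarisation: \<phi> is real on the squares of \<open>x + y\<close> and of
  \<open>x + \<i> *\<^sub>C y\<close>, which fixes the imaginary and the real parts of the two cross
  terms.\<close>

lemma hermitian: "\<phi> (star y * x) = cnj (\<phi> (star x * y))"
proof -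
  have *: "Im (c * \<phi> (star x * y) + cnj c * \<phi> (star y * x)) = 0" for c
  proof -
    have "cnj c * c = of_real ((cmod c)\<^sup>2)"
      by (simp only: complex_norm_square mult.commute)
    then have "of_real ((gns_norm (x + c *\<^sub>C y))\<^sup>2) = of_real ((gns_norm x)\<^sup>2)
        + (c * \<phi> (star x * y) + cnj c * \<phi> (star y * x)) + of_real ((cmod c)\<^sup>2 * (gns_norm y)\<^sup>2)"
      using expand[of x c y] by (simp only: square of_real_mult add.assoc)
    from arg_cong[OF this, of Im] show ?thesis
      by (simp only: plus_complex.sel Im_complex_of_real add_0_left add_0_right)
  qed
  show ?thesis using *[of 1] *[of \<i>] by (simp add: complex_eq_iff)
qed

text \<open>The multiplier \<open>- of_real s * cnj b\<close> turns both cross terms into the same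
  real number, so positivity becomes a real quadratic inequality in \<open>s\<close>.\<close>

lemma cauchy_schwarz: "cmod (\<phi> (star x * y)) \<le> gns_norm x * gns_norm y"
proof -
  define b where "b = \<phi> (star x * y)"
  define a where "a = (gns_norm x)\<^sup>2"
  define d where "d = (gns_norm y)\<^sup>2"
  define m where "m = (cmod b)\<^sup>2"
  have bb: "b * cnj b = of_real m" by (simp only: m_def complex_norm_square)
  have ge: "0 \<le> a - 2 * s * m + s\<^sup>2 * m * d" for s
  proof -
    have "\<phi> (star (x + c *\<^sub>C y) * (x + c *\<^sub>C y)) =
        of_real a + c * b + cnj c * cnj b + cnj c * c * of_real d" for c
      using expand[of x c y]
      by (simp only: hermitian[of y x] square[of x] square[of y] a_def b_def d_def)
    from this[of "- of_real s * cnj b"]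
    have "\<phi> (star (x + (- of_real s * cnj b) *\<^sub>C y) * (x + (- of_real s * cnj b) *\<^sub>C y)) =
        of_real a - of_real s * (b * cnj b) - of_real s * (b * cnj b)
        + of_real s * of_real s * (b * cnj b) * of_real d"
      by (simp add: algebra_simps)
    also have "\<dots> = of_real (a - 2 * s * m + s\<^sup>2 * m * d)"
      unfolding bb by (simp add: power2_eq_square)
    finally have "of_real (a - 2 * s * m + s\<^sup>2 * m * d) \<in> (\<real>\<^sub>\<ge>\<^sub>0 :: complex set)"
      using nonneg by metis
    then show ?thesis by (simp only: nonneg_Reals_of_real_iff)
  qed
  have "m \<le> a * d"
  proof (cases "m = 0")
    case False
    then have m: "m > 0" by (simp add: m_def)
    have "d > 0"
    proof (rule ccontr)
      assume "\<not> d > 0"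
      then have "d = 0" by (simp add: d_def)
      \<comment> \<open>For \<open>d = 0\<close> the quadratic degenerates to
        \<open>a - 2 * s * m\<close>, and this \<open>s\<close> gives it the value -1.\<close>
      then show False using ge[of "(a + 1) / (2 * m)"] m by simp
    qed
    \<comment> \<open>\<open>s = 1 / d\<close> is the minimum of the quadratic.\<close>
    then have "1 / d * (1 / d) * m * d = m / d" by simp
    then have "0 \<le> a - m / d" using ge[of "1 / d"] by (simp add: power2_eq_square)
    then show ?thesis using \<open>d > 0\<close> by (simp add: field_simps)
  qed (simp add: a_def d_def)
  then have "(cmod b)\<^sup>2 \<le> (gns_norm x * gns_norm y)\<^sup>2"
    by (simp add: m_def a_def d_def power_mult_distrib)
  then show ?thesis
    unfolding b_def by (rule power2_le_imp_le) (simp add: gns_norm_nonneg)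
qed

lemma gns_norm_triangle: "gns_norm (x + y) \<le> gns_norm x + gns_norm y"
proof (rule power2_le_imp_le)
  have "complex_of_real ((gns_norm (x + y))\<^sup>2) =
      of_real ((gns_norm x)\<^sup>2) + \<phi> (star x * y) + cnj (\<phi> (star x * y)) + of_real ((gns_norm y)\<^sup>2)"
    using expand[of x 1 y] by (simp only: square scaleC_one hermitian[of y x] complex_cnj_one mult_1_left)
  then have "(gns_norm (x + y))\<^sup>2 = (gns_norm x)\<^sup>2 + 2 * Re (\<phi> (star x * y)) + (gns_norm y)\<^sup>2"
    by (simp add: complex_eq_iff del: of_real_power)
  moreover have "Re (\<phi> (star x * y)) \<le> gns_norm x * gns_norm y"
    using complex_Re_le_cmod cauchy_schwarz order_trans by blast
  ultimately show "(gns_norm (x + y))\<^sup>2 \<le> (gns_norm x + gns_norm y)\<^sup>2"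
    by (simp add: power2_sum)
qed (simp add: gns_norm_nonneg)

lemma gns_norm_scale: "gns_norm (c *\<^sub>C x) = cmod c * gns_norm x"
proof -
  have "star (c *\<^sub>C x) * (c *\<^sub>C x) = (cnj c * c) *\<^sub>C (star x * x)"
    by (simp add: star_scaleC mult_scaleC_left mult_scaleC_right scaleC_scaleC mult.commute)
  also have "cnj c * c = of_real ((cmod c)\<^sup>2)"
    by (simp only: complex_norm_square mult.commute)
  finally have "Re (\<phi> (star (c *\<^sub>C x) * (c *\<^sub>C x))) = (cmod c)\<^sup>2 * (gns_norm x)\<^sup>2"
    by (simp only: scale square Re_complex_of_real flip: of_real_mult)
  then show ?thesis
    unfolding gns_norm_def[of "c *\<^sub>C x"] by (simp add: real_sqrt_mult gns_norm_nonneg)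
qed

end

text \<open>On a *-algebra without a norm, positivity alone does not bound left multiplication on
  the GNS space, so this is demanded separately.\<close>

locale bounded_positive_functional = positive_functional +
  assumes bounded: "\<exists>C. \<forall>y. gns_norm (x * y) \<le> C * gns_norm y"
begin

lemma gns_norm_le_gns_op_norm:
  assumes "gns_norm y \<le> 1"
  shows "gns_norm (x * y) \<le> gns_op_norm x"
  unfolding gns_op_norm_def
proof (rule cSup_upper)
  obtain C where C: "\<And>y. gns_norm (x * y) \<le> C * gns_norm y" using bounded by blast
  show "bdd_above {gns_norm (x * y) | y. gns_norm y \<le> 1}"
  proof (rule bdd_aboveI)
    fix r assume "r \<in> {gns_norm (x * y) | y. gns_norm y \<le> 1}"
    then obtain y where y: "r = gns_norm (x * y)" "gns_norm y \<le> 1" by blast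
    have "C * gns_norm y \<le> \<bar>C\<bar> * 1"
      using y(2) gns_norm_nonneg[of y] by (intro mult_mono) auto
    then show "r \<le> \<bar>C\<bar>" using C[of y] y(1) by simp
  qed
qed (use assms in blast)

lemma gns_norm_zero: "gns_norm 0 = 0"
  using gns_norm_scale[of 0 0] by simp

lemma gns_op_norm_nonneg: "0 \<le> gns_op_norm x"
  using gns_norm_le_gns_op_norm[of 0 x] by (simp add: gns_norm_zero)

lemma gns_op_norm_upper: "gns_norm (x * y) \<le> gns_op_norm x * gns_norm y"
proof -
  obtain C where C: "\<And>y. gns_norm (x * y) \<le> C * gns_norm y" using bounded by blast
  note up = gns_norm_le_gns_op_norm[of _ x]
  show ?thesis
  proof (cases "gns_norm y = 0")
    \<comment> \<open>A null vector cannot be normalised; boundedness is what sends it to a null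
      vector.\<close>
    case True
    then show ?thesis using C[of y] by simp
  next
    case False
    then have pos: "gns_norm y > 0" using gns_norm_nonneg[of y] by simp
    let ?z = "of_real (1 / gns_norm y) *\<^sub>C y"
    have "gns_norm ?z = 1" using pos unfolding gns_norm_scale by (simp del: of_real_divide)
    moreover have "gns_norm (x * ?z) = gns_norm (x * y) / gns_norm y"
      using pos unfolding mult_scaleC_right gns_norm_scale by (simp del: of_real_divide)
    ultimately have "gns_norm (x * y) / gns_norm y \<le> gns_op_norm x" using up[of ?z] by simp
    then show ?thesis using pos by (simp add: field_simps)
  qed
qed

lemma gns_op_norm_least:
  assumes "\<And>y. gns_norm (x * y) \<le> C * gns_norm y" "0 \<le> C"
  shows "gns_op_norm x \<le> C"
  unfolding gns_op_norm_def
proof (rule cSup_least)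
  have "gns_norm 0 \<le> 1" by (simp add: gns_norm_zero)
  then show "{gns_norm (x * y) | y. gns_norm y \<le> 1} \<noteq> {}" by blast
next
  fix r assume "r \<in> {gns_norm (x * y) | y. gns_norm y \<le> 1}"
  then obtain y where y: "r = gns_norm (x * y)" "gns_norm y \<le> 1" by blast
  show "r \<le> C"
    using assms(1)[of y] mult_left_le[OF y(2) assms(2)] y(1) by simp
qed

text \<open>The substantial point is the C*-identity. Cauchy-Schwarz applied to \<open>y\<close> and
  \<open>star x * x * y\<close> bounds the square of the norm of \<open>x * y\<close>, so
  \<open>gns_op_norm\<close> of \<open>star x * x\<close> dominates the square. With
  submultiplicativity this gives invariance under \<open>star\<close> and then equality.\<close>

lemma cstar_seminorm_gns_op_norm: "cstar_seminorm gns_op_norm"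
proof -
  note up = gns_op_norm_upper and least = gns_op_norm_least and nn = gns_op_norm_nonneg
  have triangle: "gns_op_norm (x + y) \<le> gns_op_norm x + gns_op_norm y" for x y
  proof (rule least)
    show "gns_norm ((x + y) * z) \<le> (gns_op_norm x + gns_op_norm y) * gns_norm z" for z
      using gns_norm_triangle[of "x * z" "y * z"] up[of x z] up[of y z] by (simp add: distrib_right)
  qed (simp add: nn)
  have scale_le: "gns_op_norm (c *\<^sub>C x) \<le> cmod c * gns_op_norm x" for c x
  proof (rule least)
    show "gns_norm (c *\<^sub>C x * y) \<le> cmod c * gns_op_norm x * gns_norm y" for y
      unfolding mult_scaleC_left gns_norm_scale
      using mult_left_mono[OF up[of x y], of "cmod c"] by (simp add: mult.assoc)
  qed (simp add: nn)
  have scale: "gns_op_norm (c *\<^sub>C x) = cmod c * gns_op_norm x" for c x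
  proof (cases "c = 0")
    case True
    then show ?thesis using scale_le[of c x] nn[of "c *\<^sub>C x"] by simp
  next
    case False
    \<comment> \<open>The reverse inequality is the one already proved, for the scalar
      \<open>inverse c\<close>.\<close>
    have "gns_op_norm x = gns_op_norm (inverse c *\<^sub>C (c *\<^sub>C x))"
      using False by (simp add: scaleC_scaleC scaleC_one)
    also have "\<dots> \<le> cmod (inverse c) * gns_op_norm (c *\<^sub>C x)" by (rule scale_le)
    finally have "cmod c * gns_op_norm x \<le> gns_op_norm (c *\<^sub>C x)"
      using False by (simp add: norm_divide field_simps)
    then show ?thesis using scale_le[of c x] by simp
  qed
  have mult: "gns_op_norm (x * y) \<le> gns_op_norm x * gns_op_norm y" for x y
  proof (rule least)
    show "gns_norm (x * y * z) \<le> gns_op_norm x * gns_op_norm y * gns_norm z" for z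
      using up[of x "y * z"] mult_left_mono[OF up[of y z] nn[of x]] by (simp add: mult.assoc)
  qed (simp add: nn)
  have sq_le: "(gns_op_norm x)\<^sup>2 \<le> gns_op_norm (star x * x)" for x
  proof -
    have "gns_norm (x * y) \<le> sqrt (gns_op_norm (star x * x)) * gns_norm y" for y
    proof -
      have "complex_of_real ((gns_norm (x * y))\<^sup>2) = \<phi> (star y * (star x * x * y))"
        by (simp only: square[symmetric] star_mult mult.assoc)
      then have "(gns_norm (x * y))\<^sup>2 = cmod (\<phi> (star y * (star x * x * y)))"
        by (metis norm_of_real abs_of_nonneg zero_le_power2)
      also have "\<dots> \<le> gns_norm y * gns_norm (star x * x * y)" by (rule cauchy_schwarz)
      also have "\<dots> \<le> gns_norm y * (gns_op_norm (star x * x) * gns_norm y)"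
        by (intro mult_left_mono up gns_norm_nonneg)
      finally have "(gns_norm (x * y))\<^sup>2 \<le> (sqrt (gns_op_norm (star x * x)) * gns_norm y)\<^sup>2"
        using nn[of "star x * x"] by (simp add: power_mult_distrib power2_eq_square mult_ac)
      then show ?thesis
        by (rule power2_le_imp_le) (simp add: nn gns_norm_nonneg)
    qed
    then have "gns_op_norm x \<le> sqrt (gns_op_norm (star x * x))"
      by (rule least) (simp add: nn)
    then show ?thesis
      using nn[of x] nn[of "star x * x"] by (metis power_mono real_sqrt_pow2)
  qed
  have star_ge: "gns_op_norm x \<le> gns_op_norm (star x)" for x
  proof (cases "gns_op_norm x = 0")
    case False
    have "gns_op_norm x * gns_op_norm x \<le> gns_op_norm (star x) * gns_op_norm x"
      using sq_le[of x] mult[of "star x" x] by (simp add: power2_eq_square)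
    then show ?thesis using False nn[of x] by (simp add: mult_le_cancel_right)
  qed (simp add: nn)
  have "gns_op_norm (star x) = gns_op_norm x" for x
    using star_ge[of x] star_ge[of "star x"] by (simp add: star_star)
  then have "gns_op_norm (star x * x) = (gns_op_norm x)\<^sup>2" for x
    using sq_le[of x] mult[of "star x" x] by (simp add: power2_eq_square)
  then show ?thesis
    unfolding cstar_seminorm_def using nn triangle scale mult by blast
qed

text \<open>\<phi> is the vector state of the cyclic vector 1: \<phi>(x) is the inner product of 1
  with \<open>x * 1\<close>.\<close>

lemma functional_le_gns_op_norm: "cmod (\<phi> x) \<le> gns_op_norm x * (gns_norm 1)\<^sup>2"
proof -
  have "cmod (\<phi> x) \<le> gns_norm 1 * gns_norm (x * 1)"
    using cauchy_schwarz[of 1 x] by simp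
  also have "\<dots> \<le> gns_norm 1 * (gns_op_norm x * gns_norm 1)"
    by (intro mult_left_mono gns_op_norm_upper gns_norm_nonneg)
  finally show ?thesis by (simp add: power2_eq_square mult_ac)
qed

lemma gns_op_norm_eq_0:
  assumes "\<And>y. \<phi> (star (x * y) * (x * y)) = 0"
  shows "gns_op_norm x = 0"
proof (rule antisym)
  have "gns_norm (x * y) = 0" for y by (simp add: gns_norm_def assms)
  then show "gns_op_norm x \<le> 0" by (intro gns_op_norm_least) simp_all
qed (rule gns_op_norm_nonneg)

end

text \<open>The relators act as zero in the GNS representation, so its operator norm is one of the
  seminorms dominated by the universal one; an element evaluating to zero then has operator norm
  zero, and \<phi> vanishes on it.\<close>

lemma bounded_positive_functional_eq_0:
  fixes \<phi> :: "'g free_algebra \<Rightarrow> complex" and u :: "'g \<Rightarrow> 'a::cstar_algebra"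
  assumes "universal_cstar_algebra R u" "bounded_positive_functional \<phi>"
    and ideal: "\<And>r y z. r \<in> R \<Longrightarrow> \<phi> (z * r * y) = 0"
    and x: "free_eval u x = 0"
  shows "\<phi> x = 0"
proof -
  interpret bounded_positive_functional \<phi> by fact
  have "\<forall>r\<in>R. gns_op_norm r = 0"
  proof
    fix r assume r: "r \<in> R"
    have "\<phi> (star (r * y) * (r * y)) = 0" for y
      using ideal[OF r, of "star y * star r" y] by (simp add: star_mult mult.assoc)
    then show "gns_op_norm r = 0" by (rule gns_op_norm_eq_0)
  qed
  then have "gns_op_norm x \<le> norm (free_eval u x)"
    using assms(1) cstar_seminorm_gns_op_norm unfolding universal_cstar_algebra_def by blast
  then have "gns_op_norm x = 0" using x gns_op_norm_nonneg[of x] by simp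
  then show ?thesis using functional_le_gns_op_norm[of x] by simp
qed

section \<open>Vectors generated by cups\<close>


definition dual_word :: "letter list \<Rightarrow> letter list" where
  "dual_word a = rev (map flip a)"

definition dual :: "('n \<times> letter) list \<Rightarrow> ('n \<times> letter) list" where
  "dual L = rev (map (map_prod id flip) L)"

text \<open>A vector in the tensor power of \<open>\<complex>\<^sup>n\<close> attached to a word is encoded as a function on lists of
  (index, letter) pairs that vanishes unless the letters spell that word, so that the vectors of all
  words live on one type.\<close>

definition colored :: "letter list \<Rightarrow> ('n \<times> letter) list set" where
  "colored a = {L. map snd L = a}"

text \<open>The tensor \<Sum> e_s \<otimes> e_s over all indices s, inserted into \<open>f\<close>
  at the positions \<open>k\<close> and \<open>Suc k\<close> with letters \<open>x\<close> and
  \<open>flip x\<close>.\<close>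

definition cup :: "nat \<Rightarrow> letter \<Rightarrow> (('n \<times> letter) list \<Rightarrow> complex) \<Rightarrow> ('n \<times> letter) list \<Rightarrow> complex" where
  "cup k x f L = (if k + 2 \<le> length L \<and> snd (L ! k) = x \<and> L ! Suc k = (fst (L ! k), flip x)
     then f (take k L @ drop (k + 2) L) else 0)"

definition cap ::
  "nat \<Rightarrow> letter \<Rightarrow> (('n::finite \<times> letter) list \<Rightarrow> complex) \<Rightarrow> ('n \<times> letter) list \<Rightarrow> complex" where
  "cap k x f L = (\<Sum>s\<in>UNIV. f (take k L @ (s, x) # (s, flip x) # drop k L))"

text \<open>This is the span of the \<xi>, generated without mentioning pairings, so that stability
  under the categorical operations can be proved by induction on how a vector arises. The rule
  \<open>zero\<close> covers words that have no pairing at all.\<close>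

inductive fixed_vector :: "letter list \<Rightarrow> (('n::finite \<times> letter) list \<Rightarrow> complex) \<Rightarrow> bool" where
  unit: "fixed_vector [] (\<lambda>L. if L = [] then 1 else 0)"
| cup: "fixed_vector (a @ b) f \<Longrightarrow> fixed_vector (a @ x # flip x # b) (cup (length a) x f)"
| zero: "fixed_vector a (\<lambda>_. 0)"
| add: "fixed_vector a f \<Longrightarrow> fixed_vector a g \<Longrightarrow> fixed_vector a (\<lambda>L. f L + g L)"
| scale: "fixed_vector a f \<Longrightarrow> fixed_vector a (\<lambda>L. c * f L)"

section \<open>Words, duals and sums over the lists of a word\<close>

lemma dual_word_simps [simp]:
  "dual_word [] = []" "dual_word (a @ b) = dual_word b @ dual_word a"
  "dual_word (x # a) = dual_word a @ [flip x]" "length (dual_word a) = length a"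
  "dual_word (dual_word a) = a"
  by (simp_all add: dual_word_def rev_map o_def)

lemma dual_simps [simp]:
  "dual [] = []" "dual (L @ M) = dual M @ dual L"
  "dual ((s, x) # L) = dual L @ [(s, flip x)]" "length (dual L) = length L"
  "dual (dual L) = L" "map snd (dual L) = dual_word (map snd L)"
  by (simp_all add: dual_def rev_map o_def prod.map_comp dual_word_def)

lemma finite_colored [simp]: "finite (colored a :: ('n::finite \<times> letter) list set)"
proof -
  have "(UNIV :: letter set) \<subseteq> {Alpha, Beta}" using letter.exhaust by blast
  then have "finite (UNIV :: letter set)" by (rule finite_subset) simp
  then have "finite (UNIV :: ('n \<times> letter) set)" by (simp add: finite_prod)
  then have "finite {L :: ('n \<times> letter) list. set L \<subseteq> UNIV \<and> length L = length a}"
    by (rule finite_lists_length_eq)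
  then show ?thesis by (rule finite_subset[rotated]) (auto simp: colored_def)
qed

lemma colored_append: "L \<in> colored (a @ b) \<longleftrightarrow> (\<exists>X Y. L = X @ Y \<and> X \<in> colored a \<and> Y \<in> colored b)"
  by (auto simp: colored_def map_eq_append_conv)

lemma colored_Cons: "L \<in> colored (x # b) \<longleftrightarrow> (\<exists>s Y. L = (s, x) # Y \<and> Y \<in> colored b)"
  by (auto simp: colored_def)

lemma colored_Nil [simp]: "colored [] = {[]}"
  by (auto simp: colored_def)

lemma length_colored: "L \<in> colored a \<Longrightarrow> length L = length a"
  by (auto simp: colored_def)

lemma sum_colored_append:
  "(\<Sum>L\<in>colored (a @ b). g (L :: ('n::finite \<times> letter) list)) = (\<Sum>X\<in>colored a. \<Sum>Y\<in>colored b. g (X @ Y))"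
proof -
  have "bij_betw (\<lambda>(X, Y). X @ Y) (colored a \<times> colored b) (colored (a @ b))"
    by (rule bij_betw_byWitness[where f' = "\<lambda>L. (take (length a) L, drop (length a) L)"])
       (auto simp: colored_append length_colored, blast)
  from sum.reindex_bij_betw[OF this, of g] show ?thesis
    by (simp add: sum.cartesian_product case_prod_beta')
qed

lemma sum_colored_Cons:
  "(\<Sum>L\<in>colored (x # b). g (L :: ('n::finite \<times> letter) list)) = (\<Sum>s\<in>UNIV. \<Sum>Y\<in>colored b. g ((s, x) # Y))"
proof -
  have "bij_betw (\<lambda>(s, Y). (s, x) # Y) (UNIV \<times> colored b) (colored (x # b))"
    by (rule bij_betw_byWitness[where f' = "\<lambda>L. (fst (hd L), tl L)"])
       (auto simp: colored_Cons length_colored)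
  from sum.reindex_bij_betw[OF this, of g] show ?thesis
    by (simp add: sum.cartesian_product case_prod_beta')
qed

lemma sum_colored_dual:
  "(\<Sum>L\<in>colored (dual_word a). g (L :: ('n::finite \<times> letter) list)) = (\<Sum>L\<in>colored a. g (dual L))"
proof -
  have "bij_betw dual (colored a) (colored (dual_word a) :: ('n \<times> letter) list set)"
    by (rule bij_betw_byWitness[where f' = dual]) (auto simp: colored_def)
  from sum.reindex_bij_betw[OF this, of g] show ?thesis by simp
qed

section \<open>Elementary calculus of cups and caps\<close>

lemma cup_append:
  "length X = k \<Longrightarrow> cup k x f (X @ p # q # Y) = (if snd p = x \<and> q = (fst p, flip x) then f (X @ Y) else 0)"
  by (auto simp: cup_def nth_append)

lemma cup_short: "length L < k + 2 \<Longrightarrow> cup k x f L = 0"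
  by (simp add: cup_def)

lemma cup_splitE:
  obtains "length L < k + 2" | X p q Y where "L = X @ p # q # Y" "length X = k"
proof (cases "length L < k + 2")
  case False
  then have "L = take k L @ L ! k # L ! Suc k # drop (Suc (Suc k)) L"
    by (simp add: Cons_nth_drop_Suc)
  then show ?thesis using that(2)[of "take k L"] False by simp
qed (rule that(1))

lemma cap_append: "length X = k \<Longrightarrow> cap k x f (X @ Y) = (\<Sum>s\<in>UNIV. f (X @ (s, x) # (s, flip x) # Y))"
  by (simp add: cap_def)

lemma cup_add: "cup k x (\<lambda>L. f L + g L) = (\<lambda>L. cup k x f L + cup k x g L)"
  by (auto simp: cup_def)

lemma cup_scale: "cup k x (\<lambda>L. c * f L) = (\<lambda>L. c * cup k x f L)"
  by (auto simp: cup_def)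

lemma cap_add: "cap k x (\<lambda>L. f L + g L) = (\<lambda>L. cap k x f L + cap k x g L)"
  by (auto simp: cap_def sum.distrib)

lemma cap_scale: "cap k x (\<lambda>L. c * f L) = (\<lambda>L. c * cap k x f L)"
  by (auto simp: cap_def sum_distrib_left)

lemma fixed_vector_support:
  assumes "fixed_vector a f" "L \<notin> colored a"
  shows "f L = 0"
  using assms
proof (induction arbitrary: L rule: fixed_vector.induct)
  case (cup a b f x)
  show ?case
  proof (cases rule: cup_splitE[of L "length a"])
    case (2 X p q Y)
    then have "f (X @ Y) = 0" if "snd p = x" "q = (fst p, flip x)"
      using that cup.prems cup.IH[of "X @ Y"] by (auto simp: colored_def)
    with 2 show ?thesis by (simp add: cup_append)
  qed (simp add: cup_short)
qed (auto simp: colored_def)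

lemma fixed_vector_congI:
  assumes "fixed_vector a g" "\<And>L. L \<notin> colored a \<Longrightarrow> f L = 0" "\<And>L. L \<in> colored a \<Longrightarrow> f L = g L"
  shows "fixed_vector a f"
proof -
  have "f = g" using assms fixed_vector_support[OF assms(1)] by (metis ext)
  with assms(1) show ?thesis by simp
qed

lemma cap_support:
  assumes "\<And>L. L \<notin> colored (a @ x # flip x # b) \<Longrightarrow> f L = 0" "M \<notin> colored (a @ b)"
  shows "cap (length a) x f M = 0"
  unfolding cap_def
proof (intro sum.neutral ballI assms(1) notI)
  fix s
  assume "take (length a) M @ (s, x) # (s, flip x) # drop (length a) M \<in> colored (a @ x # flip x # b)"
  then have *: "take (length a) (map snd M) @ x # flip x # drop (length a) (map snd M) = a @ x # flip x # b"
    by (simp add: colored_def take_map drop_map)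
  \<comment> \<open>Two letters are added even when \<open>k\<close> exceeds the length of
    \<open>Z\<close>; this determines the length of \<open>M\<close> before anything is known about
    its letters.\<close>
  have "length (take k Z @ y # z # drop k Z) = length Z + 2" for k y z and Z :: "letter list"
    by (simp add: min_def)
  with arg_cong[OF *, of length] have "length M = length a + length b" by simp
  then have "length M \<ge> length a" by simp
  then have "take (length a) (map snd M) = a \<and> drop (length a) (map snd M) = b"
    using * by (subst (asm) append_eq_append_conv) auto
  then have "map snd M = a @ b" by (metis append_take_drop_id)
  with assms(2) show False by (simp add: colored_def)
qed

text \<open>Supports are settled here once, so that each case of the next lemma only has to produce
  a candidate \<open>g\<close> and compare values on lists spelling \<open>a @ b\<close>.\<close>

lemma fixed_vector_cup_cap:
  assumes g: "fixed_vector (a @ b) g" and f: "fixed_vector (a @ x # flip x # b) f"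
    and "\<And>X Y. X \<in> colored a \<Longrightarrow> Y \<in> colored b \<Longrightarrow>
      (\<Sum>s\<in>UNIV. f (X @ (s, x) # (s, flip x) # Y)) = g (X @ Y)"
  shows "fixed_vector (a @ b) (cap (length a) x f)"
proof (rule fixed_vector_congI[OF g])
  show "cap (length a) x f L = 0" if "L \<notin> colored (a @ b)" for L
    using cap_support[OF _ that] fixed_vector_support[OF f] by blast
  show "cap (length a) x f L = g L" if "L \<in> colored (a @ b)" for L
    using that assms(3) by (auto simp: colored_append cap_append length_colored)
qed

text \<open>Capping a vector obtained by inserting a cup: either the two cancel to a loop, or they
  straighten to the identity when they overlap in one point, or they commute.\<close>

lemma fixed_vector_cap:
  assumes "fixed_vector w f" "w = a @ x # flip x # b"
  shows "fixed_vector (a @ b) (cap (length a) x f)"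
  using assms
proof (induction arbitrary: a b x rule: fixed_vector.induct)
  case (cup a1 b1 g y)
  note eq = cup.prems and g = cup.hyps
  have gc: "fixed_vector (a @ x # flip x # b) (cup (length a1) y g)"
    using fixed_vector.cup[OF g, of y] by (simp only: eq)
  consider "length a1 = length a" | "length a1 = Suc (length a)" | "Suc (length a1) = length a"
    | "length a1 \<ge> length a + 2" | "length a \<ge> length a1 + 2" by linarith
  then show ?case
  proof cases
    case 1
    with eq have *: "a1 = a" "y = x" "b1 = b" by simp_all
    \<comment> \<open>A cap directly on its own cup closes a loop, whose value is the number of
      indices.\<close>
    have "fixed_vector (a @ b) (\<lambda>L. of_nat CARD('a) * g L)"
      using g by (intro fixed_vector.scale) (simp add: *)
    then show ?thesis
      by (rule fixed_vector_cup_cap[OF _ gc]) (simp add: * cup_append length_colored)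
  next
    case 2
    with eq have *: "a1 = a @ [x]" "y = flip x" "b = x # b1"
      by (auto simp: append_eq_append_conv2 append_eq_Cons_conv Cons_eq_append_conv)
    have "fixed_vector (a @ b) g" using g by (simp add: *)
    then show ?thesis
    proof (rule fixed_vector_cup_cap[OF _ gc])
      fix X Y :: "('a \<times> letter) list" assume X: "X \<in> colored a" and Y: "Y \<in> colored b"
      then obtain t Y' where Y': "Y = (t, x) # Y'" by (auto simp: * colored_Cons)
      \<comment> \<open>The cup ties the second capped leg to the first letter of \<open>Y\<close>,
        so the sum over \<open>s\<close> has one surviving term: the zigzag is pulled
        straight.\<close>
      have "cup (length a1) y g (X @ (s, x) # (s, flip x) # Y) = (if t = s then g (X @ (s, x) # Y') else 0)" for s
        using cup_append[of "X @ [(s, x)]" "length a1" y g "(s, flip x)" "(t, x)" Y'] X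
        by (simp add: * Y' length_colored)
      then show "(\<Sum>s\<in>UNIV. cup (length a1) y g (X @ (s, x) # (s, flip x) # Y)) = g (X @ Y)"
        by (simp add: Y')
    qed
  next
    case 3
    with eq have *: "a = a1 @ [y]" "x = flip y" "b1 = y # b"
      by (auto simp: append_eq_append_conv2 append_eq_Cons_conv Cons_eq_append_conv)
    have "fixed_vector (a @ b) g" using g by (simp add: *)
    then show ?thesis
    proof (rule fixed_vector_cup_cap[OF _ gc])
      fix X Y :: "('a \<times> letter) list" assume X: "X \<in> colored a" and Y: "Y \<in> colored b"
      then obtain t X' where X': "X = X' @ [(t, y)]" "X' \<in> colored a1"
        by (auto simp: * colored_append colored_Cons)
      have "cup (length a1) y g (X @ (s, x) # (s, flip x) # Y) = (if t = s then g (X @ Y) else 0)" for s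
        using cup_append[of X' "length a1" y g "(t, y)" "(s, x)" "(s, flip x) # Y"] X'
        by (auto simp add: * length_colored)
      then show "(\<Sum>s\<in>UNIV. cup (length a1) y g (X @ (s, x) # (s, flip x) # Y)) = g (X @ Y)"
        by simp
    qed
  next
    case 4
    \<comment> \<open>The word between the capped pair and the cup to the right of it.\<close>
    define c where "c = drop (length a + 2) a1"
    have "take (length a + 2) (a1 @ y # flip y # b1) = take (length a + 2) (a @ x # flip x # b)"
      by (simp only: eq)
    then have "take (length a + 2) a1 = a @ [x, flip x]" using 4 by simp
    then have a1: "a1 = a @ x # flip x # c"
      unfolding c_def by (metis append_take_drop_id append_Cons append_Nil append_assoc)
    with eq have b: "b = c @ y # flip y # b1" by simp
    have "fixed_vector (a @ c @ b1) (cap (length a) x g)" using cup.IH[of a x "c @ b1"] by (simp add: a1)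
    then have "fixed_vector (a @ b) (cup (length (a @ c)) y (cap (length a) x g))"
      using fixed_vector.cup[of "a @ c" b1 _ y] by (simp add: b)
    then show ?thesis
    proof (rule fixed_vector_cup_cap[OF _ gc])
      fix X Y :: "('a \<times> letter) list" assume X: "X \<in> colored a" and Y: "Y \<in> colored b"
      then obtain C p q Y' where Y': "Y = C @ p # q # Y'" "C \<in> colored c"
        by (auto simp: b colored_append colored_Cons)
      have "cup (length a1) y g (X @ (s, x) # (s, flip x) # Y) =
          (if snd p = y \<and> q = (fst p, flip y) then g (X @ (s, x) # (s, flip x) # C @ Y') else 0)" for s
        using cup_append[of "X @ (s, x) # (s, flip x) # C" "length a1" y g p q Y'] X Y'
        by (simp add: a1 length_colored)
      moreover have "cup (length (a @ c)) y (cap (length a) x g) (X @ Y) =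
          (if snd p = y \<and> q = (fst p, flip y) then cap (length a) x g (X @ C @ Y') else 0)"
        using cup_append[of "X @ C" "length (a @ c)" y "cap (length a) x g" p q Y'] X Y'
        by (simp add: length_colored)
      ultimately show "(\<Sum>s\<in>UNIV. cup (length a1) y g (X @ (s, x) # (s, flip x) # Y))
          = cup (length (a @ c)) y (cap (length a) x g) (X @ Y)"
        using X by (cases "snd p = y"; cases "q = (fst p, flip y)") (simp_all add: cap_append length_colored)
    qed
  next
    case 5
    define c where "c = drop (length a1 + 2) a"
    have "take (length a1 + 2) (a1 @ y # flip y # b1) = take (length a1 + 2) (a @ x # flip x # b)"
      by (simp only: eq)
    then have "take (length a1 + 2) a = a1 @ [y, flip y]" using 5 by simp
    then have a: "a = a1 @ y # flip y # c"
      unfolding c_def by (metis append_take_drop_id append_Cons append_Nil append_assoc)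
    with eq have b1: "b1 = c @ x # flip x # b" by simp
    have "fixed_vector (a1 @ c @ b) (cap (length (a1 @ c)) x g)"
      using cup.IH[of "a1 @ c" x b] by (simp add: b1)
    then have "fixed_vector (a @ b) (cup (length a1) y (cap (length (a1 @ c)) x g))"
      using fixed_vector.cup[of a1 "c @ b" _ y] by (simp add: a)
    then show ?thesis
    proof (rule fixed_vector_cup_cap[OF _ gc])
      fix X Y :: "('a \<times> letter) list" assume X: "X \<in> colored a" and Y: "Y \<in> colored b"
      then obtain A p q C where X': "X = A @ p # q # C" "A \<in> colored a1" "C \<in> colored c"
        by (auto simp: a colored_append colored_Cons)
      have "cup (length a1) y g (X @ (s, x) # (s, flip x) # Y) =
          (if snd p = y \<and> q = (fst p, flip y) then g (A @ C @ (s, x) # (s, flip x) # Y) else 0)" for s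
        using cup_append[of A "length a1" y g p q "C @ (s, x) # (s, flip x) # Y"] X'
        by (simp add: length_colored)
      moreover have "cup (length a1) y (cap (length (a1 @ c)) x g) (X @ Y) =
          (if snd p = y \<and> q = (fst p, flip y) then cap (length (a1 @ c)) x g ((A @ C) @ Y) else 0)"
        using cup_append[of A "length a1" y "cap (length (a1 @ c)) x g" p q "C @ Y"] X'
        by (simp add: length_colored)
      moreover have "cap (length (a1 @ c)) x g ((A @ C) @ Y) = (\<Sum>s\<in>UNIV. g ((A @ C) @ (s, x) # (s, flip x) # Y))"
        using X' by (intro cap_append) (simp add: length_colored)
      ultimately show "(\<Sum>s\<in>UNIV. cup (length a1) y g (X @ (s, x) # (s, flip x) # Y))
          = cup (length a1) y (cap (length (a1 @ c)) x g) (X @ Y)"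
        by (cases "snd p = y"; cases "q = (fst p, flip y)") simp_all
    qed
  qed
next
  case (zero w)
  have "cap (length a) x (\<lambda>_. 0) = (\<lambda>_ :: ('a \<times> letter) list. 0)"
    by (simp add: cap_def fun_eq_iff)
  then show ?case by (simp only: fixed_vector.zero)
next
  case (add w f g)
  show ?case unfolding cap_add by (rule fixed_vector.add[OF add.IH[OF add.prems]])
next
  case (scale w f c)
  show ?case unfolding cap_scale by (rule fixed_vector.scale[OF scale.IH[OF scale.prems]])
qed simp

section \<open>Tensor products, adjoints and composition\<close>

lemma fixed_vector_tensor:
  assumes "fixed_vector a f" and g: "fixed_vector b g"
  shows "fixed_vector (a @ b) (\<lambda>L. f (take (length a) L) * g (drop (length a) L))"
  using assms(1)
proof induction
  case unit
  then show ?case using g by simp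
next
  case (cup a c f x)
  have "cup (length a) x f (take (length (a @ x # flip x # c)) L) * g (drop (length (a @ x # flip x # c)) L)
      = cup (length a) x (\<lambda>L. f (take (length (a @ c)) L) * g (drop (length (a @ c)) L)) L" for L
    by (cases rule: cup_splitE[of L "length a"]) (auto simp: cup_short cup_append)
  with fixed_vector.cup[of a "c @ b" _ x] cup.IH show ?case by simp
next
  case (add a f h)
  from fixed_vector.add[OF add.IH] show ?case by (simp add: distrib_right)
next
  case (scale a f c)
  from fixed_vector.scale[OF scale.IH] show ?case by (simp add: mult.assoc)
qed (simp add: fixed_vector.zero)

text \<open>A cup is its own mirror image: reversal exchanges its two letters and
  \<open>flip\<close> exchanges them back. Conjugation is carried along because the operation is
  antilinear.\<close>

lemma fixed_vector_dual:
  assumes "fixed_vector a f"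
  shows "fixed_vector (dual_word a) (\<lambda>L. cnj (f (dual L)))"
  using assms
proof induction
  case unit
  have "(dual L = []) = (L = [])" for L :: "('a \<times> letter) list" by (simp add: dual_def)
  then show ?case using fixed_vector.unit by (simp add: if_distrib[of cnj] cong: if_cong)
next
  case (cup a b f x)
  have "fixed_vector (dual_word (a @ x # flip x # b)) (cup (length (dual_word b)) x (\<lambda>L. cnj (f (dual L))))"
    using fixed_vector.cup[of "dual_word b" "dual_word a" _ x] cup.IH by simp
  then show ?case
  proof (rule fixed_vector_congI)
    fix L :: "('a \<times> letter) list" assume L: "L \<notin> colored (dual_word (a @ x # flip x # b))"
    then have "dual L \<notin> colored (a @ x # flip x # b)"
      by (auto simp: colored_def) (metis dual_word_simps(5) dual_word_simps(2,3) append.assoc append_Cons append_Nil)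
    then show "cnj (cup (length a) x f (dual L)) = 0"
      using fixed_vector_support[OF fixed_vector.cup[OF cup.hyps]] by simp
  next
    fix L :: "('a \<times> letter) list" assume "L \<in> colored (dual_word (a @ x # flip x # b))"
    then obtain X Y s t where L: "L = Y @ (s, x) # (t, flip x) # X" "length Y = length b" "length X = length a"
      by (auto simp: colored_append colored_Cons length_colored)
    have "cup (length a) x f (dual X @ (t, x) # (s, flip x) # dual Y) = (if s = t then f (dual X @ dual Y) else 0)"
      by (subst cup_append) (auto simp: L)
    then show "cnj (cup (length a) x f (dual L)) = cup (length (dual_word b)) x (\<lambda>L. cnj (f (dual L))) L"
      by (auto simp: L cup_append)
  qed
next
  case (add a f h)
  from fixed_vector.add[OF add.IH] show ?case by simp
next
  case (scale a f c)
  from fixed_vector.scale[OF scale.IH, of "cnj c"] show ?case by simp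
qed (simp add: fixed_vector.zero)

text \<open>\<open>a @ dual_word a\<close> is nested around its middle, where the last letter of
  \<open>a\<close> meets its flip. Capping works outwards from there, hence the induction from the
  right end of \<open>a\<close>.\<close>

lemma fixed_vector_contract:
  assumes "fixed_vector (u @ a @ dual_word a @ w) f"
  shows "fixed_vector (u @ w) (\<lambda>L. \<Sum>K\<in>colored a. f (take (length u) L @ K @ dual K @ drop (length u) L))"
  using assms
proof (induction a arbitrary: f rule: rev_induct)
  case Nil
  then show ?case by simp
next
  case (snoc x b)
  have "fixed_vector ((u @ b) @ x # flip x # (dual_word b @ w)) f" using snoc.prems by simp
  from fixed_vector_cap[OF this refl]
  have "fixed_vector (u @ b @ dual_word b @ w) (cap (length (u @ b)) x f)" by simp
  from snoc.IH[OF this] show ?case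
  proof (rule fixed_vector_congI)
    fix L :: "('a \<times> letter) list" assume L: "L \<notin> colored (u @ w)"
    have "take (length u) L @ K @ dual K @ drop (length u) L \<notin> colored (u @ (b @ [x]) @ dual_word (b @ [x]) @ w)"
      if "K \<in> colored (b @ [x])" for K
    proof
      assume *: "take (length u) L @ K @ dual K @ drop (length u) L \<in> colored (u @ (b @ [x]) @ dual_word (b @ [x]) @ w)"
      from length_colored[OF *] length_colored[OF that] have "length L = length u + length w" by simp
      with * that have "map snd (take (length u) L) = u \<and> map snd (drop (length u) L) = w"
        by (auto simp: colored_def append_eq_append_conv)
      with L show False by (simp add: colored_def) (metis append_take_drop_id map_append)
    qed
    then show "(\<Sum>K\<in>colored (b @ [x]). f (take (length u) L @ K @ dual K @ drop (length u) L)) = 0"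
      using fixed_vector_support[OF snoc.prems] by (simp add: sum.neutral)
  next
    fix L :: "('a \<times> letter) list" assume L: "L \<in> colored (u @ w)"
    then obtain X Y where XY: "L = X @ Y" "length X = length u" by (auto simp: colored_append length_colored)
    have "cap (length (u @ b)) x f ((X @ K) @ dual K @ Y)
        = (\<Sum>s\<in>UNIV. f ((X @ K) @ (s, x) # (s, flip x) # dual K @ Y))" if "K \<in> colored b" for K
      using that XY by (intro cap_append) (simp add: length_colored)
    then show "(\<Sum>K\<in>colored (b @ [x]). f (take (length u) L @ K @ dual K @ drop (length u) L)) =
        (\<Sum>K\<in>colored b. cap (length (u @ b)) x f (take (length u) L @ K @ dual K @ drop (length u) L))"
      by (simp add: XY sum_colored_append sum_colored_Cons)
  qed
qed

text \<open>Composition of intertwiners written as fixed vectors: tensor the two and contract the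
  common word.\<close>

lemma fixed_vector_compose:
  assumes f: "fixed_vector (u @ a) f" and g: "fixed_vector (dual_word a @ w) g"
  shows "fixed_vector (u @ w) (\<lambda>L. \<Sum>K\<in>colored a. f (take (length u) L @ K) * g (dual K @ drop (length u) L))"
proof -
  from fixed_vector_tensor[OF f g]
  have "fixed_vector (u @ a @ dual_word a @ w)
      (\<lambda>L. f (take (length (u @ a)) L) * g (drop (length (u @ a)) L))" by simp
  from fixed_vector_contract[OF this] show ?thesis
  proof (rule fixed_vector_congI)
    fix L :: "('a \<times> letter) list" assume "L \<in> colored (u @ w)"
    then show "(\<Sum>K\<in>colored a. f (take (length u) L @ K) * g (dual K @ drop (length u) L)) =
      (\<Sum>K\<in>colored a. f (take (length (u @ a)) (take (length u) L @ K @ dual K @ drop (length u) L)) *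
         g (drop (length (u @ a)) (take (length u) L @ K @ dual K @ drop (length u) L)))"
      by (intro sum.cong refl) (auto simp: length_colored)
  next
    fix L :: "('a \<times> letter) list" assume L: "L \<notin> colored (u @ w)"
    have "f (take (length u) L @ K) * g (dual K @ drop (length u) L) = 0" if "K \<in> colored a" for K
    proof (cases "map snd (take (length u) L) = u")
      case True
      then have "map snd (drop (length u) L) \<noteq> w"
        using L unfolding colored_def by (metis (mono_tags) append_take_drop_id map_append mem_Collect_eq)
      then have "dual K @ drop (length u) L \<notin> colored (dual_word a @ w)"
        using that by (auto simp: colored_def)
      then show ?thesis using fixed_vector_support[OF g] by simp
    next
      case False
      then have "take (length u) L @ K \<notin> colored (u @ a)"
        using that by (auto simp: colored_def)
      then show ?thesis using fixed_vector_support[OF f] by simp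
    qed
    then show "(\<Sum>K\<in>colored a. f (take (length u) L @ K) * g (dual K @ drop (length u) L)) = 0"
      by (simp add: sum.neutral)
  qed
qed

text \<open>Cup and cap are transposes of each other; this transfers stability under caps into
  identities for the projection.\<close>

lemma sum_cup:
  "(\<Sum>L\<in>colored (a @ x # flip x # b). c L * cup (length a) x f (L :: ('n::finite \<times> letter) list)) =
   (\<Sum>L\<in>colored (a @ b). cap (length a) x c L * f L)"
proof -
  have "c (X @ (s, x) # (t, flip x) # Y) * cup (length a) x f (X @ (s, x) # (t, flip x) # Y) =
      (if t = s then c (X @ (s, x) # (s, flip x) # Y) * f (X @ Y) else 0)" if "X \<in> colored a" for X Y s t
    using that by (simp add: cup_append length_colored)
  then show ?thesis
    by (simp add: sum_colored_append sum_colored_Cons cap_append length_colored sum_distrib_right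
        sum.swap[of _ "colored b" UNIV])
qed

section \<open>The projection onto the span of the non-crossing pairings\<close>


lemma function_subspace_fixed_vectors:
  "function_subspace (colored a) {f :: ('n::finite \<times> letter) list \<Rightarrow> complex. fixed_vector a f}"
  unfolding function_subspace_def
  using fixed_vector.zero fixed_vector.add fixed_vector.scale fixed_vector_support by blast

lemma fixed_vector_sum:
  assumes "\<And>k. k \<in> A \<Longrightarrow> fixed_vector a (f k)"
  shows "fixed_vector a (\<lambda>L. \<Sum>k\<in>A. c k * f k L)"
  using function_subspace_sum[OF function_subspace_fixed_vectors, of A f a c] assms by simp

definition fixed_frame :: "letter list \<Rightarrow> (('n::finite \<times> letter) list \<Rightarrow> complex) set" where
  "fixed_frame a = (SOME B. parseval_frame (colored a) {f. fixed_vector a f} B)"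

text \<open>The entry at \<open>I\<close>, \<open>J\<close> of the projection, equivalently the
  reproducing kernel of the fixed vectors. The word is read off \<open>I\<close>, so one function
  serves all words; lists spelling different words give 0.\<close>

definition fixed_projection :: "('n::finite \<times> letter) list \<Rightarrow> ('n \<times> letter) list \<Rightarrow> complex" where
  "fixed_projection I J = (\<Sum>e\<in>fixed_frame (map snd I). e I * cnj (e J))"

lemma parseval_fixed_frame: "parseval_frame (colored a) {f. fixed_vector a f} (fixed_frame a)"
  unfolding fixed_frame_def
  by (rule someI_ex[OF ex_parseval_frame[OF finite_colored function_subspace_fixed_vectors]])

lemma fixed_frame: "e \<in> fixed_frame a \<Longrightarrow> fixed_vector a e"
  using parseval_fixed_frame[of a] by (auto simp: parseval_frame_def)

lemma finite_fixed_frame [simp]: "finite (fixed_frame a)"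
  using parseval_fixed_frame[of a] by (auto simp: parseval_frame_def)

lemma fixed_projection_colored:
  "I \<in> colored a \<Longrightarrow> fixed_projection I J = (\<Sum>e\<in>fixed_frame a. e I * cnj (e J))"
  by (simp add: fixed_projection_def colored_def)

lemma fixed_projection_eq_0: "map snd I \<noteq> map snd J \<Longrightarrow> fixed_projection I J = 0"
  unfolding fixed_projection_def
  by (intro sum.neutral ballI) (simp add: fixed_vector_support[OF fixed_frame] colored_def)

lemma fixed_projection_commute: "fixed_projection I J = cnj (fixed_projection J I)"
proof (cases "map snd I = map snd J")
  case True
  then show ?thesis by (simp add: fixed_projection_def mult.commute)
next
  case False
  then show ?thesis by (metis fixed_projection_eq_0 complex_cnj_zero)
qed

lemma fixed_vector_fixed_projection:
  assumes "J \<in> colored a"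
  shows "fixed_vector a (\<lambda>I. fixed_projection I J)"
proof (rule fixed_vector_congI)
  show "fixed_vector a (\<lambda>I. \<Sum>e\<in>fixed_frame a. cnj (e J) * e I)"
    by (intro fixed_vector_sum fixed_frame)
  show "fixed_projection I J = 0" if "I \<notin> colored a" for I
    using that assms by (intro fixed_projection_eq_0) (auto simp: colored_def)
  show "fixed_projection I J = (\<Sum>e\<in>fixed_frame a. cnj (e J) * e I)" if "I \<in> colored a" for I
    using that by (simp add: fixed_projection_colored mult.commute)
qed

lemma fixed_projection_reproducing:
  assumes "fixed_vector a f" "I \<in> colored a"
  shows "(\<Sum>J\<in>colored a. fixed_projection I J * f J) = f I"
proof -
  have "f I = (\<Sum>e\<in>fixed_frame a. finner (colored a) e f * e I)"
    using parseval_fixed_frame[of a] assms(1) unfolding parseval_frame_def by blast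
  also have "\<dots> = (\<Sum>J\<in>colored a. \<Sum>e\<in>fixed_frame a. e I * cnj (e J) * f J)"
    by (subst sum.swap) (simp add: finner_def sum_distrib_left sum_distrib_right mult_ac)
  finally show ?thesis
    using assms(2) by (simp add: fixed_projection_colored sum_distrib_right)
qed

lemma finner_fixed_projection:
  assumes "fixed_vector a g" "J \<in> colored a"
  shows "finner (colored a) g (\<lambda>I. fixed_projection I J) = cnj (g J)"
proof -
  have "finner (colored a) g (\<lambda>I. fixed_projection I J) = cnj (\<Sum>I\<in>colored a. fixed_projection J I * g I)"
    unfolding finner_def cnj_sum complex_cnj_mult by (simp only: fixed_projection_commute[of _ J] mult.commute)
  then show ?thesis using fixed_projection_reproducing[OF assms] by simp
qed

text \<open>The difference is fixed and orthogonal to all fixed vectors, hence to itself. The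
  identities below are proved by this test: both sides are fixed vectors in the row index, and
  pairing with the kernel is just evaluation.\<close>

lemma fixed_vector_eqI:
  assumes f: "fixed_vector a f" and g: "fixed_vector a g"
    and "\<And>h. fixed_vector a h \<Longrightarrow> finner (colored a) h f = finner (colored a) h g"
  shows "f = g"
proof
  fix L
  have "fixed_vector a (\<lambda>L. f L - g L)"
    using function_subspace_diff[OF function_subspace_fixed_vectors] f g by blast
  then have "finner (colored a) (\<lambda>L. f L - g L) (\<lambda>L. f L - g L) = 0"
    using assms(3) by (simp add: finner_diff_right)
  then have "f L - g L = 0" if "L \<in> colored a"
    using finner_self_eq_0[OF finite_colored _ that, of "\<lambda>L. f L - g L"] by simp
  then show "f L = g L"
    using fixed_vector_support[OF f] fixed_vector_support[OF g] by (cases "L \<in> colored a") auto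
qed

text \<open>The projections commute with insertion of a cup, because the adjoint operation, the cap,
  preserves fixed vectors. Read as values of the form, this is the relation making the sum of v_sk
  v_tk* over k equal to 1 or 0, inside an arbitrary monomial.\<close>

lemma fixed_projection_cup:
  assumes X: "length X = length X'" and Y: "length Y = length Y'"
  shows "(\<Sum>k\<in>UNIV. fixed_projection (X @ (s, x) # (t, flip x) # Y) (X' @ (k, x) # (k, flip x) # Y'))
    = (if s = t then fixed_projection (X @ Y) (X' @ Y') else 0)"
proof -
  define a where "a = map snd X'"
  define b where "b = map snd Y'"
  have X': "X' \<in> colored a" and Y': "Y' \<in> colored b" by (simp_all add: a_def b_def colored_def)
  let ?w = "a @ x # flip x # b"
  have mem: "X' @ (k, x) # (k, flip x) # Y' \<in> colored ?w" for k
    using X' Y' by (simp add: colored_def)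
  have memXY: "X' @ Y' \<in> colored (a @ b)" using X' Y' by (auto simp: colored_append)
  have "(\<lambda>L. \<Sum>k\<in>UNIV. fixed_projection L (X' @ (k, x) # (k, flip x) # Y'))
      = cup (length a) x (\<lambda>L. fixed_projection L (X' @ Y'))"
  proof (rule fixed_vector_eqI)
    show "fixed_vector ?w (\<lambda>L. \<Sum>k\<in>UNIV. fixed_projection L (X' @ (k, x) # (k, flip x) # Y'))"
      using fixed_vector_sum[of UNIV ?w "\<lambda>k L. fixed_projection L (X' @ (k, x) # (k, flip x) # Y')" "\<lambda>_. 1"]
        fixed_vector_fixed_projection[OF mem] by simp
    show "fixed_vector ?w (cup (length a) x (\<lambda>L. fixed_projection L (X' @ Y')))"
      by (intro fixed_vector.cup fixed_vector_fixed_projection memXY)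
    fix h :: "('a \<times> letter) list \<Rightarrow> complex"
    assume h: "fixed_vector ?w h"
    have "finner (colored ?w) h (\<lambda>L. \<Sum>k\<in>UNIV. fixed_projection L (X' @ (k, x) # (k, flip x) # Y'))
        = (\<Sum>k\<in>UNIV. cnj (h (X' @ (k, x) # (k, flip x) # Y')))"
      by (simp add: finner_sum_right finner_fixed_projection[OF h mem])
    also have "\<dots> = cnj (cap (length a) x h (X' @ Y'))"
      by (simp add: cap_append a_def)
    also have "\<dots> = finner (colored (a @ b)) (cap (length a) x h) (\<lambda>L. fixed_projection L (X' @ Y'))"
      by (rule finner_fixed_projection[symmetric, OF fixed_vector_cap[OF h refl] memXY])
    also have "\<dots> = finner (colored ?w) h (cup (length a) x (\<lambda>L. fixed_projection L (X' @ Y')))"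
      unfolding finner_def sum_cup by (simp add: cap_def)
    finally show "finner (colored ?w) h (\<lambda>L. \<Sum>k\<in>UNIV. fixed_projection L (X' @ (k, x) # (k, flip x) # Y'))
        = finner (colored ?w) h (cup (length a) x (\<lambda>L. fixed_projection L (X' @ Y')))" .
  qed
  from fun_cong[OF this, of "X @ (s, x) # (t, flip x) # Y"] show ?thesis
    using X by (auto simp: cup_append a_def)
qed

lemma fixed_projection_cup':
  assumes "length X = length X'" "length Y = length Y'"
  shows "(\<Sum>k\<in>UNIV. fixed_projection (X @ (k, x) # (k, flip x) # Y) (X' @ (s, x) # (t, flip x) # Y'))
    = (if s = t then fixed_projection (X @ Y) (X' @ Y') else 0)"
proof -
  have "(\<Sum>k\<in>UNIV. fixed_projection (X @ (k, x) # (k, flip x) # Y) (X' @ (s, x) # (t, flip x) # Y'))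
      = cnj (\<Sum>k\<in>UNIV. fixed_projection (X' @ (s, x) # (t, flip x) # Y') (X @ (k, x) # (k, flip x) # Y))"
    unfolding cnj_sum by (simp only: fixed_projection_commute[symmetric])
  also have "\<dots> = (if s = t then fixed_projection (X @ Y) (X' @ Y') else 0)"
    using assms by (simp add: fixed_projection_cup fixed_projection_commute[of "X @ Y"])
  finally show ?thesis .
qed

text \<open>Reversal with conjugation is an antiunitary map carrying the fixed vectors of a word
  onto those of its dual, so it conjugates one projection into the other.\<close>

lemma fixed_projection_dual:
  "fixed_projection (dual I) (dual J) = cnj (fixed_projection I J)"
proof (cases "map snd I = map snd J")
  case True
  define a where "a = map snd J"
  have IJ: "I \<in> colored a" "J \<in> colored a" using True by (simp_all add: a_def colored_def)
  have dJ: "dual J \<in> colored (dual_word a)" by (simp add: a_def colored_def)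
  have "(\<lambda>L. fixed_projection L (dual J)) = (\<lambda>L. cnj (fixed_projection (dual L) J))"
  proof (rule fixed_vector_eqI[of "dual_word a"])
    show "fixed_vector (dual_word a) (\<lambda>L. fixed_projection L (dual J))"
      by (rule fixed_vector_fixed_projection[OF dJ])
    show "fixed_vector (dual_word a) (\<lambda>L. cnj (fixed_projection (dual L) J))"
      by (rule fixed_vector_dual[OF fixed_vector_fixed_projection[OF IJ(2)]])
    fix h :: "('a \<times> letter) list \<Rightarrow> complex"
    assume h: "fixed_vector (dual_word a) h"
    have h': "fixed_vector a (\<lambda>L. cnj (h (dual L)))" using fixed_vector_dual[OF h] by simp
    have "finner (colored (dual_word a)) h (\<lambda>L. cnj (fixed_projection (dual L) J))
        = cnj (finner (colored a) (\<lambda>L. cnj (h (dual L))) (\<lambda>L. fixed_projection L J))"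
      by (simp add: finner_def sum_colored_dual)
    also have "\<dots> = cnj (h (dual J))" by (simp add: finner_fixed_projection[OF h' IJ(2)])
    also have "\<dots> = finner (colored (dual_word a)) h (\<lambda>L. fixed_projection L (dual J))"
      by (rule finner_fixed_projection[OF h dJ, symmetric])
    finally show "finner (colored (dual_word a)) h (\<lambda>L. fixed_projection L (dual J)) =
      finner (colored (dual_word a)) h (\<lambda>L. cnj (fixed_projection (dual L) J))" by (rule sym)
  qed
  from fun_cong[OF this, of "dual I"] show ?thesis by simp
next
  case False
  then have "map snd (dual I) \<noteq> map snd (dual J)" by (metis dual_simps(6) dual_word_simps(5))
  then show ?thesis using False by (simp add: fixed_projection_eq_0 del: dual_simps)
qed

text \<open>Left multiplication by an intertwiner commutes with the projection onto the intertwiners, both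
  written by Frobenius reciprocity as vectors fixed by the word \<open>dual_word u @ a\<close>.\<close>

lemma fixed_projection_intertwiner:
  assumes e: "fixed_vector (dual_word u @ a) e" and I: "I \<in> colored u" and J: "J \<in> colored a"
    and I': "I' \<in> colored a'" and J': "J' \<in> colored a'"
  shows "(\<Sum>K\<in>colored a. e (dual I @ K) * fixed_projection (dual K @ I') (dual J @ J'))
    = (\<Sum>K\<in>colored u. fixed_projection (dual I @ I') (dual K @ J') * e (dual K @ J))"
proof -
  let ?w = "dual_word u @ a'"
  let ?f = "\<lambda>L. \<Sum>K\<in>colored a. e (take (length (dual_word u)) L @ K) *
    fixed_projection (dual K @ drop (length (dual_word u)) L) (dual J @ J')"
  let ?g = "\<lambda>L. \<Sum>K\<in>colored u. e (dual K @ J) * fixed_projection L (dual K @ J')"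
  have mem: "dual K @ M \<in> colored (dual_word b @ c)" if "K \<in> colored b" "M \<in> colored c"
    for K M :: "('a \<times> letter) list" and b c
    using that by (auto simp: colored_def)
  have "?f = ?g"
  proof (rule fixed_vector_eqI)
    show "fixed_vector ?w ?f"
      by (rule fixed_vector_compose[OF e fixed_vector_fixed_projection[OF mem[OF J J']]])
    show "fixed_vector ?w ?g"
      by (intro fixed_vector_sum fixed_vector_fixed_projection mem J')
    fix h :: "('a \<times> letter) list \<Rightarrow> complex"
    assume h: "fixed_vector ?w h"
    have e': "fixed_vector (dual_word a @ u) (\<lambda>L. cnj (e (dual L)))"
      using fixed_vector_dual[OF e] by simp
    \<comment> \<open>\<open>r\<close> is the adjoint of the intertwiner \<open>e\<close> applied to
      the test vector \<open>h\<close>. It is fixed again, so the kernel evaluates it.\<close>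
    define r where "r L = (\<Sum>K\<in>colored u. cnj (e (dual (take (length (dual_word a)) L @ K))) *
      h (dual K @ drop (length (dual_word a)) L))" for L
    have r: "fixed_vector (dual_word a @ a') r"
      unfolding r_def by (rule fixed_vector_compose[OF e' h])
    have r_app: "r (dual K @ M) = (\<Sum>I\<in>colored u. cnj (e (dual I @ K)) * h (dual I @ M))"
      if "K \<in> colored a" for K M using that by (simp add: r_def length_colored)
    have "finner (colored ?w) h ?f = (\<Sum>I\<in>colored u. \<Sum>I'\<in>colored a'. \<Sum>K\<in>colored a.
        cnj (h (dual I @ I')) * (e (dual I @ K) * fixed_projection (dual K @ I') (dual J @ J')))"
      by (simp add: finner_def sum_colored_append sum_colored_dual length_colored sum_distrib_left)
    also have "\<dots> = (\<Sum>K\<in>colored a. \<Sum>I'\<in>colored a'. \<Sum>I\<in>colored u.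
        cnj (h (dual I @ I')) * (e (dual I @ K) * fixed_projection (dual K @ I') (dual J @ J')))"
      by (subst sum.swap, subst (2) sum.swap, subst sum.swap) (rule refl)
    also have "\<dots> = finner (colored (dual_word a @ a')) r (\<lambda>L. fixed_projection L (dual J @ J'))"
      by (simp add: finner_def sum_colored_append sum_colored_dual r_app sum_distrib_left sum_distrib_right mult_ac)
    also have "\<dots> = cnj (r (dual J @ J'))"
      by (rule finner_fixed_projection[OF r mem[OF J J']])
    also have "\<dots> = (\<Sum>K\<in>colored u. e (dual K @ J) * cnj (h (dual K @ J')))"
      by (simp add: r_app[OF J])
    also have "\<dots> = finner (colored ?w) h ?g"
      by (simp add: finner_sum_right finner_scale_right finner_fixed_projection[OF h mem[OF _ J']])
    finally show "finner (colored ?w) h ?f = finner (colored ?w) h ?g" .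
  qed
  from fun_cong[OF this, of "dual I @ I'"] show ?thesis
    using I by (simp add: length_colored mult.commute)
qed

text \<open>The Casimir lemma is applied to block matrices indexed by all lists over words in
  \<open>S\<close>. The matrices are frames of the intertwiner spaces, so that \<Sum> b \<otimes>
  cnj b reproduces the projection kernel; the commutation hypothesis is the preceding lemma.\<close>

lemma fixed_projection_form_nonneg:
  fixes c :: "('n::finite \<times> letter) list \<Rightarrow> ('n \<times> letter) list \<Rightarrow> complex"
  assumes S: "finite S" and c: "\<And>I J. map snd I \<noteq> map snd J \<Longrightarrow> c I J = 0"
  defines "X \<equiv> \<Union> (colored ` S)"
  shows "(\<Sum>I\<in>X. \<Sum>J\<in>X. \<Sum>I'\<in>X. \<Sum>J'\<in>X.
    cnj (c I J) * c I' J' * fixed_projection (dual I @ I') (dual J @ J')) \<in> \<real>\<^sub>\<ge>\<^sub>0"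
proof -
  \<comment> \<open>A triple \<open>(u, a, e)\<close> stands for a frame element \<open>e\<close>
    regarded as a matrix block from the word \<open>a\<close> to the word \<open>u\<close>.\<close>
  define T :: "(letter list \<times> letter list \<times> (('n \<times> letter) list \<Rightarrow> complex)) set"
    where "T = (SIGMA u:S. SIGMA a:S. fixed_frame (dual_word u @ a))"
  define b :: "letter list \<times> letter list \<times> (('n \<times> letter) list \<Rightarrow> complex) \<Rightarrow> ('n \<times> letter) list \<Rightarrow> ('n \<times> letter) list \<Rightarrow> complex"
    where "b t I K = (case t of (u, a, e) \<Rightarrow> if map snd I = u \<and> map snd K = a then e (dual I @ K) else 0)" for t I K
  define R where "R I I' J J' = (\<Sum>t\<in>T. b t I I' * cnj (b t J J'))" for I I' J J'
  have X: "finite X" using S by (simp add: X_def)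
  have inX: "I \<in> X \<longleftrightarrow> map snd I \<in> S" for I by (auto simp: X_def colored_def)
  have R_eq: "R I I' J J' = (if map snd I = map snd J \<and> map snd I' = map snd J'
      then fixed_projection (dual I @ I') (dual J @ J') else 0)"
    if "I \<in> X" "I' \<in> X" for I I' J J'
  proof -
    have "R I I' J J' = (\<Sum>u\<in>S. \<Sum>a\<in>S. \<Sum>e\<in>fixed_frame (dual_word u @ a). b (u, a, e) I I' * cnj (b (u, a, e) J J'))"
      using S by (simp add: R_def T_def sum.Sigma case_prod_beta')
    also have "\<dots> = (\<Sum>u\<in>S. if u = map snd I then \<Sum>a\<in>S. if a = map snd I' then
        if map snd I = map snd J \<and> map snd I' = map snd J'
        then fixed_projection (dual I @ I') (dual J @ J') else 0 else 0 else 0)"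
      by (intro sum.cong refl) (auto simp: b_def fixed_projection_def intro!: sum.neutral sum.cong)
    also have "\<dots> = (if map snd I = map snd J \<and> map snd I' = map snd J'
        then fixed_projection (dual I @ I') (dual J @ J') else 0)"
      using that S by (simp add: inX sum.delta)
    finally show ?thesis .
  qed
  have sumX: "(\<Sum>K\<in>X. g K) = (\<Sum>K\<in>colored u. g K)"
    if "u \<in> S" "\<And>K. map snd K \<noteq> u \<Longrightarrow> g K = 0" for u and g :: "('n \<times> letter) list \<Rightarrow> complex"
    using that X by (intro sum.mono_neutral_right) (auto simp: X_def colored_def)
  have "(\<Sum>I\<in>X. \<Sum>J\<in>X. \<Sum>I'\<in>X. \<Sum>J'\<in>X. cnj (c I J) * c I' J' * R I I' J J') \<in> \<real>\<^sub>\<ge>\<^sub>0"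
  proof (rule casimir_form_nonneg[OF X R_def])
    fix t and I I' J J' :: "('n \<times> letter) list"
    assume t: "t \<in> T" and mem: "I \<in> X" "I' \<in> X" "J \<in> X" "J' \<in> X"
    obtain u a e where t_eq: "t = (u, a, e)" by (cases t)
    with t have ua: "u \<in> S" "a \<in> S" and e: "fixed_vector (dual_word u @ a) e"
      by (auto simp: T_def fixed_frame)
    show "(\<Sum>K\<in>X. b t I K * R K I' J J') = (\<Sum>K\<in>X. R I I' K J' * b t K J)"
    proof (cases "map snd I = u \<and> map snd J = a \<and> map snd I' = map snd J'")
      case True
      have "(\<Sum>K\<in>X. b t I K * R K I' J J') = (\<Sum>K\<in>colored a. b t I K * R K I' J J')"
        by (rule sumX[OF ua(2)]) (simp add: b_def t_eq)
      also have "\<dots> = (\<Sum>K\<in>colored a. e (dual I @ K) * fixed_projection (dual K @ I') (dual J @ J'))"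
        using True mem ua by (intro sum.cong refl) (simp add: R_eq inX b_def t_eq colored_def)
      also have "\<dots> = (\<Sum>K\<in>colored u. fixed_projection (dual I @ I') (dual K @ J') * e (dual K @ J))"
        using True by (intro fixed_projection_intertwiner[OF e, of _ _ _ "map snd I'"]) (auto simp: colored_def)
      also have "\<dots> = (\<Sum>K\<in>colored u. R I I' K J' * b t K J)"
        using True mem ua by (intro sum.cong refl) (simp add: R_eq b_def t_eq colored_def)
      also have "\<dots> = (\<Sum>K\<in>X. R I I' K J' * b t K J)"
        by (rule sumX[OF ua(1), symmetric]) (simp add: b_def t_eq)
      finally show ?thesis .
    next
      case False
      have "(\<Sum>K\<in>X. b t I K * R K I' J J') = 0"
        using False mem by (intro sum.neutral ballI) (auto simp: b_def t_eq R_eq)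
      moreover have "(\<Sum>K\<in>X. R I I' K J' * b t K J) = 0"
        using False mem by (intro sum.neutral ballI) (auto simp: b_def t_eq R_eq)
      ultimately show ?thesis by simp
    qed
  next
    fix I I' J J' :: "('n \<times> letter) list"
    assume mem: "I \<in> X" "I' \<in> X" "J \<in> X" "J' \<in> X"
    have "fixed_projection (dual I @ I') (dual J @ J') = cnj (fixed_projection (dual I' @ I) (dual J' @ J))"
      using fixed_projection_dual[of "dual I' @ I" "dual J' @ J"] by simp
    then show "R I I' J J' = cnj (R I' I J' J)" using mem by (simp add: R_eq)
  qed
  \<comment> \<open>The kernels can differ when the concatenated words agree but are cut at
    different places; there \<open>c\<close> vanishes.\<close>
  also have "(\<Sum>I\<in>X. \<Sum>J\<in>X. \<Sum>I'\<in>X. \<Sum>J'\<in>X. cnj (c I J) * c I' J' * R I I' J J') =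
     (\<Sum>I\<in>X. \<Sum>J\<in>X. \<Sum>I'\<in>X. \<Sum>J'\<in>X.
        cnj (c I J) * c I' J' * fixed_projection (dual I @ I') (dual J @ J'))"
    by (intro sum.cong refl) (use c in \<open>auto simp: R_eq\<close>)
  finally show ?thesis .
qed

section \<open>The Haar functional on the free *-algebra\<close>


definition monomial_row :: "('n \<times> 'n) monomial \<Rightarrow> ('n \<times> letter) list" where
  "monomial_row w = map (map_prod fst id) (symbols w)"

definition monomial_col :: "('n \<times> 'n) monomial \<Rightarrow> ('n \<times> letter) list" where
  "monomial_col w = map (map_prod snd id) (symbols w)"

text \<open>The letters are taken from \<open>I\<close> and only the indices from \<open>J\<close>,
  so the columns are recovered only if both lists spell the same word.\<close>

definition entry_monomial :: "('n \<times> letter) list \<Rightarrow> ('n \<times> letter) list \<Rightarrow> ('n \<times> 'n) monomial" where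
  "entry_monomial I J = Monomial (map2 (\<lambda>p q. ((fst p, fst q), snd p)) I J)"

lift_definition free_monomial :: "'g monomial \<Rightarrow> 'g free_algebra"
  is "\<lambda>w. Poly_Mapping.single w 1" .

definition free_haar :: "('n::finite \<times> 'n) free_algebra \<Rightarrow> complex" where
  "free_haar x = (\<Sum>w\<in>Poly_Mapping.keys (coeffs x).
     Poly_Mapping.lookup (coeffs x) w * fixed_projection (monomial_row w) (monomial_col w))"

section \<open>Monomials as a basis of the free *-algebra\<close>

lemma monomial_row_plus [simp]: "monomial_row (s + t) = monomial_row s @ monomial_row t" and monomial_col_plus [simp]: "monomial_col (s + t) = monomial_col s @ monomial_col t"
  by (simp_all add: monomial_row_def monomial_col_def plus_monomial_def)

lemma monomial_row_zero [simp]: "monomial_row 0 = []" and monomial_col_zero [simp]: "monomial_col 0 = []"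
  by (simp_all add: monomial_row_def monomial_col_def zero_monomial_def)

lemma monomial_row_star [simp]: "monomial_row (monomial_star w) = dual (monomial_row w)"
  and monomial_col_star [simp]: "monomial_col (monomial_star w) = dual (monomial_col w)"
  by (simp_all add: monomial_row_def monomial_col_def monomial_star_def dual_def rev_map o_def prod.map_comp)

lemma map_snd_monomial_row: "map snd (monomial_row w) = map snd (monomial_col w)"
  by (simp add: monomial_row_def monomial_col_def o_def)

lemma length_monomial_row: "length (monomial_row w) = length (monomial_col w)"
  by (simp add: monomial_row_def monomial_col_def)

lemma monomial_row_entry: "length I = length J \<Longrightarrow> monomial_row (entry_monomial I J) = I"
  by (induction I J rule: list_induct2) (auto simp: entry_monomial_def monomial_row_def)

lemma monomial_col_entry: "map snd I = map snd J \<Longrightarrow> monomial_col (entry_monomial I J) = J"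
proof -
  assume *: "map snd I = map snd J"
  then have "length I = length J" by (metis length_map)
  then show ?thesis using *
    by (induction I J rule: list_induct2) (auto simp: entry_monomial_def monomial_col_def)
qed

lemma entry_monomial_Nil [simp]: "entry_monomial [] [] = 0"
  by (simp add: entry_monomial_def zero_monomial_def)

lemma entry_monomial_append:
  "length I = length J \<Longrightarrow> entry_monomial (I @ I') (J @ J') = entry_monomial I J + entry_monomial I' J'"
  by (simp add: entry_monomial_def plus_monomial_def)

lemma free_monomial_plus: "free_monomial (s + t) = free_monomial s * free_monomial t"
  by transfer (simp add: mult_single)

lemma free_monomial_zero: "free_monomial 0 = 1"
  by transfer simp

lemma free_monomial_star: "free_monomial (monomial_star w) = star (free_monomial w)"
  by transfer (simp add: pm_star_single)

lemma free_monomial_letter: "free_monomial (Monomial [(g, x)]) = letter_pow (gen g) x"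
proof (cases x)
  case Alpha
  then show ?thesis by (simp add: free_monomial_def gen_def)
next
  case Beta
  have "Monomial [(g, x)] = monomial_star (Monomial [(g, Alpha)])"
    by (simp add: monomial_star_def Beta)
  then have "free_monomial (Monomial [(g, x)]) = star (free_monomial (Monomial [(g, Alpha)]))"
    by (simp only: free_monomial_star)
  then show ?thesis by (simp add: Beta free_monomial_def gen_def)
qed

lemma free_eval_free_monomial: "free_eval u (free_monomial w) = monomial_eval u w"
  by (simp add: free_eval_pm_eval free_monomial.rep_eq pm_eval_single scaleC_one)

lemma coeffs_sum: "coeffs (sum f A) = (\<Sum>k\<in>A. coeffs (f k))"
  by (induction A rule: infinite_finite_induct) (simp_all add: zero_free_algebra.rep_eq plus_free_algebra.rep_eq)

lemma free_algebra_expansion: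
  "(\<Sum>w\<in>Poly_Mapping.keys (coeffs x). Poly_Mapping.lookup (coeffs x) w *\<^sub>C free_monomial w) = x"
proof -
  have "coeffs (\<Sum>w\<in>Poly_Mapping.keys (coeffs x). Poly_Mapping.lookup (coeffs x) w *\<^sub>C free_monomial w) = coeffs x"
    using poly_mapping_sum_single[of "coeffs x"]
    by (simp add: coeffs_sum scaleC_free_algebra.rep_eq free_monomial.rep_eq mult_single)
  then show ?thesis by (simp add: coeffs_inject)
qed

lemma free_haar_superset:
  assumes "finite K" "Poly_Mapping.keys (coeffs x) \<subseteq> K"
  shows "free_haar x = (\<Sum>w\<in>K. Poly_Mapping.lookup (coeffs x) w * fixed_projection (monomial_row w) (monomial_col w))"
  unfolding free_haar_def using assms
  by (intro sum.mono_neutral_left) (auto simp: in_keys_iff)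

lemma free_haar_add: "free_haar (x + y) = free_haar x + free_haar y"
proof -
  let ?K = "Poly_Mapping.keys (coeffs x) \<union> Poly_Mapping.keys (coeffs y)"
  have "Poly_Mapping.keys (coeffs (x + y)) \<subseteq> ?K"
    by (simp add: plus_free_algebra.rep_eq Poly_Mapping.keys_add)
  then show ?thesis
    by (simp add: free_haar_superset[of ?K] plus_free_algebra.rep_eq lookup_add distrib_right sum.distrib)
qed

lemma lookup_single_zero_mult:
  "Poly_Mapping.lookup (Poly_Mapping.single 0 c * x) w = c * Poly_Mapping.lookup (x :: 'k::monoid_add \<Rightarrow>\<^sub>0 complex) w"
proof -
  let ?k = Poly_Mapping.keys and ?l = Poly_Mapping.lookup and ?s = Poly_Mapping.single
  have "?s 0 c * x = (\<Sum>k\<in>?k x. ?s k (c * ?l x k))"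
    by (subst poly_mapping_sum_single[of x]) (simp add: sum_distrib_left mult_single)
  then show ?thesis
    by (simp add: lookup_sum lookup_single when_def in_keys_iff)
qed

lemma free_haar_scale: "free_haar (c *\<^sub>C x) = c * free_haar x"
proof -
  have "Poly_Mapping.keys (coeffs (c *\<^sub>C x)) \<subseteq> Poly_Mapping.keys (coeffs x)"
    by (auto simp: in_keys_iff scaleC_free_algebra.rep_eq lookup_single_zero_mult)
  then have "free_haar (c *\<^sub>C x) = (\<Sum>w\<in>Poly_Mapping.keys (coeffs x).
      Poly_Mapping.lookup (coeffs (c *\<^sub>C x)) w * fixed_projection (monomial_row w) (monomial_col w))"
    by (intro free_haar_superset) simp_all
  then show ?thesis
    by (simp add: free_haar_def scaleC_free_algebra.rep_eq lookup_single_zero_mult sum_distrib_left mult.assoc)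
qed

lemma free_haar_zero: "free_haar 0 = 0"
  using free_haar_scale[of 0 0] by simp

lemma free_haar_sum: "free_haar (sum f A) = (\<Sum>k\<in>A. free_haar (f k))"
  by (induction A rule: infinite_finite_induct) (simp_all add: free_haar_add free_haar_zero)

lemma free_haar_diff: "free_haar (x - y) = free_haar x - free_haar y"
  using free_haar_add[of "x - y" y] by simp

lemma free_haar_monomial: "free_haar (free_monomial w) = fixed_projection (monomial_row w) (monomial_col w)"
  by (simp add: free_haar_def free_monomial.rep_eq)

lemma fixed_projection_Nil: "fixed_projection [] [] = (1 :: complex)"
  using fixed_projection_reproducing[OF fixed_vector.unit, of "[]"] by simp

lemma free_haar_one: "free_haar 1 = 1"
  using free_haar_monomial[of 0] by (simp add: free_monomial_zero fixed_projection_Nil)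

lemma free_haar_col_contract:
  "(\<Sum>k\<in>UNIV. free_haar (free_monomial s * (letter_pow (gen (i, k)) x * letter_pow (gen (j, k)) (flip x)) * free_monomial t))
    = (if i = j then free_haar (free_monomial s * free_monomial t) else 0)"
proof -
  have "free_monomial s * (letter_pow (gen (i, k)) x * letter_pow (gen (j, k)) (flip x)) * free_monomial t
      = free_monomial (s + (Monomial [((i, k), x)] + Monomial [((j, k), flip x)]) + t)" for k
    by (simp add: free_monomial_plus free_monomial_letter)
  moreover have "monomial_row (s + (Monomial [((i, k), x)] + Monomial [((j, k), flip x)]) + t)
      = monomial_row s @ (i, x) # (j, flip x) # monomial_row t" for k
    by (simp add: monomial_row_def plus_monomial_def)
  moreover have "monomial_col (s + (Monomial [((i, k), x)] + Monomial [((j, k), flip x)]) + t)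
      = monomial_col s @ (k, x) # (k, flip x) # monomial_col t" for k
    by (simp add: monomial_col_def plus_monomial_def)
  ultimately show ?thesis
    by (simp add: free_haar_monomial fixed_projection_cup length_monomial_row flip: free_monomial_plus)
qed

lemma free_haar_row_contract:
  "(\<Sum>k\<in>UNIV. free_haar (free_monomial s * (letter_pow (gen (k, i)) x * letter_pow (gen (k, j)) (flip x)) * free_monomial t))
    = (if i = j then free_haar (free_monomial s * free_monomial t) else 0)"
proof -
  have "free_monomial s * (letter_pow (gen (k, i)) x * letter_pow (gen (k, j)) (flip x)) * free_monomial t
      = free_monomial (s + (Monomial [((k, i), x)] + Monomial [((k, j), flip x)]) + t)" for k
    by (simp add: free_monomial_plus free_monomial_letter)
  moreover have "monomial_row (s + (Monomial [((k, i), x)] + Monomial [((k, j), flip x)]) + t)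
      = monomial_row s @ (k, x) # (k, flip x) # monomial_row t" for k
    by (simp add: monomial_row_def plus_monomial_def)
  moreover have "monomial_col (s + (Monomial [((k, i), x)] + Monomial [((k, j), flip x)]) + t)
      = monomial_col s @ (i, x) # (j, flip x) # monomial_col t" for k
    by (simp add: monomial_col_def plus_monomial_def)
  ultimately show ?thesis
    by (simp add: free_haar_monomial fixed_projection_cup' length_monomial_row flip: free_monomial_plus)
qed

text \<open>Unitarity of the matrix and of its transpose gives four families of relators. A variable
  letter \<open>x\<close> merges them into two, matching the column and the row contraction
  above.\<close>

lemma biunitary_relatorE:
  assumes "r \<in> biunitary_relators u"
  obtains i j x where
    "r = (\<Sum>k\<in>UNIV. letter_pow (u i k) x * letter_pow (u j k) (flip x)) - (if i = j then 1 else 0)"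
  | i j x where
    "r = (\<Sum>k\<in>UNIV. letter_pow (u k i) x * letter_pow (u k j) (flip x)) - (if i = j then 1 else 0)"
  using assms that(1)[of _ Alpha] that(1)[of _ Beta] that(2)[of _ Alpha] that(2)[of _ Beta]
  unfolding biunitary_relators_def unitary_matrix_relators_def by auto

lemma biunitary_relators_row: "(\<Sum>k\<in>UNIV. u i k * star (u i k)) - 1 \<in> biunitary_relators u"
  unfolding biunitary_relators_def unitary_matrix_relators_def
  by (intro UnI1 CollectI exI[of _ i]) simp

lemma biunitary_relators_col: "(\<Sum>k\<in>UNIV. star (u k i) * u k i) - 1 \<in> biunitary_relators u"
  unfolding biunitary_relators_def unitary_matrix_relators_def
  by (rule UnI1, rule UnI2, intro CollectI exI[of _ i]) simp

lemma free_haar_ideal: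
  fixes r :: "('n::finite \<times> 'n) free_algebra"
  assumes r: "r \<in> biunitary_relators (\<lambda>i j. gen (i, j))"
  shows "free_haar (z * r * y) = 0"
proof -
  have mono: "free_haar (free_monomial s * r * free_monomial t) = 0" for s t
    using r
    by (cases rule: biunitary_relatorE)
       (simp_all add: left_diff_distrib right_diff_distrib sum_distrib_left sum_distrib_right
         free_haar_diff free_haar_sum free_haar_col_contract free_haar_row_contract free_haar_zero)
  let ?k = "\<lambda>x. Poly_Mapping.keys (coeffs x)" and ?l = "\<lambda>x. Poly_Mapping.lookup (coeffs x)"
  have "z * r * y = (\<Sum>s\<in>?k z. ?l z s *\<^sub>C free_monomial s) * r * (\<Sum>t\<in>?k y. ?l y t *\<^sub>C free_monomial t)"
    by (simp only: free_algebra_expansion)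
  also have "free_haar \<dots> = 0"
    by (simp add: sum_distrib_left sum_distrib_right free_haar_sum mult_scaleC_left mult_scaleC_right
        free_haar_scale mono)
  finally show ?thesis .
qed

text \<open>Expanding \<open>star x * x\<close> in monomials gives exactly the quadratic form shown
  nonnegative above, for the matrix of coefficients of \<open>x\<close>.\<close>

lemma free_haar_nonneg: "free_haar (star x * x) \<in> \<real>\<^sub>\<ge>\<^sub>0"
proof -
  define K where "K = Poly_Mapping.keys (coeffs x)"
  define l where "l = Poly_Mapping.lookup (coeffs x)"
  define S where "S = (\<lambda>w. map snd (monomial_row w)) ` K"
  define X where "X = \<Union> (colored ` S :: ('a \<times> letter) list set set)"
  \<comment> \<open>The coefficients of \<open>x\<close> arranged by the row list and the column
    list of their monomials.\<close>
  define c where "c I J = (\<Sum>w\<in>K. if monomial_row w = I \<and> monomial_col w = J then l w else 0)" for I J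
  have K: "finite K" by (simp add: K_def)
  have X: "finite X" using K by (simp add: X_def S_def)
  have inX: "monomial_row w \<in> X" "monomial_col w \<in> X" if "w \<in> K" for w
  proof -
    have "map snd (monomial_row w) \<in> S" using that by (simp add: S_def)
    then show "monomial_row w \<in> X" "monomial_col w \<in> X"
      using map_snd_monomial_row[of w] by (auto simp: X_def colored_def)
  qed
  have sum_c: "(\<Sum>I\<in>X. \<Sum>J\<in>X. (\<Sum>w\<in>K. if monomial_row w = I \<and> monomial_col w = J then d w else 0) * g I J)
      = (\<Sum>w\<in>K. d w * g (monomial_row w) (monomial_col w))" for d and g :: "_ \<Rightarrow> _ \<Rightarrow> complex"
  proof -
    have "(\<Sum>I\<in>X. \<Sum>J\<in>X. (\<Sum>w\<in>K. if monomial_row w = I \<and> monomial_col w = J then d w else 0) * g I J)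
        = (\<Sum>I\<in>X. \<Sum>J\<in>X. \<Sum>w\<in>K. if monomial_row w = I then if monomial_col w = J then d w * g I J else 0 else 0)"
      by (intro sum.cong refl) (auto simp: sum_distrib_right intro!: sum.cong)
    also have "\<dots> = (\<Sum>w\<in>K. \<Sum>I\<in>X. \<Sum>J\<in>X. if monomial_row w = I then if monomial_col w = J then d w * g I J else 0 else 0)"
      by (simp only: sum.swap[of _ K X])
    also have "\<dots> = (\<Sum>w\<in>K. \<Sum>I\<in>X. if monomial_row w = I then \<Sum>J\<in>X. if monomial_col w = J then d w * g I J else 0 else 0)"
      by (intro sum.cong refl) auto
    also have "\<dots> = (\<Sum>w\<in>K. d w * g (monomial_row w) (monomial_col w))"
      by (intro sum.cong refl) (simp add: X inX)
    finally show ?thesis .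
  qed
  have cnj_c: "cnj (c I J) = (\<Sum>w\<in>K. if monomial_row w = I \<and> monomial_col w = J then cnj (l w) else 0)" for I J
    unfolding c_def cnj_sum by (intro sum.cong refl) auto
  have "(\<Sum>I\<in>X. \<Sum>J\<in>X. \<Sum>I'\<in>X. \<Sum>J'\<in>X.
      cnj (c I J) * c I' J' * fixed_projection (dual I @ I') (dual J @ J')) \<in> \<real>\<^sub>\<ge>\<^sub>0"
    unfolding X_def
  proof (rule fixed_projection_form_nonneg)
    show "finite S" using K by (simp add: S_def)
    show "c I J = 0" if "map snd I \<noteq> map snd J" for I J
      unfolding c_def using that map_snd_monomial_row by (intro sum.neutral ballI) auto
  qed
  also have "(\<Sum>I\<in>X. \<Sum>J\<in>X. \<Sum>I'\<in>X. \<Sum>J'\<in>X.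
      cnj (c I J) * c I' J' * fixed_projection (dual I @ I') (dual J @ J'))
    = (\<Sum>I\<in>X. \<Sum>J\<in>X. cnj (c I J) * (\<Sum>I'\<in>X. \<Sum>J'\<in>X. c I' J' * fixed_projection (dual I @ I') (dual J @ J')))"
    by (simp only: sum_distrib_left mult.assoc)
  also have "\<dots> = (\<Sum>w\<in>K. cnj (l w) * (\<Sum>w'\<in>K. l w' * fixed_projection (dual (monomial_row w) @ monomial_row w') (dual (monomial_col w) @ monomial_col w')))"
    unfolding cnj_c sum_c unfolding c_def sum_c ..
  also have "\<dots> = free_haar ((\<Sum>w\<in>K. star (l w *\<^sub>C free_monomial w)) * (\<Sum>w\<in>K. l w *\<^sub>C free_monomial w))"
  proof -
    have "(\<Sum>w\<in>K. star (l w *\<^sub>C free_monomial w)) * (\<Sum>w\<in>K. l w *\<^sub>C free_monomial w)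
        = (\<Sum>w\<in>K. \<Sum>w'\<in>K. (cnj (l w) * l w') *\<^sub>C free_monomial (monomial_star w + w'))"
      by (simp only: sum_product star_scaleC mult_scaleC_left mult_scaleC_right scaleC_scaleC
          free_monomial_star free_monomial_plus mult.commute[where 'a = complex])
    then show ?thesis
      by (simp add: free_haar_sum free_haar_scale free_haar_monomial sum_distrib_left mult.assoc)
  qed
  also have "(\<Sum>w\<in>K. star (l w *\<^sub>C free_monomial w)) * (\<Sum>w\<in>K. l w *\<^sub>C free_monomial w) = star x * x"
    by (simp add: K_def l_def free_algebra_expansion flip: star_sum)
  finally show ?thesis .
qed

lemma positive_functional_free_haar: "positive_functional free_haar"
  by standard (simp_all add: free_haar_add free_haar_scale free_haar_nonneg)

text \<open>Unitarity splits the squared norm of \<open>y\<close> into those of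
  \<open>w k * y\<close>, so generators and their adjoints act as contractions. Elements with
  bounded left multiplication form a unital subalgebra, hence are everything.\<close>

lemma bounded_positive_functional_free_haar:
  "bounded_positive_functional (free_haar :: ('n::finite \<times> 'n) free_algebra \<Rightarrow> complex)"
proof -
  interpret positive_functional "free_haar :: ('n \<times> 'n) free_algebra \<Rightarrow> complex"
    by (rule positive_functional_free_haar)
  define bdd where "bdd x \<longleftrightarrow> (\<exists>C\<ge>0. \<forall>y. gns_norm (x * y) \<le> C * gns_norm y)"
    for x :: "('n \<times> 'n) free_algebra"
  have contraction: "gns_norm (w k * y) \<le> gns_norm y"
    if "(\<Sum>k\<in>UNIV. star (w k) * w k) - 1 \<in> biunitary_relators (\<lambda>i j. gen (i, j))"
    for w :: "'n \<Rightarrow> ('n \<times> 'n) free_algebra" and k y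
  proof -
    have "free_haar (star y * ((\<Sum>k\<in>UNIV. star (w k) * w k) - 1) * y) = 0"
      by (rule free_haar_ideal[OF that])
    then have "(\<Sum>k\<in>UNIV. free_haar (star (w k * y) * (w k * y))) = free_haar (star y * y)"
      by (simp add: left_diff_distrib right_diff_distrib sum_distrib_left sum_distrib_right
          free_haar_diff free_haar_sum star_mult mult.assoc)
    then have "of_real (\<Sum>k\<in>UNIV. (gns_norm (w k * y))\<^sup>2) = complex_of_real ((gns_norm y)\<^sup>2)"
      by (simp only: square of_real_sum)
    then have *: "(\<Sum>k\<in>UNIV. (gns_norm (w k * y))\<^sup>2) = (gns_norm y)\<^sup>2"
      by (simp only: of_real_eq_iff)
    have "(gns_norm (w k * y))\<^sup>2 \<le> (\<Sum>k\<in>UNIV. (gns_norm (w k * y))\<^sup>2)"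
      by (rule member_le_sum) simp_all
    then show ?thesis
      unfolding * by (rule power2_le_imp_le) (rule gns_norm_nonneg)
  qed
  have letter: "bdd (letter_pow (gen (i, j)) x)" for i j :: 'n and x
  proof -
    have "(\<Sum>k\<in>UNIV. star (gen (k, j)) * gen (k, j)) - 1 \<in> biunitary_relators (\<lambda>i j. gen (i, j))"
      using biunitary_relators_col[of "\<lambda>i j. gen (i, j)" j] by simp
    from contraction[OF this] have 1: "gns_norm (gen (i, j) * y) \<le> gns_norm y" for y by blast
    \<comment> \<open>For an adjoint the other unitarity relation serves, with \<open>w k\<close>
      the adjoint of the entry at \<open>(i, k)\<close>.\<close>
    have "(\<Sum>k\<in>UNIV. gen (i, k) * star (gen (i, k))) - 1 \<in> biunitary_relators (\<lambda>i j. gen (i, j))"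
      using biunitary_relators_row[of "\<lambda>i j. gen (i, j)" i] by simp
    then have "(\<Sum>k\<in>UNIV. star (star (gen (i, k))) * star (gen (i, k))) - 1 \<in> biunitary_relators (\<lambda>i j. gen (i, j))"
      by (simp only: star_star)
    from contraction[OF this] have 2: "gns_norm (star (gen (i, j)) * y) \<le> gns_norm y" for y by blast
    show ?thesis unfolding bdd_def by (rule exI[of _ 1], cases x) (simp_all add: 1 2)
  qed
  have mult: "bdd (x * y)" if x: "bdd x" and y: "bdd y" for x y
  proof -
    obtain C where C: "C \<ge> 0" "\<And>z. gns_norm (x * z) \<le> C * gns_norm z" using x by (auto simp: bdd_def)
    obtain D where D: "D \<ge> 0" "\<And>z. gns_norm (y * z) \<le> D * gns_norm z" using y by (auto simp: bdd_def)
    have "gns_norm (x * y * z) \<le> C * D * gns_norm z" for z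
      using C(2)[of "y * z"] mult_left_mono[OF D(2)[of z] C(1)] by (simp add: mult.assoc)
    then show ?thesis unfolding bdd_def using C(1) D(1) by (intro exI[of _ "C * D"]) simp
  qed
  have add: "bdd (x + y)" if x: "bdd x" and y: "bdd y" for x y
  proof -
    obtain C where C: "C \<ge> 0" "\<And>z. gns_norm (x * z) \<le> C * gns_norm z" using x by (auto simp: bdd_def)
    obtain D where D: "D \<ge> 0" "\<And>z. gns_norm (y * z) \<le> D * gns_norm z" using y by (auto simp: bdd_def)
    have "gns_norm ((x + y) * z) \<le> (C + D) * gns_norm z" for z
      using gns_norm_triangle[of "x * z" "y * z"] C(2)[of z] D(2)[of z] by (simp add: distrib_right)
    then show ?thesis unfolding bdd_def using C(1) D(1) by (intro exI[of _ "C + D"]) simp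
  qed
  have scale: "bdd (c *\<^sub>C x)" if x: "bdd x" for c x
  proof -
    obtain C where C: "C \<ge> 0" "\<And>z. gns_norm (x * z) \<le> C * gns_norm z" using x by (auto simp: bdd_def)
    have "gns_norm (c *\<^sub>C x * z) \<le> cmod c * C * gns_norm z" for z
      unfolding mult_scaleC_left gns_norm_scale
      using mult_left_mono[OF C(2)[of z], of "cmod c"] by (simp add: mult.assoc)
    then show ?thesis unfolding bdd_def using C(1) by (intro exI[of _ "cmod c * C"]) simp
  qed
  have one: "bdd 1" unfolding bdd_def by (intro exI[of _ 1]) simp
  have "bdd (free_monomial (Monomial l))" for l
  proof (induction l)
    case Nil
    then show ?case using one by (simp add: free_monomial_zero[unfolded zero_monomial_def])
  next
    case (Cons p l)
    obtain i j x where p: "p = ((i, j), x)" by (metis surj_pair)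
    have "Monomial (p # l) = Monomial [p] + Monomial l" by (simp add: plus_monomial_def)
    then show ?case using Cons.IH letter by (simp add: free_monomial_plus p free_monomial_letter mult)
  qed
  then have mono: "bdd (free_monomial w)" for w by (cases w) simp
  have zero: "bdd 0" using scale[OF one, of 0] by simp
  have sum: "bdd (\<Sum>w\<in>K. f w)" if "\<And>w. bdd (f w)" for f :: "_ \<Rightarrow> ('n \<times> 'n) free_algebra" and K :: "('n \<times> 'n) monomial set"
    by (induction K rule: infinite_finite_induct) (simp_all add: zero add that)
  have "bdd x" for x
    using sum[of "\<lambda>w. Poly_Mapping.lookup (coeffs x) w *\<^sub>C free_monomial w" "Poly_Mapping.keys (coeffs x)"]
      scale[OF mono] by (simp only: free_algebra_expansion)
  then show ?thesis by unfold_locales (auto simp: bdd_def)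
qed

lemma free_haar_eq_0:
  assumes "is_Au v" "free_eval (\<lambda>(i, j). v i j) x = 0"
  shows "free_haar x = 0"
  using bounded_positive_functional_eq_0[OF assms(1)[unfolded is_Au_def] bounded_positive_functional_free_haar
      free_haar_ideal assms(2)] .

section \<open>Identification of the Haar functional\<close>


definition entry :: "('n \<Rightarrow> 'n \<Rightarrow> 'a::complex_star_algebra) \<Rightarrow> ('n \<times> letter) list \<Rightarrow> ('n \<times> letter) list \<Rightarrow> 'a" where
  "entry v I J = monomial_eval (\<lambda>(i, j). v i j) (entry_monomial I J)"

lemma entry_Nil [simp]: "entry v [] [] = 1"
  by (simp add: entry_def monomial_eval_zero)

lemma entry_append:
  "length I = length J \<Longrightarrow> entry v (I @ I') (J @ J') = entry v I J * entry v I' J'"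
  by (simp add: entry_def entry_monomial_append monomial_eval_plus)

lemma entry_single: "entry v [(i, x)] [(j, y)] = letter_pow (v i j) x"
  by (simp add: entry_def entry_monomial_def monomial_eval_def)

lemma entry_Cons: "entry v ((i, x) # I) ((j, y) # J) = letter_pow (v i j) x * entry v I J"
  using entry_append[of "[(i, x)]" "[(j, y)]" v I J] by (simp add: entry_single)

lemma biunitary_row_sum:
  assumes "biunitary_relators v \<subseteq> {0}"
  shows "(\<Sum>k\<in>UNIV. letter_pow (v k s) x * letter_pow (v k t) (flip x)) = (if s = t then 1 else 0)"
proof -
  have "(\<Sum>k\<in>UNIV. v k s * star (v k t)) - (if s = t then 1 else 0) \<in> biunitary_relators v"
    unfolding biunitary_relators_def unitary_matrix_relators_def by blast
  moreover have "(\<Sum>k\<in>UNIV. star (v k s) * v k t) - (if s = t then 1 else 0) \<in> biunitary_relators v"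
    unfolding biunitary_relators_def unitary_matrix_relators_def by blast
  ultimately have "(\<Sum>k\<in>UNIV. v k s * star (v k t)) - (if s = t then 1 else 0) = 0"
    "(\<Sum>k\<in>UNIV. star (v k s) * v k t) - (if s = t then 1 else 0) = 0"
    using assms by blast+
  then show ?thesis by (cases x) simp_all
qed

text \<open>Invariance under the tensor corepresentation, in the form f* v = f*. In the induction a
  cup is absorbed by one column orthogonality relation between neighbouring letters.\<close>

lemma entry_fixed_vector:
  fixes v :: "'n::finite \<Rightarrow> 'n \<Rightarrow> 'a::complex_star_algebra"
  assumes v: "biunitary_relators v \<subseteq> {0}" and f: "fixed_vector a f" and J: "J \<in> colored a"
  shows "(\<Sum>K\<in>colored a. cnj (f K) *\<^sub>C entry v K J) = cnj (f J) *\<^sub>C 1"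
  using f J
proof (induction arbitrary: J)
  case unit
  then show ?case by (simp add: scaleC_one)
next
  case (cup a b f x)
  obtain X' Y' s t where J: "J = X' @ (s, x) # (t, flip x) # Y'" "X' \<in> colored a" "Y' \<in> colored b"
    using cup.prems by (auto simp: colored_append colored_Cons)
  then have XY': "X' @ Y' \<in> colored (a @ b)" by (auto simp: colored_append)
  have mid: "(\<Sum>k\<in>UNIV. entry v (X @ (k, x) # (k, flip x) # Y) J) = (if s = t then entry v (X @ Y) (X' @ Y') else 0)"
    if "X \<in> colored a" "Y \<in> colored b" for X Y
  proof -
    have "(\<Sum>k\<in>UNIV. entry v (X @ (k, x) # (k, flip x) # Y) J)
        = entry v X X' * (\<Sum>k\<in>UNIV. letter_pow (v k s) x * letter_pow (v k t) (flip x)) * entry v Y Y'"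
      using that J by (simp add: entry_append entry_Cons length_colored sum_distrib_left sum_distrib_right mult.assoc)
    then show ?thesis using that J by (simp add: biunitary_row_sum[OF v] entry_append length_colored)
  qed
  have "(\<Sum>K\<in>colored (a @ x # flip x # b). cnj (cup (length a) x f K) *\<^sub>C entry v K J)
      = (\<Sum>X\<in>colored a. \<Sum>k\<in>UNIV. \<Sum>l\<in>UNIV. \<Sum>Y\<in>colored b.
          if k = l then cnj (f (X @ Y)) *\<^sub>C entry v (X @ (k, x) # (k, flip x) # Y) J else 0)"
    by (simp only: sum_colored_append sum_colored_Cons)
       (intro sum.cong refl, auto simp: cup_append length_colored)
  also have "\<dots> = (\<Sum>X\<in>colored a. \<Sum>k\<in>UNIV. \<Sum>Y\<in>colored b. \<Sum>l\<in>UNIV.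
          if k = l then cnj (f (X @ Y)) *\<^sub>C entry v (X @ (k, x) # (k, flip x) # Y) J else 0)"
    by (intro sum.cong refl sum.swap)
  also have "\<dots> = (\<Sum>X\<in>colored a. \<Sum>Y\<in>colored b. \<Sum>k\<in>UNIV.
          cnj (f (X @ Y)) *\<^sub>C entry v (X @ (k, x) # (k, flip x) # Y) J)"
    by (simp, intro sum.cong refl sum.swap)
  also have "\<dots> = (\<Sum>X\<in>colored a. \<Sum>Y\<in>colored b.
          if s = t then cnj (f (X @ Y)) *\<^sub>C entry v (X @ Y) (X' @ Y') else 0)"
    by (intro sum.cong refl) (simp add: mid flip: scaleC_sum_right)
  also have "\<dots> = (if s = t then \<Sum>K\<in>colored (a @ b). cnj (f K) *\<^sub>C entry v K (X' @ Y') else 0)"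
    by (simp add: sum_colored_append)
  also have "\<dots> = cnj (cup (length a) x f J) *\<^sub>C 1"
    using cup.IH[OF XY'] J by (simp add: cup_append length_colored)
  finally show ?case .
next
  case (add a f g)
  then show ?case by (simp add: scaleC_add_left sum.distrib)
next
  case (scale a f c)
  have "(\<Sum>K\<in>colored a. cnj (c * f K) *\<^sub>C entry v K J) = cnj c *\<^sub>C (\<Sum>K\<in>colored a. cnj (f K) *\<^sub>C entry v K J)"
    by (simp add: scaleC_sum_right scaleC_scaleC)
  then show ?case using scale.IH[OF scale.prems] by (simp add: scaleC_scaleC)
qed simp

lemma comultiplication_entry:
  fixes v :: "'n::finite \<Rightarrow> 'n \<Rightarrow> 'a::cstar_algebra"
  assumes tensor: "cstar_tensor \<iota>\<^sub>1 \<iota>\<^sub>2" and \<Delta>: "comultiplication v \<iota>\<^sub>1 \<iota>\<^sub>2 \<Delta>"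
  shows "map snd I = map snd J \<Longrightarrow>
    \<Delta> (entry v I J) = (\<Sum>K\<in>colored (map snd I). \<iota>\<^sub>1 (entry v I K) * \<iota>\<^sub>2 (entry v K J))"
proof (induction I arbitrary: J)
  case Nil
  then show ?case using tensor \<Delta> by (simp add: cstar_tensor_def comultiplication_def star_hom_def)
next
  case (Cons p I)
  have hom: "star_hom \<Delta>" "star_hom \<iota>\<^sub>1" "star_hom \<iota>\<^sub>2" and comm: "\<And>x y. \<iota>\<^sub>1 x * \<iota>\<^sub>2 y = \<iota>\<^sub>2 y * \<iota>\<^sub>1 x"
    and \<Delta>v: "\<And>i j. \<Delta> (v i j) = (\<Sum>k\<in>UNIV. \<iota>\<^sub>1 (v i k) * \<iota>\<^sub>2 (v k j))"
    using tensor \<Delta> by (auto simp: cstar_tensor_def comultiplication_def)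
  have hm: "\<Delta> (x * y) = \<Delta> x * \<Delta> y" "\<iota>\<^sub>1 (x * y) = \<iota>\<^sub>1 x * \<iota>\<^sub>1 y" "\<iota>\<^sub>2 (x * y) = \<iota>\<^sub>2 x * \<iota>\<^sub>2 y"
    "\<Delta> (star x) = star (\<Delta> x)" "\<iota>\<^sub>1 (star x) = star (\<iota>\<^sub>1 x)" "\<iota>\<^sub>2 (star x) = star (\<iota>\<^sub>2 x)" for x y
    using hom by (simp_all add: star_hom_def)
  obtain i x where p: "p = (i, x)" by (cases p)
  obtain j J' where J: "J = (j, x) # J'" "map snd I = map snd J'"
    using Cons.prems p by (cases J) auto
  have letter: "\<Delta> (letter_pow (v i j) x) = (\<Sum>k\<in>UNIV. \<iota>\<^sub>1 (letter_pow (v i k) x) * \<iota>\<^sub>2 (letter_pow (v k j) x))"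
  proof (cases x)
    \<comment> \<open>The adjoint reverses each product of legs, and commutation of the two legs
      restores the order.\<close>
    case Beta
    have "\<Delta> (star (v i j)) = (\<Sum>k\<in>UNIV. star (\<iota>\<^sub>2 (v k j)) * star (\<iota>\<^sub>1 (v i k)))"
      by (simp add: hm(4) \<Delta>v star_sum star_mult)
    also have "\<dots> = (\<Sum>k\<in>UNIV. \<iota>\<^sub>1 (star (v i k)) * \<iota>\<^sub>2 (star (v k j)))"
      by (simp only: hm(5,6)[symmetric] comm)
    finally show ?thesis by (simp add: Beta)
  qed (simp add: \<Delta>v)
  have "\<Delta> (entry v (p # I) J) = \<Delta> (letter_pow (v i j) x) * \<Delta> (entry v I J')"
    by (simp add: p J entry_Cons hm)
  also have "\<dots> = (\<Sum>k\<in>UNIV. \<Sum>K\<in>colored (map snd I).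
      \<iota>\<^sub>1 (letter_pow (v i k) x) * \<iota>\<^sub>2 (letter_pow (v k j) x) * (\<iota>\<^sub>1 (entry v I K) * \<iota>\<^sub>2 (entry v K J')))"
    by (simp only: letter Cons.IH[OF J(2)] sum_product)
  also have "\<dots> = (\<Sum>k\<in>UNIV. \<Sum>K\<in>colored (map snd I).
      \<iota>\<^sub>1 (letter_pow (v i k) x) * \<iota>\<^sub>1 (entry v I K) * (\<iota>\<^sub>2 (letter_pow (v k j) x) * \<iota>\<^sub>2 (entry v K J')))"
    by (intro sum.cong refl) (metis comm mult.assoc)
  also have "\<dots> = (\<Sum>K\<in>colored (map snd (p # I)). \<iota>\<^sub>1 (entry v (p # I) K) * \<iota>\<^sub>2 (entry v K J))"
    by (simp add: p J sum_colored_Cons entry_Cons hm)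
  finally show ?case .
qed

lemma haar_entry:
  fixes v :: "'n::finite \<Rightarrow> 'n \<Rightarrow> 'a::cstar_algebra"
  assumes v: "is_Au v" and tensor: "cstar_tensor \<iota>\<^sub>1 \<iota>\<^sub>2" and \<Delta>: "comultiplication v \<iota>\<^sub>1 \<iota>\<^sub>2 \<Delta>"
    and h: "haar_functional \<iota>\<^sub>1 \<iota>\<^sub>2 \<Delta> h"
    and I: "I \<in> colored a" and J: "J \<in> colored a"
  shows "h (entry v I J) = fixed_projection I J"
proof -
  have h_add: "h (x + y) = h x + h y" and h_scale: "h (c *\<^sub>C x) = c * h x" and h_one: "h 1 = 1" for x y c
    using h by (auto simp: haar_functional_def)
  have h_sum: "h (\<Sum>K\<in>A. f K) = (\<Sum>K\<in>A. h (f K))" for f :: "('n \<times> letter) list \<Rightarrow> 'a" and A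
    using h_scale[of 0 0] by (induction A rule: infinite_finite_induct) (simp_all add: h_add)
  \<comment> \<open>\<open>S\<close> is id \<otimes> h; applied to the comultiplication formula it
    yields a linear relation among the entries of the row \<open>I\<close>.\<close>
  obtain S where S: "bounded_linear S" "\<And>x y. S (\<iota>\<^sub>1 x * \<iota>\<^sub>2 y) = h y *\<^sub>C x" "\<And>x. S (\<Delta> x) = h x *\<^sub>C 1"
    using h by (auto simp: haar_functional_def right_slice_def)
  have words: "map snd I = a" "map snd J = a" using I J by (simp_all add: colored_def)
  have "h (entry v I J) *\<^sub>C 1 = S (\<Sum>K\<in>colored a. \<iota>\<^sub>1 (entry v I K) * \<iota>\<^sub>2 (entry v K J))"
    using comultiplication_entry[OF tensor \<Delta>, of I J] S(3)[of "entry v I J"] by (simp add: words)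
  also have "\<dots> = (\<Sum>K\<in>colored a. h (entry v K J) *\<^sub>C entry v I K)"
    using bounded_linear.linear[OF S(1)] by (simp add: linear_sum S(2))
  finally have inv: "h (entry v I J) *\<^sub>C 1 = (\<Sum>K\<in>colored a. h (entry v K J) *\<^sub>C entry v I K)" .
  \<comment> \<open>A lift of this relation to the free *-algebra, where the constructed form can be
    evaluated on it.\<close>
  define x :: "('n \<times> 'n) free_algebra" where
    "x = (\<Sum>K\<in>colored a. h (entry v K J) *\<^sub>C free_monomial (entry_monomial I K)) - h (entry v I J) *\<^sub>C 1"
  have hom: "star_hom (free_eval (\<lambda>(i, j). v i j))" by (rule star_hom_free_eval)
  have "free_eval (\<lambda>(i, j). v i j) (x + h (entry v I J) *\<^sub>C 1)
      = (\<Sum>K\<in>colored a. h (entry v K J) *\<^sub>C entry v I K)"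
    using hom by (simp add: x_def star_hom_sum[OF hom])
      (simp add: star_hom_def free_eval_free_monomial entry_def)
  moreover have "free_eval (\<lambda>(i, j). v i j) (x + h (entry v I J) *\<^sub>C 1)
      = free_eval (\<lambda>(i, j). v i j) x + h (entry v I J) *\<^sub>C 1"
    using hom by (simp add: star_hom_def)
  ultimately have "free_eval (\<lambda>(i, j). v i j) x = 0" using inv by simp
  then have "free_haar x = 0" by (rule free_haar_eq_0[OF v])
  moreover have "monomial_row (entry_monomial I K) = I" "monomial_col (entry_monomial I K) = K"
    if "K \<in> colored a" for K
    using that words length_colored[OF that] length_colored[OF I]
    by (auto simp: colored_def intro!: monomial_row_entry monomial_col_entry)
  ultimately have 1: "h (entry v I J) = (\<Sum>K\<in>colored a. h (entry v K J) * fixed_projection I K)"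
    by (simp add: x_def free_haar_diff free_haar_sum free_haar_scale free_haar_one free_haar_monomial)
  \<comment> \<open>The columns of the projection are fixed vectors, so invariance applies to them;
    taking \<open>h\<close> gives the second equation, P H = P.\<close>
  have "(\<Sum>K\<in>colored a. fixed_projection I K *\<^sub>C entry v K J) = fixed_projection I J *\<^sub>C 1"
    using entry_fixed_vector[OF is_Au_biunitary[OF v] fixed_vector_fixed_projection[OF I] J]
    by (simp only: fixed_projection_commute[symmetric])
  from arg_cong[OF this, of h] have "(\<Sum>K\<in>colored a. fixed_projection I K * h (entry v K J)) = fixed_projection I J"
    by (simp add: h_sum h_scale h_one)
  with 1 show ?thesis by (simp add: mult.commute)
qed

section \<open>Non-crossing pairings\<close>


text \<open>Where an old position moves when a pair is inserted at \<open>k\<close>: the order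
  isomorphism onto the complement of \<open>{k, Suc k}\<close>.\<close>

definition skip :: "nat \<Rightarrow> nat \<Rightarrow> nat" where
  "skip k t = (if t < k then t else t + 2)"

definition insert_pair :: "nat \<Rightarrow> nat set set \<Rightarrow> nat set set" where
  "insert_pair k p = insert {k, Suc k} ((`) (skip k) ` p)"

definition pairing_vector :: "letter list \<Rightarrow> nat set set \<Rightarrow> ('n \<times> letter) list \<Rightarrow> complex" where
  "pairing_vector a p L = (if L \<in> colored a then pairing_delta p (\<lambda>r. fst (L ! r)) else 0)"

lemma skip_less_iff [simp]: "skip k r < skip k t \<longleftrightarrow> r < t"
  by (auto simp: skip_def)

lemma skip_eq_iff [simp]: "skip k r = skip k t \<longleftrightarrow> r = t"
  by (auto simp: skip_def)

lemma skip_neq [simp]: "skip k r \<noteq> k" "skip k r \<noteq> Suc k" "k \<noteq> skip k r" "Suc k \<noteq> skip k r"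
  by (auto simp: skip_def)

lemma inj_skip: "inj (skip k)"
  by (rule injI) simp

lemma range_skip: "range (skip k) = UNIV - {k, Suc k}"
proof -
  have "t \<in> range (skip k)" if "t \<noteq> k" "t \<noteq> Suc k" for t
    using that by (intro image_eqI[of _ _ "if t < k then t else t - 2"]) (auto simp: skip_def)
  then show ?thesis by auto
qed

lemma vimage_skip_lessThan: "k \<le> n \<Longrightarrow> skip k -` {..<n + 2} = {..<n}"
  by (auto simp: skip_def split: if_splits)

lemma image_skip_lessThan: "k \<le> n \<Longrightarrow> skip k ` {..<n} = {..<n + 2} - {k, Suc k}"
proof -
  assume k: "k \<le> n"
  have "skip k ` {..<n} = skip k ` (skip k -` {..<n + 2})" using vimage_skip_lessThan[OF k] by simp
  also have "\<dots> = {..<n + 2} - {k, Suc k}" by (auto simp: image_vimage_eq range_skip)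
  finally show ?thesis .
qed

lemma nth_skip: "length X = k \<Longrightarrow> (X @ p # q # Y) ! skip k r = (X @ Y) ! r"
  by (auto simp: skip_def nth_append Suc_diff_le)

section \<open>Removing and inserting adjacent pairs\<close>

lemma nc_pairings_iff: "p \<in> nc_pairings a \<longleftrightarrow> partition_on {..<length a} p \<and> (\<forall>b\<in>p. card b = 2) \<and>
    noncrossing p \<and> (\<forall>r t. r \<noteq> t \<and> {r, t} \<in> p \<longrightarrow> a ! r \<noteq> a ! t)"
  by (simp add: nc_pairings_def)

lemma nc_pairings_pairD:
  assumes "p \<in> nc_pairings a" "{r, t} \<in> p"
  shows "r \<noteq> t" "r < length a" "t < length a"
proof -
  have "card {r, t} = 2" using assms by (auto simp: nc_pairings_iff)
  then show "r \<noteq> t" by auto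
  have "{r, t} \<subseteq> {..<length a}" using assms by (auto simp: nc_pairings_iff partition_on_def)
  then show "r < length a" "t < length a" by auto
qed

lemma nc_pairings_blockE:
  assumes "p \<in> nc_pairings a" "b \<in> p"
  obtains r t where "b = {r, t}" "r < t"
proof -
  have "card b = 2" using assms by (auto simp: nc_pairings_iff)
  then obtain r t where rt: "b = {r, t}" "r \<noteq> t" by (auto simp: card_2_iff)
  show ?thesis
  proof (cases "r < t")
    case True
    with rt(1) show ?thesis by (rule that)
  next
    case False
    with rt have "b = {t, r}" "t < r" by auto
    then show ?thesis by (rule that)
  qed
qed

lemma nc_pairings_partner:
  assumes "p \<in> nc_pairings a" "r < length a"
  obtains t where "{r, t} \<in> p" "t \<noteq> r" "t < length a"
proof -
  have "r \<in> \<Union>p" using assms by (auto simp: nc_pairings_iff partition_on_def)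
  then obtain b where b: "b \<in> p" "r \<in> b" by blast
  with nc_pairings_blockE[OF assms(1) b(1)] obtain t where "b = {r, t}" by (metis insertE insert_commute singletonD)
  then show ?thesis using that b(1) nc_pairings_pairD[OF assms(1), of r t] by metis
qed

lemma nc_pairings_eq:
  assumes "p \<in> nc_pairings a" "b \<in> p" "b' \<in> p" "r \<in> b" "r \<in> b'"
  shows "b = b'"
proof -
  have "disjoint p" using assms(1) by (simp add: nc_pairings_iff partition_on_def)
  then show ?thesis using assms(2-5) by (metis disjointD disjoint_iff)
qed

lemma nc_pairings_unique:
  assumes "p \<in> nc_pairings a" "{r, t} \<in> p" "{r, u} \<in> p"
  shows "t = u"
  using nc_pairings_eq[OF assms, of r] nc_pairings_pairD(1)[OF assms(1,2)] by (auto simp: doubleton_eq_iff)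

lemma noncrossingD:
  "\<lbrakk>noncrossing p; b \<in> p; b' \<in> p; r < s; s < t; t < u; r \<in> b; t \<in> b; s \<in> b'; u \<in> b'\<rbrakk> \<Longrightarrow> b = b'"
  unfolding noncrossing_def by blast

lemma finite_nc_pairings: "finite (nc_pairings a)"
  by (rule finite_subset[OF _ finitely_many_partition_on[of "{..<length a}"]]) (auto simp: nc_pairings_iff)

lemma nc_pairings_Nil [simp]: "nc_pairings [] = {{}}"
  by (auto simp: nc_pairings_iff partition_on_empty noncrossing_def)

text \<open>A pair of minimal width works. If it were wider than 1, the neighbour of its left end
  would have a partner that either lies outside, giving a crossing, or inside, giving a narrower
  pair.\<close>

lemma nc_pairings_adjacent:
  assumes p: "p \<in> nc_pairings a" and "a \<noteq> []"
  shows "\<exists>k. {k, Suc k} \<in> p"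
proof -
  define P where "P d \<longleftrightarrow> d > 0 \<and> (\<exists>r. {r, r + d} \<in> p)" for d
  have nc: "noncrossing p" using p by (simp add: nc_pairings_iff)
  obtain t where t: "{0, t} \<in> p" "t \<noteq> 0" using nc_pairings_partner[OF p, of 0] assms(2) by auto
  then have "P t" unfolding P_def by (intro conjI exI[of _ 0]) simp_all
  then have Pd: "P (LEAST d. P d)" by (rule LeastI)
  define d where "d = (LEAST d. P d)"
  have min: "d \<le> d'" if "P d'" for d' unfolding d_def by (rule Least_le[of P, OF that])
  obtain r where r: "d > 0" "{r, r + d} \<in> p" using Pd by (auto simp: d_def P_def)
  have "d = 1"
  proof (rule ccontr)
    assume "d \<noteq> 1"
    then have d: "d \<ge> 2" using r(1) by simp
    have "Suc r < length a" using nc_pairings_pairD(3)[OF p r(2)] d by simp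
    then obtain u where u: "{Suc r, u} \<in> p" "u \<noteq> Suc r" using nc_pairings_partner[OF p] by metis
    have "u \<noteq> r"
    proof
      assume "u = r"
      then have "{r, Suc r} \<in> p" using u(1) by (simp add: insert_commute)
      then show False using nc_pairings_unique[OF p _ r(2)] d by fastforce
    qed
    moreover have "u \<noteq> r + d"
    proof
      assume "u = r + d"
      then have "{r + d, Suc r} \<in> p" "{r + d, r} \<in> p" using u(1) r(2) by (simp_all add: insert_commute)
      then show False using nc_pairings_unique[OF p] by fastforce
    qed
    ultimately have neq: "{Suc r, u} \<noteq> {r, r + d}" by (auto simp: doubleton_eq_iff)
    consider "u < r" | "r + d < u" | "Suc r < u" "u < r + d"
      using u(2) \<open>u \<noteq> r\<close> \<open>u \<noteq> r + d\<close> by linarith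
    then show False
    proof cases
      case 1
      then show ?thesis using noncrossingD[OF nc u(1) r(2), of u r "Suc r" "r + d"] d neq by simp
    next
      case 2
      then show ?thesis using noncrossingD[OF nc r(2) u(1), of r "Suc r" "r + d" u] d neq by simp
    next
      case 3
      then have "P (u - Suc r)" unfolding P_def using u(1) by (intro conjI exI[of _ "Suc r"]) simp_all
      then show ?thesis using min 3 by fastforce
    qed
  qed
  then show ?thesis using r(2) by (intro exI[of _ r]) simp
qed

lemma pair_in_insert_pair:
  "{skip k r, skip k t} \<in> insert_pair k p \<longleftrightarrow> {r, t} \<in> p"
proof -
  have eq: "{skip k r, skip k t} = skip k ` {r, t}" by simp
  have neq: "skip k ` {r, t} \<noteq> {k, Suc k}" by (auto simp: doubleton_eq_iff)
  have "inj ((`) (skip k))" by (rule injI) (simp add: inj_image_eq_iff[OF inj_skip])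
  then have "skip k ` {r, t} \<in> (`) (skip k) ` p \<longleftrightarrow> {r, t} \<in> p" by (rule inj_image_mem_iff)
  with neq show ?thesis unfolding eq insert_pair_def insert_iff by blast
qed

lemma pair_in_insert_pairE:
  assumes "{r, t} \<in> insert_pair k p"
  obtains "{r, t} = {k, Suc k}" | r' t' where "r = skip k r'" "t = skip k t'" "{r', t'} \<in> p"
proof (cases "{r, t} = {k, Suc k}")
  case False
  then obtain b where "{r, t} = skip k ` b" using assms by (auto simp: insert_pair_def)
  then obtain r' t' where "r = skip k r'" "t = skip k t'" by blast
  then show ?thesis using that(2) assms by (simp add: pair_in_insert_pair)
qed (rule that(1))

lemma insert_pair_nc_pairings:
  assumes p: "p \<in> nc_pairings (a @ b)"
  shows "insert_pair (length a) p \<in> nc_pairings (a @ x # flip x # b)"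
proof -
  let ?k = "length a" and ?n = "length a + length b"
  have part: "partition_on {..<?n} p" using p by (simp add: nc_pairings_iff)
  have "{} \<notin> p" using part by (rule partition_onD3)
  then have ne: "(`) (skip ?k) ` p - {{}} = (`) (skip ?k) ` p" by auto
  have img: "partition_on ({..<?n + 2} - {?k, Suc ?k}) ((`) (skip ?k) ` p)"
    using partition_on_inj_image[OF part inj_on_subset[OF inj_skip subset_UNIV], of ?k]
    unfolding image_skip_lessThan[OF le_add1] ne .
  have "partition_on {..<length (a @ x # flip x # b)} (insert_pair ?k p)"
    unfolding insert_pair_def
    by (subst partition_on_insert) (use img in \<open>auto simp: disjnt_iff\<close>)
  moreover have "card c = 2" if "c \<in> insert_pair ?k p" for c
    using that p by (auto simp: insert_pair_def nc_pairings_iff card_image inj_on_subset[OF inj_skip])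
  moreover have "noncrossing (insert_pair ?k p)"
    unfolding noncrossing_def
  proof (intro ballI allI impI, elim conjE)
    fix c c' r s t u
    assume c: "c \<in> insert_pair ?k p" "c' \<in> insert_pair ?k p"
      and rstu: "r < s" "s < t" "t < u" "r \<in> c" "t \<in> c" "s \<in> c'" "u \<in> c'"
    \<comment> \<open>No position lies strictly between \<open>?k\<close> and \<open>Suc ?k\<close>,
      so the new pair takes part in no crossing.\<close>
    have "c \<noteq> {?k, Suc ?k}" "c' \<noteq> {?k, Suc ?k}" using rstu by auto
    then obtain d d' where d: "c = skip ?k ` d" "d \<in> p" "c' = skip ?k ` d'" "d' \<in> p"
      using c by (auto simp: insert_pair_def)
    then obtain r' s' t' u' where "r = skip ?k r'" "t = skip ?k t'" "r' \<in> d" "t' \<in> d"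
      "s = skip ?k s'" "u = skip ?k u'" "s' \<in> d'" "u' \<in> d'"
      using rstu by blast
    moreover have "noncrossing p" using p by (simp add: nc_pairings_iff)
    ultimately show "c = c'"
      using noncrossingD[of p d d' r' s' t' u'] d rstu by simp
  qed
  moreover have "(a @ x # flip x # b) ! r \<noteq> (a @ x # flip x # b) ! t"
    if "{r, t} \<in> insert_pair ?k p" "r \<noteq> t" for r t
    using that(1)
  proof (cases rule: pair_in_insert_pairE)
    case 1
    have "x \<noteq> flip x" by (cases x) simp_all
    with 1 that(2) show ?thesis by (auto simp: doubleton_eq_iff nth_append)
  next
    case (2 r' t')
    then have "(a @ b) ! r' \<noteq> (a @ b) ! t'" using p that(2) by (auto simp: nc_pairings_iff)
    with 2 show ?thesis by (simp add: nth_skip)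
  qed
  ultimately show ?thesis unfolding nc_pairings_iff by blast
qed

lemma nc_pairings_split_adjacent:
  assumes p: "p \<in> nc_pairings w" and k: "{k, Suc k} \<in> p"
  obtains a x b p' where "w = a @ x # flip x # b" "length a = k" "p' \<in> nc_pairings (a @ b)" "p = insert_pair k p'"
proof -
  have len: "Suc k < length w" using nc_pairings_pairD(3)[OF p k] .
  define a x b where "a = take k w" and "x = w ! k" and "b = drop (k + 2) w"
  have "w ! k \<noteq> w ! Suc k" using p k by (auto simp: nc_pairings_iff)
  then have "w ! Suc k = flip x" unfolding x_def by (cases "w ! k"; cases "w ! Suc k") auto
  moreover have "w = a @ x # w ! Suc k # b"
    using len by (simp add: a_def b_def x_def Cons_nth_drop_Suc)
  ultimately have w: "w = a @ x # flip x # b" by simp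
  have la: "length a = k" using len by (simp add: a_def)
  let ?n = "length a + length b"
  \<comment> \<open>The removed pair has empty preimage; deleting the empty set leaves a
    partition.\<close>
  define p' where "p' = (-`) (skip k) ` p - {{}}"
  have part: "partition_on {..<?n + 2} p" using p by (simp add: nc_pairings_iff w)
  have avoid: "k \<notin> c \<and> Suc k \<notin> c" if "c \<in> p" "c \<noteq> {k, Suc k}" for c
    using nc_pairings_eq[OF p that(1) k] that(2) by blast
  have img: "skip k ` (skip k -` c) = c" if "c \<in> p" "c \<noteq> {k, Suc k}" for c
    using avoid[OF that] by (auto simp: image_vimage_eq range_skip)
  have vim: "skip k -` {k, Suc k} = {}" by auto
  have p'_img: "skip k ` d \<in> p \<and> skip k ` d \<noteq> {k, Suc k}" if "d \<in> p'" for d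
  proof -
    from that obtain c where c: "c \<in> p" "d = skip k -` c" "d \<noteq> {}" by (auto simp: p'_def)
    then have "c \<noteq> {k, Suc k}" using vim by blast
    then show ?thesis using c img by simp
  qed
  have "partition_on {..<length (a @ b)} p'"
    using partition_on_vimage[OF part, of "skip k"] vimage_skip_lessThan[of k ?n] la by (simp add: p'_def)
  moreover have "card d = 2" if "d \<in> p'" for d
  proof -
    have "card (skip k ` d) = 2" using p'_img[OF that] p by (auto simp: nc_pairings_iff)
    then show ?thesis by (simp add: card_image inj_on_subset[OF inj_skip])
  qed
  moreover have "noncrossing p'"
    unfolding noncrossing_def
  proof (intro ballI allI impI, elim conjE)
    fix d d' r s t u
    assume d: "d \<in> p'" "d' \<in> p'" and rstu: "r < s" "s < t" "t < u" "r \<in> d" "t \<in> d" "s \<in> d'" "u \<in> d'"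
    have "noncrossing p" using p by (simp add: nc_pairings_iff)
    then have "skip k ` d = skip k ` d'"
      by (rule noncrossingD[of p _ _ "skip k r" "skip k s" "skip k t" "skip k u"])
         (use p'_img d rstu in auto)
    then show "d = d'" by (simp add: inj_image_eq_iff[OF inj_skip])
  qed
  moreover have "(a @ b) ! r \<noteq> (a @ b) ! t" if "{r, t} \<in> p'" "r \<noteq> t" for r t
  proof -
    have "{skip k r, skip k t} \<in> p" using p'_img[OF that(1)] by simp
    then have "w ! skip k r \<noteq> w ! skip k t" using p that(2) by (auto simp: nc_pairings_iff)
    then show ?thesis by (simp add: w nth_skip la)
  qed
  ultimately have "p' \<in> nc_pairings (a @ b)" unfolding nc_pairings_iff by blast
  moreover have "p = insert_pair k p'"
  proof (intro equalityI subsetI)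
    fix c assume c: "c \<in> p"
    show "c \<in> insert_pair k p'"
    proof (cases "c = {k, Suc k}")
      case False
      have "c \<noteq> {}" using partition_onD3[OF part] c by blast
      then have "skip k -` c \<noteq> {}" using img[OF c False] by (metis image_empty)
      then show ?thesis using img[OF c False] c unfolding insert_pair_def p'_def by blast
    qed (simp add: insert_pair_def)
  next
    fix c assume "c \<in> insert_pair k p'"
    then show "c \<in> p" using k p'_img by (auto simp: insert_pair_def)
  qed
  ultimately show ?thesis using that w la by blast
qed

text \<open>The recursion has the same shape as the rules for fixed vectors: inserting an adjacent
  pair corresponds to applying a cup.\<close>

lemma nc_pairings_induct [consumes 1, case_names Nil insert]:
  assumes "p \<in> nc_pairings w"
    and "P [] {}"
    and "\<And>a x b p. p \<in> nc_pairings (a @ b) \<Longrightarrow> P (a @ b) p \<Longrightarrow> P (a @ x # flip x # b) (insert_pair (length a) p)"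
  shows "P w p"
  using assms(1)
proof (induction "length w" arbitrary: w p rule: less_induct)
  case less
  show ?case
  proof (cases "w = []")
    case True
    then show ?thesis using less.prems assms(2) by simp
  next
    case False
    obtain k where "{k, Suc k} \<in> p" using nc_pairings_adjacent[OF less.prems False] by blast
    from nc_pairings_split_adjacent[OF less.prems this] obtain a x b p' where
      w: "w = a @ x # flip x # b" "length a = k" "p' \<in> nc_pairings (a @ b)" "p = insert_pair k p'" .
    have "P (a @ b) p'" using less.hyps[of "a @ b" p'] w by simp
    from assms(3)[OF w(3) this, of x] show ?thesis using w by simp
  qed
qed

lemma nc_pairings_balanced:
  assumes "p \<in> nc_pairings a"
  shows "count_list a Alpha = count_list a Beta"
  using assms
proof (induction rule: nc_pairings_induct)
  case (insert a x b p)
  then show ?case by (cases x) simp_all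
qed simp

section \<open>The vectors of pairings span the fixed vectors\<close>

lemma pairing_delta_insert_pair:
  "pairing_delta (insert_pair k p) i =
     (if i k = i (Suc k) then pairing_delta p (\<lambda>r. i (skip k r)) else 0)"
proof -
  have "(\<forall>r t. {r, t} \<in> insert_pair k p \<longrightarrow> i r = i t) \<longleftrightarrow>
      i k = i (Suc k) \<and> (\<forall>r t. {r, t} \<in> p \<longrightarrow> i (skip k r) = i (skip k t))" (is "?L \<longleftrightarrow> ?R")
  proof
    assume L: ?L
    then have "i k = i (Suc k)" by (auto simp: insert_pair_def)
    then show ?R using L pair_in_insert_pair by blast
  next
    assume R: ?R
    show ?L
    proof (intro allI impI)
      fix r t assume "{r, t} \<in> insert_pair k p"
      then show "i r = i t"
        by (cases rule: pair_in_insert_pairE) (use R in \<open>auto simp: doubleton_eq_iff\<close>)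
    qed
  qed
  then show ?thesis by (simp add: pairing_delta_def)
qed

lemma pairing_vector_insert_pair:
  "pairing_vector (a @ x # flip x # b) (insert_pair (length a) p) = cup (length a) x (pairing_vector (a @ b) p)"
proof
  fix L :: "('a \<times> letter) list"
  show "pairing_vector (a @ x # flip x # b) (insert_pair (length a) p) L = cup (length a) x (pairing_vector (a @ b) p) L"
  proof (cases "L \<in> colored (a @ x # flip x # b)")
    case True
    then obtain X s t Y where L: "L = X @ (s, x) # (t, flip x) # Y" "X \<in> colored a" "Y \<in> colored b"
      by (auto simp: colored_append colored_Cons)
    then have "X @ Y \<in> colored (a @ b)" by (auto simp: colored_append)
    moreover have "L ! length a = (s, x)" "L ! Suc (length a) = (t, flip x)"
      using L by (simp_all add: nth_append length_colored)
    moreover have "L ! skip (length a) r = (X @ Y) ! r" for r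
      using L nth_skip[of X "length a"] by (simp add: length_colored)
    ultimately show ?thesis using True L
      by (cases "s = t") (simp_all add: pairing_vector_def pairing_delta_insert_pair cup_append length_colored)
  next
    case False
    have "cup (length a) x (pairing_vector (a @ b) p) L = 0"
    proof (cases rule: cup_splitE[of L "length a"])
      case (2 X p' q' Y)
      then show ?thesis using False by (auto simp: cup_append pairing_vector_def colored_def)
    qed (simp add: cup_short)
    then show ?thesis using False by (simp add: pairing_vector_def)
  qed
qed

lemma cup_sum: "cup k x (\<lambda>L. \<Sum>p\<in>A. f p L) = (\<lambda>L. \<Sum>p\<in>A. cup k x (f p) L)"
proof -
  have zero: "cup k x (\<lambda>_. 0) = (\<lambda>_. 0)" by (simp add: cup_def fun_eq_iff)
  show ?thesis by (induction A rule: infinite_finite_induct) (simp_all add: zero cup_add)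
qed

lemma pairing_vector_Nil: "pairing_vector [] {} = (\<lambda>L. if L = [] then 1 else 0)"
  by (simp add: pairing_vector_def pairing_delta_def fun_eq_iff)

lemma fixed_vector_pairing_vector:
  assumes "p \<in> nc_pairings a"
  shows "fixed_vector a (pairing_vector a p)"
  using assms
proof (induction rule: nc_pairings_induct)
  case Nil
  then show ?case unfolding pairing_vector_Nil by (rule fixed_vector.unit)
next
  case (insert a x b p)
  then show ?case unfolding pairing_vector_insert_pair by (intro fixed_vector.cup)
qed

lemma fixed_vector_pairing_span:
  assumes "fixed_vector a f"
  shows "\<exists>c. f = (\<lambda>L. \<Sum>p\<in>nc_pairings a. c p * pairing_vector a p L)"
  using assms
proof induction
  case unit
  show ?case by (rule exI[of _ "\<lambda>_. 1"]) (simp add: pairing_vector_Nil)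
next
  case (cup a b f x)
  then obtain c where c: "f = (\<lambda>L. \<Sum>p\<in>nc_pairings (a @ b). c p * pairing_vector (a @ b) p L)" by blast
  let ?D = "nc_pairings (a @ x # flip x # b)" and ?i = "insert_pair (length a)"
  \<comment> \<open>The coefficients are pushed forward along the insertion, summed over each
    fibre.\<close>
  define d where "d q = (\<Sum>p\<in>{p \<in> nc_pairings (a @ b). ?i p = q}. c p)" for q
  have "cup (length a) x f L = (\<Sum>q\<in>?D. d q * pairing_vector (a @ x # flip x # b) q L)" for L
  proof -
    have "cup (length a) x f L = (\<Sum>p\<in>nc_pairings (a @ b). c p * cup (length a) x (pairing_vector (a @ b) p) L)"
      unfolding c by (simp add: cup_sum cup_scale)
    also have "\<dots> = (\<Sum>p\<in>nc_pairings (a @ b). c p * pairing_vector (a @ x # flip x # b) (?i p) L)"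
      by (simp only: pairing_vector_insert_pair)
    also have "\<dots> = (\<Sum>q\<in>?D. \<Sum>p\<in>{p \<in> nc_pairings (a @ b). ?i p = q}. c p * pairing_vector (a @ x # flip x # b) (?i p) L)"
      by (intro sum.group[symmetric] finite_nc_pairings) (auto intro: insert_pair_nc_pairings)
    also have "\<dots> = (\<Sum>q\<in>?D. d q * pairing_vector (a @ x # flip x # b) q L)"
      unfolding d_def sum_distrib_right by (intro sum.cong refl) auto
    finally show ?thesis .
  qed
  then show ?case by blast
next
  case (zero a)
  show ?case by (rule exI[of _ "\<lambda>_. 0"]) simp
next
  case (add a f g)
  then obtain c d where "f = (\<lambda>L. \<Sum>p\<in>nc_pairings a. c p * pairing_vector a p L)"
    "g = (\<lambda>L. \<Sum>p\<in>nc_pairings a. d p * pairing_vector a p L)" by blast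
  then show ?case by (intro exI[of _ "\<lambda>p. c p + d p"]) (simp add: distrib_right sum.distrib)
next
  case (scale a f k)
  then obtain c where "f = (\<lambda>L. \<Sum>p\<in>nc_pairings a. c p * pairing_vector a p L)" by blast
  then show ?case by (intro exI[of _ "\<lambda>p. k * c p"]) (simp add: sum_distrib_left mult.assoc)
qed

section \<open>Linear independence and the Weingarten matrix\<close>


definition openers :: "nat set set \<Rightarrow> nat set" where
  "openers p = {r. \<exists>t>r. {r, t} \<in> p}"

text \<open>An inserted pair is adjacent, and \<open>skip\<close> moves positions by 0 or 2.\<close>

lemma nc_pairings_parity:
  assumes "p \<in> nc_pairings a" "{r, t} \<in> p"
  shows "even r \<longleftrightarrow> odd t"
  using assms
proof (induction arbitrary: r t rule: nc_pairings_induct)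
  case (insert a x b p)
  have even_skip: "even (skip k r) \<longleftrightarrow> even r" for k r by (simp add: skip_def)
  from insert.prems show ?case
  proof (cases rule: pair_in_insert_pairE)
    case (2 r' t')
    then show ?thesis using insert.IH[OF 2(3)] by (simp add: even_skip)
  qed (auto simp: doubleton_eq_iff)
qed simp

lemma openers_pair:
  assumes p: "p \<in> nc_pairings a" and "{r, t} \<in> p" "r < t"
  shows "r \<in> openers p" "t \<notin> openers p"
proof -
  show "r \<in> openers p" using assms by (auto simp: openers_def)
  show "t \<notin> openers p"
  proof
    assume "t \<in> openers p"
    then obtain u where u: "u > t" "{t, u} \<in> p" by (auto simp: openers_def)
    moreover have "{t, r} \<in> p" using assms(2) by (simp add: insert_commute)
    ultimately show False using nc_pairings_unique[OF p, of t u r] assms(3) by simp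
  qed
qed

lemma vimage_skip_openers: "skip k -` openers (insert_pair k p) = openers p"
proof -
  have "(\<exists>t > skip k r. {skip k r, t} \<in> insert_pair k p) \<longleftrightarrow> (\<exists>t > r. {r, t} \<in> p)" for r
  proof
    assume "\<exists>t > skip k r. {skip k r, t} \<in> insert_pair k p"
    then obtain t where t: "t > skip k r" "{skip k r, t} \<in> insert_pair k p" by blast
    from t(2) show "\<exists>t > r. {r, t} \<in> p"
      by (cases rule: pair_in_insert_pairE) (use t(1) in \<open>auto simp: doubleton_eq_iff\<close>)
  next
    assume "\<exists>t > r. {r, t} \<in> p"
    then obtain t where "t > r" "{r, t} \<in> p" by blast
    then show "\<exists>t > skip k r. {skip k r, t} \<in> insert_pair k p"
      by (intro exI[of _ "skip k t"]) (simp add: pair_in_insert_pair)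
  qed
  then show ?thesis by (auto simp: openers_def)
qed

text \<open>As with balanced brackets, the set of left ends determines the pairing: an opener
  followed directly by a closer must be matched with it, and that pair can be removed.\<close>

lemma openers_inj:
  assumes "p \<in> nc_pairings a" "q \<in> nc_pairings a" "openers p = openers q"
  shows "p = q"
  using assms
proof (induction arbitrary: q rule: nc_pairings_induct)
  case (insert a x b p)
  let ?k = "length a" and ?w = "a @ x # flip x # b"
  note q = insert.prems(1)
  have k: "?k \<in> openers q" and Sk: "Suc ?k \<notin> openers q"
    using openers_pair[OF insert_pair_nc_pairings[OF insert.hyps], of ?k "Suc ?k"] insert.prems(2)
    by (simp_all add: insert_pair_def)
  obtain t where t: "t > ?k" "{?k, t} \<in> q" using k by (auto simp: openers_def)
  have "t = Suc ?k"
  proof (rule ccontr)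
    assume neq: "t \<noteq> Suc ?k"
    \<comment> \<open>A closer at \<open>Suc ?k\<close> not matched with \<open>?k\<close> has its
      partner left of \<open>?k\<close>, and this pair would cross the one opened at
      \<open>?k\<close>.\<close>
    obtain s where s: "{Suc ?k, s} \<in> q" "s \<noteq> Suc ?k" by (rule nc_pairings_partner[OF q, of "Suc ?k"]) auto
    then have "\<not> s > Suc ?k" using Sk by (auto simp: openers_def)
    with s(2) have "s < Suc ?k" by simp
    moreover have "s \<noteq> ?k"
    proof
      assume "s = ?k"
      then have "{?k, Suc ?k} \<in> q" using s(1) by (simp add: insert_commute)
      then show False using nc_pairings_unique[OF q t(2)] neq by blast
    qed
    moreover have "noncrossing q" using q by (simp add: nc_pairings_iff)
    ultimately have "{Suc ?k, s} = {?k, t}"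
      using noncrossingD[of q "{Suc ?k, s}" "{?k, t}" s ?k "Suc ?k" t] s t neq by simp
    then show False using neq by (auto simp: doubleton_eq_iff)
  qed
  with t have "{?k, Suc ?k} \<in> q" by simp
  from nc_pairings_split_adjacent[OF q this] obtain a' x' b' q' where
    w: "?w = a' @ x' # flip x' # b'" "length a' = ?k" "q' \<in> nc_pairings (a' @ b')" "q = insert_pair ?k q'" .
  then have "q' \<in> nc_pairings (a @ b)" by simp
  moreover have "openers p = openers q'"
    using vimage_skip_openers[of ?k p] vimage_skip_openers[of ?k q'] insert.prems(2) w(4) by simp
  ultimately show ?case using insert.IH w(4) by simp
qed simp

text \<open>The test vector of \<open>q\<close> marks the openers of \<open>q\<close> by \<open>u\<close> and the other positions by \<open>v\<close>, with the
  two values exchanged at odd positions, because paired positions have opposite parity.\<close>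

lemma pairing_delta_openers:
  assumes p: "p \<in> nc_pairings a" and uv: "u \<noteq> v"
  shows "pairing_delta p (\<lambda>r. if r \<in> U \<longleftrightarrow> even r then u else v) =
    (if \<forall>r t. {r, t} \<in> p \<longrightarrow> (r \<in> U \<longleftrightarrow> t \<notin> U) then 1 else 0)"
proof -
  have "((if r \<in> U \<longleftrightarrow> even r then u else v) = (if t \<in> U \<longleftrightarrow> even t then u else v))
      \<longleftrightarrow> (r \<in> U \<longleftrightarrow> t \<notin> U)" if "{r, t} \<in> p" for r t
    using nc_pairings_parity[OF p that] uv by auto
  then show ?thesis by (auto simp: pairing_delta_def)
qed

lemma sum_openers:
  assumes p: "p \<in> nc_pairings a" and U: "U \<subseteq> {..<length a}"
  shows "\<Sum>U = (\<Sum>b\<in>p. \<Sum>(b \<inter> U))"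
proof -
  have part: "partition_on {..<length a} p" using p by (simp add: nc_pairings_iff)
  have "U = (\<Union>b\<in>p. b \<inter> U)" using part U by (auto simp: partition_on_def)
  then have "\<Sum>U = \<Sum>(\<Union>b\<in>p. b \<inter> U)" by simp
  also have "\<dots> = (\<Sum>b\<in>p. \<Sum>(b \<inter> U))"
  proof (rule sum.UNION_disjoint)
    show "finite p" using part by (rule finite_elements[rotated]) simp
    show "\<forall>b\<in>p. finite (b \<inter> U)" using U by (meson finite_Int finite_lessThan finite_subset)
    show "\<forall>b\<in>p. \<forall>c\<in>p. b \<noteq> c \<longrightarrow> b \<inter> U \<inter> (c \<inter> U) = {}"
      using nc_pairings_eq[OF p] by blast
  qed
  finally show ?thesis .
qed

lemma openers_subset: "p \<in> nc_pairings a \<Longrightarrow> openers p \<subseteq> {..<length a}"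
  using nc_pairings_pairD by (fastforce simp: openers_def)

text \<open>Each block of \<open>p\<close> contains exactly one element of \<open>openers q\<close>,
  while \<open>openers p\<close> takes the smaller element of the block. So the sum for
  \<open>p\<close> is at most the sum for \<open>q\<close>, and equality forces agreement on every
  block.\<close>

lemma openers_minimal:
  assumes p: "p \<in> nc_pairings a" and q: "q \<in> nc_pairings a"
    and split: "\<And>r t. {r, t} \<in> p \<Longrightarrow> (r \<in> openers q \<longleftrightarrow> t \<notin> openers q)"
    and le: "\<Sum>(openers q) \<le> \<Sum>(openers p)"
  shows "p = q"
proof -
  have block: "b \<inter> openers p = b \<inter> openers q \<or> \<Sum>(b \<inter> openers p) < \<Sum>(b \<inter> openers q)" if "b \<in> p" for b
  proof -
    from nc_pairings_blockE[OF p that] obtain r t where b: "b = {r, t}" "r < t" by blast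
    then have "b \<inter> openers p = {r}" using openers_pair[OF p, of r t] that by auto
    moreover have "b \<inter> openers q = {r} \<or> b \<inter> openers q = {t}" using split[of r t] b that by auto
    ultimately show ?thesis using b(2) by auto
  qed
  have fin: "finite p"
    using p finite_elements[of "{..<length a}" p] by (simp add: nc_pairings_iff)
  have eq: "b \<inter> openers p = b \<inter> openers q" if "b \<in> p" for b
  proof (rule ccontr)
    assume "b \<inter> openers p \<noteq> b \<inter> openers q"
    with block[OF that] have "\<Sum>(b \<inter> openers p) < \<Sum>(b \<inter> openers q)" by blast
    moreover have "\<Sum>(c \<inter> openers p) \<le> \<Sum>(c \<inter> openers q)" if "c \<in> p" for c
      using block[OF that] by auto
    ultimately have "(\<Sum>c\<in>p. \<Sum>(c \<inter> openers p)) < (\<Sum>c\<in>p. \<Sum>(c \<inter> openers q))"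
      using fin that by (intro sum_strict_mono_ex1) auto
    then show False
      using le sum_openers[OF p openers_subset[OF p]] sum_openers[OF p openers_subset[OF q]] by simp
  qed
  have "\<Union>p = {..<length a}" using p by (simp add: nc_pairings_iff partition_on_def)
  then have "openers p = openers q"
    using eq openers_subset[OF p] openers_subset[OF q] by blast
  then show ?thesis by (rule openers_inj[OF p q])
qed

definition color :: "letter list \<Rightarrow> (nat \<Rightarrow> 'n) \<Rightarrow> ('n \<times> letter) list" where
  "color a i = map (\<lambda>r. (i r, a ! r)) [0..<length a]"

lemma color_colored [simp]: "color a i \<in> colored a"
  by (simp add: color_def colored_def o_def map_nth)

lemma pairing_vector_color:
  assumes "p \<in> nc_pairings a"
  shows "pairing_vector a p (color a i) = pairing_delta p i"
proof -
  have "fst (color a i ! r) = i r" if "r < length a" for r using that by (simp add: color_def)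
  then have "(\<forall>r t. {r, t} \<in> p \<longrightarrow> fst (color a i ! r) = fst (color a i ! t)) \<longleftrightarrow> (\<forall>r t. {r, t} \<in> p \<longrightarrow> i r = i t)"
    using nc_pairings_pairD[OF assms] by metis
  then show ?thesis by (simp add: pairing_vector_def pairing_delta_def)
qed

text \<open>Ordered by the sum of the openers, the matrix of values on the test vectors is
  triangular. At a pairing \<open>q\<close> of least weight among those with nonzero coefficient,
  only its own term survives.\<close>

lemma pairing_vector_independent:
  fixes c :: "nat set set \<Rightarrow> complex"
  assumes card: "CARD('n::finite) \<ge> 2"
    and zero: "\<And>L :: ('n \<times> letter) list. L \<in> colored a \<Longrightarrow> (\<Sum>p\<in>nc_pairings a. c p * pairing_vector a p L) = 0"
    and p: "p \<in> nc_pairings a"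
  shows "c p = 0"
proof (rule ccontr)
  assume "c p \<noteq> 0"
  \<comment> \<open>The test vectors need two distinct index values.\<close>
  obtain u v :: 'n where uv: "u \<noteq> v"
    using card card_2_iff'[of "UNIV :: 'n set"] by (metis UNIV_I card_le_Suc0_iff_eq finite not_less_eq_eq numeral_2_eq_2)
  define N where "N = {q \<in> nc_pairings a. c q \<noteq> 0}"
  have "finite N" "N \<noteq> {}" using finite_nc_pairings p \<open>c p \<noteq> 0\<close> by (auto simp: N_def)
  then obtain q where q: "q \<in> N" and min: "\<And>p. p \<in> N \<Longrightarrow> \<Sum>(openers q) \<le> \<Sum>(openers p)"
    using ex_min_if_finite[of "(\<lambda>p. \<Sum>(openers p)) ` N"] by (auto simp: not_less)
  let ?i = "\<lambda>r. if r \<in> openers q \<longleftrightarrow> even r then u else v"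
  have qD: "q \<in> nc_pairings a" "c q \<noteq> 0" using q by (auto simp: N_def)
  have "c p * pairing_vector a p (color a ?i) = (if p = q then c q else 0)" if pD: "p \<in> nc_pairings a" for p
  proof (cases "c p = 0")
    case False
    then have le: "\<Sum>(openers q) \<le> \<Sum>(openers p)" using min pD by (simp add: N_def)
    have "(\<forall>r t. {r, t} \<in> p \<longrightarrow> (r \<in> openers q \<longleftrightarrow> t \<notin> openers q)) \<longleftrightarrow> p = q"
    proof
      assume "p = q"
      show "\<forall>r t. {r, t} \<in> p \<longrightarrow> (r \<in> openers q \<longleftrightarrow> t \<notin> openers q)"
      proof (intro allI impI)
        fix r t assume rt: "{r, t} \<in> p"
        then have "r < t \<or> t < r" using nc_pairings_pairD(1)[OF pD] by force
        then show "r \<in> openers q \<longleftrightarrow> t \<notin> openers q"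
          using openers_pair[OF qD(1), of r t] openers_pair[OF qD(1), of t r] rt \<open>p = q\<close>
          by (auto simp: insert_commute)
      qed
    next
      assume "\<forall>r t. {r, t} \<in> p \<longrightarrow> (r \<in> openers q \<longleftrightarrow> t \<notin> openers q)"
      then show "p = q" using openers_minimal[OF pD qD(1) _ le] by blast
    qed
    then show ?thesis
      unfolding pairing_vector_color[OF pD] pairing_delta_openers[OF pD uv] by auto
  qed (use qD in auto)
  then have "(\<Sum>p\<in>nc_pairings a. c p * pairing_vector a p (color a ?i)) = c q"
    using qD(1) finite_nc_pairings[of a] by (simp add: sum.delta' cong: sum.cong)
  with zero[OF color_colored] qD(2) show False by simp
qed

text \<open>The inner product counts the index lists constant on each loop, that is, the functions
  from the set of loops to the indices.\<close>

lemma gram_pairing_vector: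
  assumes p: "p \<in> nc_pairings a" and q: "q \<in> nc_pairings a"
  shows "(\<Sum>L\<in>colored a. pairing_vector a p L * pairing_vector a q (L :: ('n::finite \<times> letter) list)) = gram a CARD('n) p q"
proof -
  define R0 where "R0 = {(r, t). {r, t} \<in> p \<union> q}"
  define R where "R = R0\<^sup>*"
  \<comment> \<open>\<open>R\<close> is an equivalence on all natural numbers; only the classes of
    positions of the word enter \<open>Q\<close>.\<close>
  define Q where "Q = {..<length a} // R"
  have "sym R0" by (auto simp: sym_def R0_def insert_commute)
  then have "sym R" unfolding R_def by (rule sym_rtrancl)
  have equiv: "equiv UNIV R"
    unfolding R_def by (rule equivI) (use \<open>sym R\<close> in \<open>auto simp: R_def refl_on_def trans_rtrancl\<close>)
  have fQ: "finite Q" unfolding Q_def quotient_def by simp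
  define M where "M = {L \<in> colored a :: ('n \<times> letter) list set. \<forall>(r, t)\<in>R0. fst (L ! r) = fst (L ! t)}"
  have "(\<Sum>L\<in>colored a. pairing_vector a p L * pairing_vector a q (L :: ('n \<times> letter) list))
      = (\<Sum>L\<in>(colored a :: ('n \<times> letter) list set). if \<forall>(r, t)\<in>R0. fst (L ! r) = fst (L ! t) then 1 else 0)"
    by (intro sum.cong refl) (auto simp: pairing_vector_def pairing_delta_def R0_def)
  also have "\<dots> = of_nat (card M)"
    by (simp add: M_def sum.If_cases Int_def)
  also have "card M = card (Q \<rightarrow>\<^sub>E (UNIV :: 'n set))"
  proof (rule bij_betw_same_card[symmetric])
    define F where "F f = color a (\<lambda>r. f (R `` {r}))" for f :: "nat set \<Rightarrow> 'n"
    have F: "fst (F f ! r) = f (R `` {r})" if "r < length a" for f r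
      using that by (simp add: F_def color_def)
    show "bij_betw F (Q \<rightarrow>\<^sub>E (UNIV :: 'n set)) M"
    proof (rule bij_betw_imageI)
      show "inj_on F (Q \<rightarrow>\<^sub>E UNIV)"
      proof (rule inj_onI)
        fix f g assume fg: "f \<in> Q \<rightarrow>\<^sub>E (UNIV :: 'n set)" "g \<in> Q \<rightarrow>\<^sub>E UNIV" "F f = F g"
        show "f = g"
        proof (rule PiE_ext[OF fg(1,2)])
          fix C assume "C \<in> Q"
          then obtain r where "r < length a" "C = R `` {r}" by (auto simp: Q_def quotient_def)
          then show "f C = g C" using F[of r f] F[of r g] fg(3) by simp
        qed
      qed
      show "F ` (Q \<rightarrow>\<^sub>E UNIV) = M"
      proof (intro equalityI subsetI)
        fix L assume "L \<in> F ` (Q \<rightarrow>\<^sub>E UNIV)"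
        then obtain f where L: "L = F f" by blast
        have "fst (L ! r) = fst (L ! t)" if "(r, t) \<in> R0" for r t
        proof -
          have "r < length a" "t < length a"
            using that nc_pairings_pairD[OF p] nc_pairings_pairD[OF q] by (auto simp: R0_def)
          moreover have "R `` {r} = R `` {t}"
            using that equiv by (intro equiv_class_eq[OF equiv]) (auto simp: R_def)
          ultimately show ?thesis by (simp add: L F)
        qed
        then show "L \<in> M" by (auto simp: M_def L F_def)
      next
        fix L assume L: "L \<in> M"
        then have Lc: "L \<in> colored a" by (simp add: M_def)
        have const: "fst (L ! r) = fst (L ! t)" if "(r, t) \<in> R" for r t
          using that unfolding R_def by (induction rule: rtrancl_induct) (use L in \<open>auto simp: M_def\<close>)
        define f where "f C = (if C \<in> Q then fst (L ! (SOME r. r \<in> C)) else undefined)" for C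
        have f: "f (R `` {r}) = fst (L ! r)" if "r < length a" for r
        proof -
          have "R `` {r} \<in> Q" using that by (auto simp: Q_def quotient_def)
          moreover have "(SOME t. t \<in> R `` {r}) \<in> R `` {r}"
            by (rule someI[of _ r]) (simp add: R_def)
          ultimately show ?thesis using const[of r "SOME t. t \<in> R `` {r}"] by (simp add: f_def)
        qed
        have "F f = L"
        proof (rule nth_equalityI)
          show "length (F f) = length L" using Lc by (simp add: F_def color_def length_colored)
          fix r assume "r < length (F f)"
          then have r: "r < length a" by (simp add: F_def color_def)
          then have "snd (L ! r) = a ! r" using Lc by (auto simp: colored_def)
          then show "F f ! r = L ! r" using r f[OF r] by (simp add: F_def color_def prod_eq_iff)
        qed
        moreover have "f \<in> Q \<rightarrow>\<^sub>E UNIV" by (auto simp: f_def)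
        ultimately show "L \<in> F ` (Q \<rightarrow>\<^sub>E UNIV)" by blast
      qed
    qed
  qed
  also have "card (Q \<rightarrow>\<^sub>E (UNIV :: 'n set)) = CARD('n) ^ card Q"
    by (rule card_funcsetE[OF fQ])
  finally show ?thesis
    by (simp add: gram_def loops_def Q_def R_def R0_def)
qed

lemma inverse_matrix_on_unique:
  assumes D: "finite D" and W: "inverse_matrix_on D G W" and W': "inverse_matrix_on D G W'"
  shows "W = W'"
proof (intro ext)
  fix p q
  show "W p q = W' p q"
  proof (cases "p \<in> D \<and> q \<in> D")
    case True
    have "W p q = (\<Sum>r\<in>D. W p r * (\<Sum>s\<in>D. G r s * W' s q))"
      using W' True D by (simp add: inverse_matrix_on_def mult_delta_right cong: sum.cong)
    also have "\<dots> = (\<Sum>s\<in>D. (\<Sum>r\<in>D. W p r * G r s) * W' s q)"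
      by (simp add: sum_distrib_left sum_distrib_right mult.assoc) (rule sum.swap)
    also have "\<dots> = W' p q"
      using W True D by (simp add: inverse_matrix_on_def mult_delta_left cong: sum.cong)
    finally show ?thesis .
  next
    case False
    then have "W p q = 0" "W' p q = 0" using W W' unfolding inverse_matrix_on_def by blast+
    then show ?thesis by simp
  qed
qed

lemma gram_commute: "gram a n p q = gram a n q p"
  by (simp add: gram_def loops_def Un_commute)

text \<open>Expanding the frame in the \<xi> writes the projection with some coefficient matrix
  \<open>W\<close>. Since it fixes each \<xi>, independence lets one compare coefficients, which
  says that \<open>W\<close> inverts the Gram matrix.\<close>

lemma fixed_projection_weingarten:
  assumes card: "CARD('n::finite) \<ge> 2" and I: "I \<in> colored a" and J: "J \<in> colored a"
  shows "fixed_projection I (J :: ('n \<times> letter) list) =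
    (\<Sum>p\<in>nc_pairings a. \<Sum>q\<in>nc_pairings a. pairing_vector a p I * pairing_vector a q J * weingarten a CARD('n) p q)"
proof -
  let ?D = "nc_pairings a" and ?\<xi> = "pairing_vector a :: _ \<Rightarrow> ('n \<times> letter) list \<Rightarrow> complex"
  define E where "E = (fixed_frame a :: (('n \<times> letter) list \<Rightarrow> complex) set)"
  have "\<forall>e\<in>E. \<exists>c. e = (\<lambda>L. \<Sum>p\<in>?D. c p * ?\<xi> p L)"
    using fixed_vector_pairing_span[OF fixed_frame] by (auto simp: E_def)
  from bchoice[OF this] obtain \<kappa> where \<kappa>0: "\<forall>e\<in>E. e = (\<lambda>L. \<Sum>p\<in>?D. \<kappa> e p * ?\<xi> p L)" ..
  have \<kappa>: "e L = (\<Sum>p\<in>?D. \<kappa> e p * ?\<xi> p L)" if "e \<in> E" for e L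
    by (rule fun_cong[OF bspec[OF \<kappa>0 that]])
  define W where "W p q = (if p \<in> ?D \<and> q \<in> ?D then \<Sum>e\<in>E. \<kappa> e p * cnj (\<kappa> e q) else 0)" for p q
  have real: "cnj (?\<xi> p L) = ?\<xi> p L" for p L by (simp add: pairing_vector_def pairing_delta_def)
  have proj: "fixed_projection L M = (\<Sum>p\<in>?D. \<Sum>q\<in>?D. ?\<xi> p L * ?\<xi> q M * W p q)" if "L \<in> colored a" for L M
  proof -
    have "fixed_projection L M = (\<Sum>e\<in>E. \<Sum>p\<in>?D. \<Sum>q\<in>?D. ?\<xi> p L * ?\<xi> q M * (\<kappa> e p * cnj (\<kappa> e q)))"
      unfolding fixed_projection_colored[OF that] E_def[symmetric]
      by (intro sum.cong refl) (simp add: \<kappa> sum_product real mult_ac)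
    also have "\<dots> = (\<Sum>p\<in>?D. \<Sum>q\<in>?D. \<Sum>e\<in>E. ?\<xi> p L * ?\<xi> q M * (\<kappa> e p * cnj (\<kappa> e q)))"
      by (subst sum.swap, intro sum.cong refl sum.swap)
    finally show ?thesis by (simp add: W_def sum_distrib_left)
  qed
  let ?G = "gram a CARD('n)"
  have WG: "(\<Sum>r\<in>?D. W p r * ?G r q) = (if p = q then 1 else 0)" if pq: "p \<in> ?D" "q \<in> ?D" for p q
  proof -
    \<comment> \<open>The coefficients of the projection of the vector of \<open>q\<close> minus
      that vector itself.\<close>
    define c where "c p = (\<Sum>r\<in>?D. W p r * ?G r q) - (if p = q then 1 else 0)" for p
    have "c p = 0"
    proof (rule pairing_vector_independent[OF card _ pq(1)])
      fix L :: "('n \<times> letter) list" assume L: "L \<in> colored a"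
      have "?\<xi> q L = (\<Sum>M\<in>colored a. fixed_projection L M * ?\<xi> q M)"
        by (rule fixed_projection_reproducing[OF fixed_vector_pairing_vector[OF pq(2)] L, symmetric])
      also have "\<dots> = (\<Sum>M\<in>colored a. \<Sum>p\<in>?D. \<Sum>r\<in>?D. ?\<xi> p L * W p r * (?\<xi> r M * ?\<xi> q M))"
        by (simp add: proj[OF L] sum_distrib_left sum_distrib_right mult_ac)
      also have "\<dots> = (\<Sum>p\<in>?D. \<Sum>r\<in>?D. \<Sum>M\<in>colored a. ?\<xi> p L * W p r * (?\<xi> r M * ?\<xi> q M))"
        by (subst sum.swap, intro sum.cong refl sum.swap)
      also have "\<dots> = (\<Sum>p\<in>?D. (\<Sum>r\<in>?D. W p r * ?G r q) * ?\<xi> p L)"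
      proof -
        have "(\<Sum>M\<in>colored a. ?\<xi> p L * W p r * (?\<xi> r M * ?\<xi> q M)) = W p r * ?G r q * ?\<xi> p L"
          if "r \<in> ?D" for p r
          unfolding sum_distrib_left[symmetric] gram_pairing_vector[OF that pq(2)] by (simp only: mult_ac)
        then show ?thesis by (simp add: sum_distrib_right)
      qed
      finally have "(\<Sum>p\<in>?D. (\<Sum>r\<in>?D. W p r * ?G r q) * ?\<xi> p L) = ?\<xi> q L" ..
      moreover have "(\<Sum>p\<in>?D. (if p = q then 1 else 0) * ?\<xi> p L) = ?\<xi> q L"
        using pq(2) finite_nc_pairings[of a] by (simp add: mult_delta_left)
      ultimately show "(\<Sum>p\<in>?D. c p * ?\<xi> p L) = 0"
        by (simp only: c_def left_diff_distrib sum_subtractf diff_self)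
    qed
    then show ?thesis by (simp add: c_def)
  qed
  have W_cnj: "cnj (W p q) = W q p" for p q by (simp add: W_def mult.commute)
  have G_cnj: "cnj (?G p q) = ?G q p" for p q
    by (subst gram_commute) (simp add: gram_def)
  have GW: "(\<Sum>r\<in>?D. ?G p r * W r q) = (if p = q then 1 else 0)" if "p \<in> ?D" "q \<in> ?D" for p q
  proof -
    \<comment> \<open>Both matrices are Hermitian, so conjugation turns the left inverse into a
      right inverse.\<close>
    have "(\<Sum>r\<in>?D. ?G p r * W r q) = cnj (\<Sum>r\<in>?D. W q r * ?G r p)"
      by (simp add: W_cnj G_cnj mult.commute)
    then show ?thesis using WG[OF that(2,1)] by auto
  qed
  have "inverse_matrix_on ?D ?G W"
    unfolding inverse_matrix_on_def using WG GW by (auto simp: W_def)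
  then have "weingarten a CARD('n) = W"
    unfolding weingarten_def using inverse_matrix_on_unique[OF finite_nc_pairings] by (intro the_equality) auto
  then show ?thesis using proj[OF I] by simp
qed

lemma word_product_entry: "word_product v a i j = entry v (color a i) (color a j)"
proof -
  have "entry v (map (\<lambda>r. (i r, a ! r)) rs) (map (\<lambda>r. (j r, a ! r)) rs)
      = prod_list (map (\<lambda>r. letter_pow (v (i r) (j r)) (a ! r)) rs)" for rs
    by (induction rs) (simp_all add: entry_Cons)
  then show ?thesis by (simp add: word_product_def color_def)
qed

theorem theorem9p5:
  fixes v :: "'n::finite \<Rightarrow> 'n \<Rightarrow> 'a::cstar_algebra"
    and \<iota>\<^sub>1 \<iota>\<^sub>2 \<Delta> :: "'a \<Rightarrow> 't::cstar_algebra"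
    and h :: "'a \<Rightarrow> complex"
  assumes "CARD('n) \<ge> 2"
    and "is_Au v"
    and "cstar_tensor \<iota>\<^sub>1 \<iota>\<^sub>2"
    and "comultiplication v \<iota>\<^sub>1 \<iota>\<^sub>2 \<Delta>"
    and "haar_functional \<iota>\<^sub>1 \<iota>\<^sub>2 \<Delta> h"
  shows "(\<forall>(a :: letter list) i j. count_list a Alpha = count_list a Beta \<longrightarrow>
            h (word_product v a i j) =
              (\<Sum>p\<in>nc_pairings a. \<Sum>q\<in>nc_pairings a.
                 pairing_delta p i * pairing_delta q j * weingarten a CARD('n) p q)) \<and>
         (\<forall>(a :: letter list) i j. count_list a Alpha \<noteq> count_list a Beta \<longrightarrow>
            h (word_product v a i j) = 0)"
proof -
  \<comment> \<open>The formula holds for every word; for an unbalanced one the sum is empty, which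
    is the second claim.\<close>
  have *: "h (word_product v a i j) = (\<Sum>p\<in>nc_pairings a. \<Sum>q\<in>nc_pairings a.
      pairing_delta p i * pairing_delta q j * weingarten a CARD('n) p q)" for a i j
    using haar_entry[OF assms(2-5) color_colored color_colored, of a i j]
      fixed_projection_weingarten[OF assms(1) color_colored color_colored, of a i j]
    by (simp add: word_product_entry pairing_vector_color)
  moreover have "nc_pairings a = {}" if "count_list a Alpha \<noteq> count_list a Beta" for a
    using that nc_pairings_balanced by blast
  ultimately show ?thesis by simp
qed

end
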